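(* Let $G$ be a 2-connected claw-o-heavy graph of order $n$. If for every induced path $v_1v_2v_3v_4v_5v_6$ on six vertices in $G$ we have $\max\{d(v_1),d(v_6)\}\geq n/2$, then $G$ is hamiltonian.
   Context: Graphs are finite, simple and undirected; $d(v)$ is the degree of $v$ in $G$. A graph $G$ on $n$ vertices is claw-o-heavy if every induced subgraph of $G$ isomorphic to $K_{1,3}$ contains two nonadjacent vertices $u,v$ with $d(u)+d(v)\geq n$. An induced path $v_1\cdots v_6$ means an induced subgraph isomorphic to $P_6$ with edges $v_kv_{k+1}$. *)

theory Defs
  imports "Graph_Theory.Graph_Theory" Complex_Main
begin

text \<open>
  A finite simple undirected graph is a \<^locale>\<open>pair_graph\<close>: each edge is represented by the two
  opposite arcs between its ends. Hence the degree of a vertex is its out-degree.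
\<close>

definition vertex_degree :: "'a pair_pre_digraph \<Rightarrow> 'a \<Rightarrow> nat" where
  "vertex_degree G v = out_degree (with_proj G) v"

text \<open>
  As usual, a k-connected graph has more than k vertices, so that the complete graph on two
  vertices is not 2-connected.
\<close>

definition k_connected :: "nat \<Rightarrow> 'a pair_pre_digraph \<Rightarrow> bool" where
  "k_connected k G \<longleftrightarrow> k < card (pverts G) \<and>
     (\<forall>X \<subseteq> pverts G. card X < k \<longrightarrow>
        Digraph_Component.connected (with_proj G \<restriction> (pverts G - X)))"

definition claw_o_heavy :: "'a pair_pre_digraph \<Rightarrow> bool" where
  "claw_o_heavy G \<longleftrightarrow>
     (\<forall>H. induced_subgraph H (with_proj G) \<and> K\<^bsub>1,3\<^esub> H \<longrightarrow>
        (\<exists>u \<in> verts H. \<exists>v \<in> verts H. u \<noteq> v \<and> (u, v) \<notin> parcs G \<and>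
           vertex_degree G u + vertex_degree G v \<ge> card (pverts G)))"

definition induced_path :: "'a pair_pre_digraph \<Rightarrow> 'a list \<Rightarrow> bool" where
  "induced_path G vs \<longleftrightarrow> distinct vs \<and> set vs \<subseteq> pverts G \<and>
     arcs (with_proj G \<restriction> set vs) =
       {(vs ! i, vs ! j) | i j. i < length vs \<and> j < length vs \<and> (j = Suc i \<or> i = Suc j)}"

text \<open>
  The bound on the length is needed because \<^const>\<open>pre_digraph.cycle\<close> also accepts the closed walk
  that traverses one edge back and forth.
\<close>

definition hamiltonian :: "'a pair_pre_digraph \<Rightarrow> bool" where
  "hamiltonian G \<longleftrightarrow>
     (\<exists>p. pre_digraph.cycle (with_proj G) p \<and> 3 \<le> length p \<and> fst ` set p = pverts G)"

end

theory Submission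
  imports Defs
begin

text \<open>
  Call two vertices H-adjacent if they are adjacent or their degree sum is at least n. Every cycle
  in H can be turned into a cycle in G through at least the same vertices, so the maximality of a
  longest cycle C of G is contradicted by any longer cycle in H. If C is not spanning,
  2-connectivity yields a shortest path R outside C joining two vertices x1 and x2 of C. At each of
  them the claw condition makes the two neighbours on C H-adjacent, and the resulting triangles are
  enlarged along C as long as they stay cliques in H. Many pairs of vertices are then not
  H-adjacent, because otherwise C could be rerouted through R. If the vertices of C next to the two
  cliques are light in the right places, an induced path on six vertices with two light ends runs
  along R; where they are heavy, H-adjacent vertices that are not adjacent have so many common
  neighbours that one of these completes such a path.
\<close>

section \<open>Paths, cycles and heavy pairs\<close>

text \<open>Let \<open>c\<close>, \<open>e\<close> be the first and last vertex of \<open>S1\<close>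
  and \<open>d\<close>, \<open>f\<close> those of \<open>S2\<close>; the first node is next to
  \<open>c\<close> and \<open>d\<close>, the second next to \<open>e\<close> and \<open>f\<close>.
  The final clash concerns these four. One of \<open>c\<close>, \<open>f\<close> is heavy and one of
  \<open>d\<close>, \<open>e\<close> is heavy, but neither two vertices next to the same node
  (\<open>c d\<close>, \<open>e f\<close>) nor the two ends of one segment (\<open>c e\<close>,
  \<open>d f\<close>) are both heavy. The obstacle is that an H-adjacent pair with large degree sum
  may fail to be an edge, so it serves in cycles but not in induced paths. A common neighbour takes
  its place there, and its other adjacencies have to be controlled by counting. A nonadjacent
  H-adjacent pair with \<open>k\<close> common non-neighbours has at least \<open>2 + k\<close>
  common neighbours. On the other side, an H-path with more vertices than a longest cycle has ends
  with at most two common neighbours, apart from vertices where the path may leave the edges of the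
  graph. Enough common non-neighbours therefore leave a common neighbour without the unwanted
  adjacencies; this is the origin of the small constants 2, 3 and 5 below.\<close>

definition hpath :: "('a \<Rightarrow> 'a \<Rightarrow> bool) \<Rightarrow> 'a set \<Rightarrow> 'a \<Rightarrow> 'a \<Rightarrow> bool" where
  "hpath E A u v \<longleftrightarrow>
     (\<exists>P. P \<noteq> [] \<and> hd P = u \<and> last P = v \<and> distinct P \<and> successively E P \<and> set P = A)"

definition cyc :: "('a \<Rightarrow> 'a \<Rightarrow> bool) \<Rightarrow> 'a set \<Rightarrow> bool" where
  "cyc E A \<longleftrightarrow> (\<exists>u v. hpath E A u v \<and> E v u \<and> 3 \<le> card A)"

lemma hpI: "P \<noteq> [] \<Longrightarrow> distinct P \<Longrightarrow> successively E P \<Longrightarrow> hpath E (set P) (hd P) (last P)"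
  unfolding hpath_def by blast

lemma hpath_single [simp]: "hpath E {u} u u"
  unfolding hpath_def by (rule exI[of _ "[u]"]) simp

lemma hpath_join:
  assumes "hpath E A u v" "hpath E B w z" "E v w" "A \<inter> B = {}"
  shows "hpath E (A \<union> B) u z"
proof -
  obtain P where P: "P \<noteq> []" "hd P = u" "last P = v" "distinct P" "successively E P" "set P = A"
    using assms(1) unfolding hpath_def by blast
  obtain Q where Q: "Q \<noteq> []" "hd Q = w" "last Q = z" "distinct Q" "successively E Q" "set Q = B"
    using assms(2) unfolding hpath_def by blast
  show ?thesis unfolding hpath_def
    by (rule exI[of _ "P @ Q"]) (use P Q assms in \<open>auto simp: successively_append_iff\<close>)
qed

lemma successively_rev_sym: "symp E \<Longrightarrow> successively E (rev P) \<longleftrightarrow> successively E P"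
  unfolding successively_rev by (metis successively_mono sympD)

lemma hpath_rev:
  assumes "symp E" "hpath E A u v"
  shows "hpath E A v u"
proof -
  obtain P where P: "P \<noteq> []" "hd P = u" "last P = v" "distinct P" "successively E P" "set P = A"
    using assms(2) unfolding hpath_def by blast
  have "successively E (rev P)"
    using P(5) successively_rev_sym[OF assms(1)] by blast
  then show ?thesis unfolding hpath_def
    by (intro exI[of _ "rev P"]) (use P in \<open>auto simp: hd_rev last_rev\<close>)
qed

lemma hpath_finite: "hpath E A u v \<Longrightarrow> finite A"
  and hpath_hd_in: "hpath E A u v \<Longrightarrow> u \<in> A"
  and hpath_last_in: "hpath E A u v \<Longrightarrow> v \<in> A"
  unfolding hpath_def by auto

lemma hpath_mono: "hpath E A u v \<Longrightarrow> (\<And>x y. E x y \<Longrightarrow> E' x y) \<Longrightarrow> hpath E' A u v"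
  unfolding hpath_def by (metis successively_mono)

lemma hpath_snoc: "hpath E A u v \<Longrightarrow> E v w \<Longrightarrow> w \<notin> A \<Longrightarrow> hpath E (insert w A) u w"
  using hpath_join[of E A u v "{w}" w w] by simp

lemma hpath_Cons: "hpath E A u v \<Longrightarrow> E w u \<Longrightarrow> w \<notin> A \<Longrightarrow> hpath E (insert w A) w v"
  using hpath_join[of E "{w}" w w A u v] by simp

lemma cyc_mono: "cyc E A \<Longrightarrow> (\<And>x y. E x y \<Longrightarrow> E' x y) \<Longrightarrow> cyc E' A"
  unfolding cyc_def by (meson hpath_mono)

text \<open>In a distinct list of length at least 3 the first and the last entry are not
  consecutive, so the one pair that \<open>E'\<close> may add to \<open>E\<close> is never a step of
  \<open>Q\<close>.\<close>

lemma successively_drop_closing_edge: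
  assumes "successively E' Q" "distinct Q" "3 \<le> length Q"
    and "\<And>x y. E' x y \<Longrightarrow> \<not> E x y \<Longrightarrow> {x, y} = {hd Q, last Q}"
  shows "successively E Q"
  unfolding successively_conv_nth
proof (intro allI impI)
  fix i assume i: "Suc i < length Q"
  have ne: "Q \<noteq> []" using assms(3) by auto
  have "E' (Q ! i) (Q ! Suc i)" using assms(1) i by (simp add: successively_conv_nth)
  moreover have "{Q ! i, Q ! Suc i} \<noteq> {hd Q, last Q}"
  proof
    assume eq: "{Q ! i, Q ! Suc i} = {hd Q, last Q}"
    have "hd Q = Q ! 0" "last Q = Q ! (length Q - 1)" using ne by (simp_all add: hd_conv_nth last_conv_nth)
    then have "Q ! 0 \<in> {Q ! i, Q ! Suc i}" "Q ! (length Q - 1) \<in> {Q ! i, Q ! Suc i}" using eq by auto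
    then have "i = 0 \<or> Suc i = 0" "length Q - 1 = i \<or> length Q - 1 = Suc i"
      using assms(2) i ne by (auto simp: nth_eq_iff_index_eq)
    then show False using assms(3) i by auto
  qed
  ultimately show "E (Q ! i) (Q ! Suc i)" using assms(4) by blast
qed

text \<open>Cutting the cycle open at the one added pair leaves a path between \<open>u\<close> and
  \<open>v\<close> through all of \<open>A\<close>; a cycle that avoids the pair survives in
  \<open>E\<close>.\<close>

lemma cycle_or_path_avoiding_edge:
  assumes "symp E'" "cyc E' A" and E: "\<And>x y. E' x y \<Longrightarrow> \<not> E x y \<Longrightarrow> {x, y} = {u, v}"
  shows "cyc E A \<or> hpath E A u v \<or> hpath E A v u"
proof -
  obtain P where P: "P \<noteq> []" "distinct P" "successively E' P" "set P = A" "E' (last P) (hd P)" "3 \<le> card A"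
    using assms(2) unfolding cyc_def hpath_def by blast
  have len: "3 \<le> length P" using P by (metis distinct_card)
  have main: "hpath E A u v \<or> hpath E A v u"
    if Q: "distinct Q" "successively E' Q" "set Q = A" "{hd Q, last Q} = {u, v}" for Q
  proof -
    have "length Q = length P" using Q P by (metis distinct_card)
    then have "successively E Q"
      using successively_drop_closing_edge[of E' Q E] Q E len by auto
    moreover have "Q \<noteq> []" using Q(3) P by auto
    ultimately have "hpath E A (hd Q) (last Q)" using Q hpI by metis
    then show ?thesis using Q(4) by (auto simp: doubleton_eq_iff)
  qed
  show ?thesis
  proof (cases "{last P, hd P} = {u, v}")
    case True
    then show ?thesis using main[of P] P by (auto simp: insert_commute)
  next
    case False
    then have cl: "E (last P) (hd P)" using P E by blast
    show ?thesis
    proof (cases "successively E P")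
      case True
      then show ?thesis using P cl hpI[of P E] unfolding cyc_def by metis
    next
      case False
      then obtain i where i: "Suc i < length P" "\<not> E (P ! i) (P ! Suc i)"
        by (auto simp: successively_conv_nth)
      have E'i: "E' (P ! i) (P ! Suc i)" using P(3) i by (simp add: successively_conv_nth)
      \<comment> \<open>The rotation that turns the pair at position \<open>i\<close> into the
        closing pair.\<close>
      let ?Q = "drop (Suc i) P @ take (Suc i) P"
      have "P = take (Suc i) P @ drop (Suc i) P" by simp
      then have "successively E' (take (Suc i) P)" "successively E' (drop (Suc i) P)"
        using P(3) by (metis successively_append_iff)+
      moreover have "last (drop (Suc i) P) = last P" "hd (take (Suc i) P) = hd P" using i P(1) by auto
      ultimately have "successively E' ?Q" using P by (auto simp: successively_append_iff)
      moreover have "distinct ?Q" using P(2) by (metis distinct_append distinct_rotate rotate_append append_take_drop_id)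
      moreover have "set ?Q = A" using P(4) by (metis set_append Un_commute append_take_drop_id)
      moreover have "hd ?Q = P ! Suc i" using i by (simp add: hd_drop_conv_nth)
      moreover have "last ?Q = P ! i" using i P(1)
        by (metis Suc_lessD last_appendR last_snoc snoc_eq_iff_butlast take_Suc_conv_app_nth)
      ultimately show ?thesis using main[of ?Q] E E'i i(2) by (metis insert_commute)
    qed
  qed
qed

text \<open>The exchange argument of Ore, in the form of Bondy and Chvatal: the path closes up
  without the edge \<open>u v\<close>. \<open>B\<close> exceeds \<open>A\<close> by one vertex when
  the ends have a common neighbour off the path.\<close>

lemma hpath_closing_edge:
  assumes "symp E" "irreflp E" and E: "\<And>x y. E x y \<Longrightarrow> x \<in> V" and V: "finite V" "u \<in> V" "v \<in> V"
    and "u \<noteq> v"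
    and deg: "card V \<le> card {y. E u y} + card {y. E v y}"
    and hpath: "hpath E A u v" "3 \<le> card A" and "A \<subseteq> V"
  shows "\<exists>B. A \<subseteq> B \<and> cyc E B"
proof (cases "\<exists>y. y \<notin> A \<and> E u y \<and> E v y")
  case True
  then obtain y where y: "y \<notin> A" "E u y" "E v y" by blast
  have "hpath E (insert y A) u y" using hpath_snoc[OF hpath(1)] y by auto
  then have "cyc E (insert y A)" unfolding cyc_def
    using y sympD[OF assms(1)] hpath(2) hpath_finite[OF hpath(1)] by (metis card_insert_disjoint le_SucI)
  then show ?thesis by blast
next
  case False
  obtain P where P: "P \<noteq> []" "hd P = u" "last P = v" "distinct P" "successively E P" "set P = A"
    using hpath(1) unfolding hpath_def by blast
  let ?m = "length P"
  have m: "?m = card A" using P distinct_card by metis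
  have u0: "P ! 0 = u" "P ! (?m - 1) = v" using P by (simp_all add: hd_conv_nth last_conv_nth flip: P(2,3))
  let ?Nu = "{y. E u y}" and ?Nv = "{y. E v y}"
  have sub: "?Nu \<subseteq> V" "?Nv \<subseteq> V" using E sympD[OF assms(1)] by blast+
  then have fin: "finite ?Nu" "finite ?Nv" using V finite_subset by blast+
  \<comment> \<open>A position in both sets gives two crossing chords. There are
    \<open>?m - 1\<close> positions, while the neighbours off the path are disjoint and fill at most
    \<open>card V - card A\<close> vertices, so \<open>?I\<close> and \<open>?J\<close> have at
    least \<open>?m\<close> elements together.\<close>
  let ?I = "{i. i < ?m - 1 \<and> E u (P ! Suc i)}" and ?J = "{i. i < ?m - 1 \<and> E v (P ! i)}"
  have "?Nu \<inter> A \<subseteq> (\<lambda>i. P ! Suc i) ` ?I"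
  proof
    fix y assume y: "y \<in> ?Nu \<inter> A"
    then obtain j where j: "j < ?m" "P ! j = y" using P(6) by (metis IntD2 in_set_conv_nth)
    have "j \<noteq> 0" using j y u0 assms(2) by (metis IntD1 irreflpD mem_Collect_eq)
    then obtain k where "j = Suc k" using not0_implies_Suc by blast
    then show "y \<in> (\<lambda>i. P ! Suc i) ` ?I" using j y by (intro image_eqI[of _ _ k]) auto
  qed
  then have cI: "card (?Nu \<inter> A) \<le> card ?I" by (rule surj_card_le[rotated]) simp
  have "?Nv \<inter> A \<subseteq> (\<lambda>i. P ! i) ` ?J"
  proof
    fix y assume y: "y \<in> ?Nv \<inter> A"
    then obtain j where j: "j < ?m" "P ! j = y" using P(6) by (metis IntD2 in_set_conv_nth)
    have "j \<noteq> ?m - 1" using j y u0 assms(2) by (metis IntD1 irreflpD mem_Collect_eq)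
    then show "y \<in> (\<lambda>i. P ! i) ` ?J" using j y by (intro image_eqI[of _ _ j]) auto
  qed
  then have cJ: "card (?Nv \<inter> A) \<le> card ?J" by (rule surj_card_le[rotated]) simp
  have "card (?Nu - A) + card (?Nv - A) = card ((?Nu - A) \<union> (?Nv - A))"
    using fin False by (subst card_Un_disjoint) auto
  also have "\<dots> \<le> card (V - A)" using sub V by (intro card_mono) auto
  also have "\<dots> = card V - card A" using \<open>A \<subseteq> V\<close> V by (simp add: card_Diff_subset finite_subset)
  finally have "card (?Nu - A) + card (?Nv - A) \<le> card V - card A" .
  moreover have "card ?Nu = card (?Nu \<inter> A) + card (?Nu - A)" "card ?Nv = card (?Nv \<inter> A) + card (?Nv - A)"
    using fin by (auto simp: card_Int_Diff)
  moreover have "card A \<le> card V" using \<open>A \<subseteq> V\<close> V card_mono by blast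
  ultimately have "card A \<le> card ?I + card ?J" using deg cI cJ by linarith
  then have "?m - 1 < card ?I + card ?J" using m hpath(2) by linarith
  moreover have "card (?I \<union> ?J) \<le> ?m - 1" using card_mono[of "{..<?m - 1}" "?I \<union> ?J"] by auto
  ultimately have "card (?I \<inter> ?J) \<noteq> 0" using card_Un_Int[of ?I ?J] by auto
  then obtain i where i: "i < ?m - 1" "E u (P ! Suc i)" "E v (P ! i)" by (auto simp: card_gt_0_iff)
  \<comment> \<open>From \<open>u\<close> up to position \<open>i\<close>, by a chord to the end
    \<open>v\<close>, and backwards to position \<open>i + 1\<close>, which is a neighbour of
    \<open>u\<close>.\<close>
  let ?Q = "take (Suc i) P @ rev (drop (Suc i) P)"
  have PQ: "P = take (Suc i) P @ drop (Suc i) P" by simp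
  have ne: "drop (Suc i) P \<noteq> []" using i by auto
  have s: "successively E (take (Suc i) P)" "successively E (drop (Suc i) P)"
    using P(5) PQ by (metis successively_append_iff)+
  have l: "last (take (Suc i) P) = P ! i" using i by (simp add: take_Suc_conv_app_nth)
  have "successively E (rev (drop (Suc i) P))" using s(2) successively_rev_sym[OF assms(1)] by blast
  moreover have "E (P ! i) v" using i(3) sympD[OF assms(1)] by blast
  ultimately have "successively E ?Q" using s l ne i P(3)
    by (simp add: successively_append_iff hd_rev)
  moreover have "distinct ?Q" using P(4) PQ by (metis distinct_append distinct_rev set_rev)
  moreover have "set ?Q = A" using P(6) PQ by (metis set_append set_rev)
  moreover have "hd ?Q = u" using P by simp
  moreover have "last ?Q = P ! Suc i" using ne i by (simp add: last_rev hd_drop_conv_nth)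
  ultimately have "cyc E A" unfolding cyc_def using hpI[of ?Q E] i hpath(2) sympD[OF assms(1)] P(1)
    by (metis append_is_Nil_conv take_eq_Nil nat.distinct(1))
  then show ?thesis by blast
qed

lemma cyc_subset_verts: "cyc E A \<Longrightarrow> (\<And>x y. E x y \<Longrightarrow> x \<in> V) \<Longrightarrow> A \<subseteq> V"
proof
  fix x assume "cyc E A" and E: "\<And>x y. E x y \<Longrightarrow> x \<in> V" and x: "x \<in> A"
  then obtain P where P: "P \<noteq> []" "successively E P" "set P = A" "E (last P) (hd P)"
    unfolding cyc_def hpath_def by blast
  obtain i where i: "i < length P" "P ! i = x" using x P(3) by (metis in_set_conv_nth)
  show "x \<in> V"
  proof (cases "Suc i < length P")
    case True
    then show ?thesis using P(2) i E by (metis successively_conv_nth)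
  next
    case False
    then have "i = length P - 1" using i by auto
    then have "x = last P" using i P by (simp add: last_conv_nth)
    then show ?thesis using P E by blast
  qed
qed

locale sgraph =
  fixes V :: "'a set" and ad :: "'a \<Rightarrow> 'a \<Rightarrow> bool"
  assumes finV [simp]: "finite V"
    and ad_sym: "ad u v \<Longrightarrow> ad v u"
    and ad_irr [simp]: "\<not> ad u u"
    and ad_V: "ad u v \<Longrightarrow> u \<in> V"
begin

definition dg :: "'a \<Rightarrow> nat" where "dg v = card {u. ad v u}"

definition H :: "'a \<Rightarrow> 'a \<Rightarrow> bool" where
  "H u v \<longleftrightarrow> u \<in> V \<and> v \<in> V \<and> u \<noteq> v \<and> (ad u v \<or> card V \<le> dg u + dg v)"

definition heavy :: "'a \<Rightarrow> bool" where "heavy v \<longleftrightarrow> card V \<le> 2 * dg v"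

lemma ad_commute: "ad u v \<longleftrightarrow> ad v u" using ad_sym by blast

lemma H_commute: "H u v \<longleftrightarrow> H v u" unfolding H_def using ad_sym by (auto simp: add.commute)

lemma H_sym: "H u v \<Longrightarrow> H v u" using H_commute by blast

lemma symp_H [simp]: "symp H" using H_sym by (simp add: symp_def)
lemma symp_ad [simp]: "symp ad" using ad_sym by (simp add: symp_def)

lemma H_irr [simp]: "\<not> H u u" unfolding H_def by simp

lemma ad_H: "ad u v \<Longrightarrow> H u v" unfolding H_def using ad_V ad_sym ad_irr by metis

lemma H_V: "H u v \<Longrightarrow> u \<in> V" and H_V2: "H u v \<Longrightarrow> v \<in> V" unfolding H_def by simp_all

lemma nb_V: "{u. ad v u} \<subseteq> V" using ad_V ad_sym by blast

lemma fin_nb [simp]: "finite {u. ad v u}" using nb_V finV finite_subset by blast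

lemma heavy_H: "heavy u \<Longrightarrow> heavy v \<Longrightarrow> u \<in> V \<Longrightarrow> v \<in> V \<Longrightarrow> u \<noteq> v \<Longrightarrow> H u v"
  unfolding heavy_def H_def by auto

lemma light_H_ad: "H u v \<Longrightarrow> \<not> heavy u \<Longrightarrow> \<not> heavy v \<Longrightarrow> ad u v"
  unfolding heavy_def H_def by auto

text \<open>The two neighbourhoods have total size at least \<open>card V\<close>, but their union
  misses \<open>u\<close>, \<open>v\<close> and \<open>Os\<close>. Each common non-neighbour thus
  buys one more common neighbour.\<close>

lemma common_nb_card:
  assumes "H u v" "\<not> ad u v" and "Os \<subseteq> V" "\<And>z. z \<in> Os \<Longrightarrow> \<not> ad u z \<and> \<not> ad v z \<and> z \<noteq> u \<and> z \<noteq> v"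
  shows "2 + card Os \<le> card {y. ad u y \<and> ad v y}"
proof -
  let ?Nu = "{y. ad u y}" and ?Nv = "{y. ad v y}"
  have uv: "u \<in> V" "v \<in> V" "u \<noteq> v" using assms(1) unfolding H_def by auto
  have fO: "finite Os" using assms(3) finV finite_subset by blast
  have "?Nu \<union> ?Nv \<subseteq> V - ({u, v} \<union> Os)"
    using assms(2,4) nb_V[of u] nb_V[of v] ad_commute[of v u] by auto
  then have "card (?Nu \<union> ?Nv) \<le> card (V - ({u, v} \<union> Os))" by (intro card_mono) auto
  also have "\<dots> = card V - card ({u, v} \<union> Os)" using uv assms(3) fO by (intro card_Diff_subset) auto
  also have "card ({u, v} \<union> Os) = 2 + card Os"
    using uv(3) fO assms(4) by (subst card_Un_disjoint) auto
  finally have "card (?Nu \<union> ?Nv) \<le> card V - (2 + card Os)" .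
  moreover have "card ?Nu + card ?Nv = card (?Nu \<union> ?Nv) + card (?Nu \<inter> ?Nv)" by (intro card_Un_Int) auto
  moreover have "card V \<le> card ?Nu + card ?Nv" using assms(1,2) unfolding H_def dg_def by auto
  moreover have "2 + card Os \<le> card V"
    using \<open>card ({u, v} \<union> Os) = 2 + card Os\<close> uv assms(3) by (metis card_mono finV insert_subset Un_least empty_subsetI)
  moreover have "?Nu \<inter> ?Nv = {y. ad u y \<and> ad v y}" by auto
  ultimately show ?thesis by simp
qed

text \<open>The heavy pairs are added one at a time, as in the closure of Bondy and Chvatal.\<close>

lemma cyc_H_ad: "cyc H A \<Longrightarrow> \<exists>B. A \<subseteq> B \<and> cyc ad B"
proof -
  define EF where "EF F x y \<longleftrightarrow> ad x y \<or> (x, y) \<in> F \<or> (y, x) \<in> F" for F x y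
  have main: "cyc (EF F) A \<Longrightarrow> \<exists>B. A \<subseteq> B \<and> cyc ad B" if "finite F" "F \<subseteq> {(x, y). H x y}" for F A
    using that
  proof (induction F arbitrary: A)
    case empty
    then show ?case by (auto simp: EF_def)
  next
    case (insert e F)
    obtain u v where e: "e = (u, v)" by force
    have uv: "H u v" using insert.prems(2) e by auto
    have FH: "F \<subseteq> {(x, y). H x y}" using insert.prems by auto
    have s: "symp (EF F)" "symp (EF (insert e F))" unfolding symp_def EF_def using ad_sym by auto
    have i: "irreflp (EF F)" unfolding irreflp_def EF_def using FH by auto
    have EV: "EF F x y \<Longrightarrow> x \<in> V" for x y using FH ad_V H_V H_V2 by (auto simp: EF_def)
    have EV': "EF (insert e F) x y \<Longrightarrow> x \<in> V" for x y
      using insert.prems(2) ad_V H_V H_V2 by (auto simp: EF_def)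
    have uv': "u \<in> V" "v \<in> V" "u \<noteq> v" using uv unfolding H_def by auto
    have "cyc (EF F) A \<or> hpath (EF F) A u v \<or> hpath (EF F) A v u"
      by (rule cycle_or_path_avoiding_edge[OF s(2) insert.prems(1)]) (auto simp: EF_def e)
    then have "cyc (EF F) A \<or> hpath (EF F) A u v" using hpath_rev[OF s(1)] by blast
    then show ?case
    proof
      assume "cyc (EF F) A"
      then show ?case using insert.IH FH by blast
    next
      assume h: "hpath (EF F) A u v"
      show ?case
      proof (cases "ad u v")
        case True
        have "cyc (EF F) A" unfolding cyc_def using h True ad_sym insert.prems(1)
          by (metis EF_def cyc_def)
        then show ?thesis using insert.IH FH by blast
      next
        case False
        \<comment> \<open>\<open>H\<close> refers to degrees in the graph itself; added pairs only
          raise degrees, so the degree condition holds at every stage.\<close>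
        have le: "dg x \<le> card {y. EF F x y}" for x unfolding dg_def
          using EV s(1) by (intro card_mono finite_subset[OF _ finV]) (auto simp: EF_def dest: sympD)
        have deg: "card V \<le> card {y. EF F u y} + card {y. EF F v y}"
          using uv False le[of u] le[of v] unfolding H_def by auto
        have A: "A \<subseteq> V" using insert.prems(1) by (rule cyc_subset_verts) (rule EV')
        have c3: "3 \<le> card A" using insert.prems(1) unfolding cyc_def by auto
        have "\<exists>B. A \<subseteq> B \<and> cyc (EF F) B"
          by (rule hpath_closing_edge[of "EF F" V u v]) (fact s(1) i EV finV uv' deg h c3 A)+
        then obtain B where "A \<subseteq> B" "cyc (EF F) B" by blast
        then show ?thesis using insert.IH[OF _ FH] by (meson subset_trans)
      qed
    qed
  qed
  let ?F = "{(x, y). H x y}"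
  have "?F \<subseteq> V \<times> V" using H_V H_V2 by auto
  then have "finite ?F" using finV by (meson finite_SigmaI finite_subset)
  moreover assume "cyc H A"
  then have "cyc (EF ?F) A" by (rule cyc_mono) (auto simp: EF_def)
  ultimately show ?thesis using main[of ?F A] by blast
qed

end

section \<open>Cycles of maximum order\<close>

text \<open>An entry of \<open>L\<close> consists of a vertex set, a first and a last vertex. A
  rerouted cycle is written as a list of such pieces, and its order is read off from their
  cardinalities.\<close>

lemma hpath_pieces:
  assumes "L \<noteq> []" "\<forall>x \<in> set L. hpath E (fst x) (fst (snd x)) (snd (snd x))"
    "successively (\<lambda>x y. E (snd (snd x)) (fst (snd y))) L"
    "sorted_wrt (\<lambda>x y. fst x \<inter> fst y = {}) L"
  shows "hpath E (\<Union>x \<in> set L. fst x) (fst (snd (hd L))) (snd (snd (last L))) \<and>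
    card (\<Union>x \<in> set L. fst x) = (\<Sum>x \<leftarrow> L. card (fst x))"
  using assms
proof (induction L rule: list_nonempty_induct)
  case (single x)
  then show ?case by simp
next
  case (cons x L)
  let ?U = "\<Union>x \<in> set L. fst x"
  have IH: "hpath E ?U (fst (snd (hd L))) (snd (snd (last L)))" "card ?U = (\<Sum>x \<leftarrow> L. card (fst x))"
    using cons by (auto simp: successively_Cons)
  have d: "fst x \<inter> ?U = {}" using cons.prems(3) by auto
  have hpA: "hpath E (fst x) (fst (snd x)) (snd (snd x))" using cons.prems by simp
  have "E (snd (snd x)) (fst (snd (hd L)))" using cons.prems(2) cons.hyps by (simp add: successively_Cons)
  then have "hpath E (fst x \<union> ?U) (fst (snd x)) (snd (snd (last L)))" using hpath_join[OF hpA IH(1)] d by simp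
  moreover have "card (fst x \<union> ?U) = card (fst x) + card ?U"
    using d hpath_finite[OF hpA] hpath_finite[OF IH(1)] by (intro card_Un_disjoint)
  ultimately show ?case using IH cons.hyps by simp
qed

text \<open>\<open>M\<close> bounds the cycles of \<open>H\<close>; it will be the order of a
  longest cycle of the graph, which bounds both by \<open>cyc_H_ad\<close>. Edges among
  \<open>a\<close>, \<open>b\<close>, \<open>c\<close> count as H-adjacencies, so the claw condition
  applies to induced and non-induced claws alike.\<close>

locale claw_graph = sgraph +
  fixes M :: nat
  assumes claw: "\<lbrakk>ad x a; ad x b; ad x c; a \<noteq> b; b \<noteq> c; a \<noteq> c\<rbrakk> \<Longrightarrow> H a b \<or> H b c \<or> H a c"
    and cyc_le: "cyc H A \<Longrightarrow> card A \<le> M"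
    and M3: "3 \<le> M"
begin

text \<open>The contradiction behind every rerouting. The numbered variants below take the pieces
  and their links separately.\<close>

lemma no_cyc:
  assumes "L \<noteq> []" "\<forall>x \<in> set L. hpath H (fst x) (fst (snd x)) (snd (snd x))"
    "successively (\<lambda>x y. H (snd (snd x)) (fst (snd y))) L"
    "sorted_wrt (\<lambda>x y. fst x \<inter> fst y = {}) L"
    "M < (\<Sum>x \<leftarrow> L. card (fst x))"
    "H (snd (snd (last L))) (fst (snd (hd L)))"
  shows False
proof -
  let ?U = "\<Union>x \<in> set L. fst x"
  have U: "hpath H ?U (fst (snd (hd L))) (snd (snd (last L)))" "M < card ?U"
    using hpath_pieces[OF assms(1-4)] assms(5) by auto
  then have "cyc H ?U" unfolding cyc_def using assms(6) M3 by (meson less_imp_le order_trans)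
  then show False using cyc_le U(2) by fastforce
qed

lemma no_cyc5:
  assumes "hpath H A1 a1 b1"
    and "hpath H A2 a2 b2"
    and "hpath H A3 a3 b3"
    and "hpath H A4 a4 b4"
    and "hpath H A5 a5 b5"
    and "H b1 a2" "H b2 a3" "H b3 a4" "H b4 a5" "H b5 a1"
    and "M < card A1 + card A2 + card A3 + card A4 + card A5"
    and "A1 \<inter> A2 = {}" "A1 \<inter> A3 = {}" "A1 \<inter> A4 = {}" "A1 \<inter> A5 = {}" "A2 \<inter> A3 = {}" "A2 \<inter> A4 = {}" "A2 \<inter> A5 = {}" "A3 \<inter> A4 = {}" "A3 \<inter> A5 = {}" "A4 \<inter> A5 = {}"
  shows False
  using assms by (intro no_cyc[of "[(A1, a1, b1), (A2, a2, b2), (A3, a3, b3), (A4, a4, b4), (A5, a5, b5)]"]) auto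

lemma no_cyc6:
  assumes "hpath H A1 a1 b1"
    and "hpath H A2 a2 b2"
    and "hpath H A3 a3 b3"
    and "hpath H A4 a4 b4"
    and "hpath H A5 a5 b5"
    and "hpath H A6 a6 b6"
    and "H b1 a2" "H b2 a3" "H b3 a4" "H b4 a5" "H b5 a6" "H b6 a1"
    and "M < card A1 + card A2 + card A3 + card A4 + card A5 + card A6"
    and "A1 \<inter> A2 = {}" "A1 \<inter> A3 = {}" "A1 \<inter> A4 = {}" "A1 \<inter> A5 = {}" "A1 \<inter> A6 = {}" "A2 \<inter> A3 = {}" "A2 \<inter> A4 = {}" "A2 \<inter> A5 = {}" "A2 \<inter> A6 = {}" "A3 \<inter> A4 = {}" "A3 \<inter> A5 = {}" "A3 \<inter> A6 = {}" "A4 \<inter> A5 = {}" "A4 \<inter> A6 = {}" "A5 \<inter> A6 = {}"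
  shows False
  using assms by (intro no_cyc[of "[(A1, a1, b1), (A2, a2, b2), (A3, a3, b3), (A4, a4, b4), (A5, a5, b5), (A6, a6, b6)]"]) auto

lemma no_cyc7:
  assumes "hpath H A1 a1 b1"
    and "hpath H A2 a2 b2"
    and "hpath H A3 a3 b3"
    and "hpath H A4 a4 b4"
    and "hpath H A5 a5 b5"
    and "hpath H A6 a6 b6"
    and "hpath H A7 a7 b7"
    and "H b1 a2" "H b2 a3" "H b3 a4" "H b4 a5" "H b5 a6" "H b6 a7" "H b7 a1"
    and "M < card A1 + card A2 + card A3 + card A4 + card A5 + card A6 + card A7"
    and "A1 \<inter> A2 = {}" "A1 \<inter> A3 = {}" "A1 \<inter> A4 = {}" "A1 \<inter> A5 = {}" "A1 \<inter> A6 = {}" "A1 \<inter> A7 = {}" "A2 \<inter> A3 = {}" "A2 \<inter> A4 = {}" "A2 \<inter> A5 = {}" "A2 \<inter> A6 = {}" "A2 \<inter> A7 = {}" "A3 \<inter> A4 = {}" "A3 \<inter> A5 = {}" "A3 \<inter> A6 = {}" "A3 \<inter> A7 = {}" "A4 \<inter> A5 = {}" "A4 \<inter> A6 = {}" "A4 \<inter> A7 = {}" "A5 \<inter> A6 = {}" "A5 \<inter> A7 = {}" "A6 \<inter> A7 = {}"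
  shows False
  using assms by (intro no_cyc[of "[(A1, a1, b1), (A2, a2, b2), (A3, a3, b3), (A4, a4, b4), (A5, a5, b5), (A6, a6, b6), (A7, a7, b7)]"]) auto

lemma no_cyc_list:
  assumes "P \<noteq> []" "distinct P" "successively H P" "H (last P) (hd P)" "M < length P"
  shows False
  using no_cyc[of "[(set P, hd P, last P)]"] assms hpI[of P H] distinct_card[of P] by simp

section \<open>Common neighbours of the ends of an H-path with more than \<open>M\<close>
  vertices\<close>

declare successively_rev [simp del]

lemma succ_H_rev [simp]: "successively H (rev P) \<longleftrightarrow> successively H P"
  by (rule successively_rev_sym) simp

lemma succ_ad_rev [simp]: "successively ad (rev P) \<longleftrightarrow> successively ad P"
  by (rule successively_rev_sym) simp

lemma succ_ad_H: "successively ad P \<Longrightarrow> successively H P"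
  using successively_mono ad_H by blast

text \<open>With \<open>?u\<close>, \<open>?v\<close> the ends of \<open>Z\<close> and
  \<open>?b\<close>, \<open>?c\<close> those of a nonempty \<open>B\<close>, each of the pairs
  \<open>?u ?v\<close>, \<open>?u ?b\<close>, \<open>?v ?c\<close> would close a cycle that is too
  long. The claws at \<open>x\<close> and \<open>w\<close> then force \<open>?v ?b\<close> and
  \<open>?u ?c\<close>, and these two together with \<open>x w\<close> close such a cycle as
  well.\<close>

lemma diamond:
  assumes Z: "Z = A @ [x] @ B @ [w] @ D" and ne: "A \<noteq> []" "D \<noteq> []"
    and dZ: "distinct Z" and sZ: "successively H Z" and M: "M < length Z"
    and x: "ad x (hd Z)" "ad x (last Z)" and w: "ad w (hd Z)" "ad w (last Z)"
    and gx: "ad x (last A)" "ad x (hd (B @ [w]))" and gw: "ad w (last (x # B))" "ad w (hd D)"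
    and xw: "H x w"
  shows False
proof -
  let ?u = "hd A" and ?v = "last D"
  have uv: "hd Z = ?u" "last Z = ?v" using Z ne by auto
  have s: "successively H A" "successively H B" "successively H D" "successively H ([x] @ B @ [w])"
    "successively H (A @ [x] @ B)" "successively H (B @ [w] @ D)"
  proof -
    have "Z = A @ ([x] @ B @ [w]) @ D" "Z = (A @ [x] @ B) @ [w] @ D" "Z = (A @ [x]) @ B @ [w] @ D"
      "Z = (A @ [x]) @ B @ ([w] @ D)" using Z by simp_all
    then show "successively H A" "successively H B" "successively H D" "successively H ([x] @ B @ [w])"
      "successively H (A @ [x] @ B)" "successively H (B @ [w] @ D)"
      using sZ by (metis successively_append_iff)+
  qed
  have nuv: "\<not> H ?u ?v"
    using no_cyc_list[of Z] Z dZ sZ M uv H_sym[of ?u ?v] by auto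
  show False
  proof (cases "B = []")
    case True
    \<comment> \<open>Here \<open>x\<close> and \<open>w\<close> are consecutive on
      \<open>Z\<close>, and reversing \<open>A\<close> between them suffices.\<close>
    have "distinct ([x] @ rev A @ [w] @ D)" using dZ Z True by auto
    moreover have "successively H ([x] @ rev A @ [w] @ D)"
      using s ne gx gw w(1) uv True ad_H ad_sym
      by (auto simp: successively_append_iff successively_Cons hd_rev last_rev)
    moreover have "H (last ([x] @ rev A @ [w] @ D)) (hd ([x] @ rev A @ [w] @ D))"
      using x(2) uv ne ad_H ad_sym by auto
    ultimately show False using no_cyc_list[of "[x] @ rev A @ [w] @ D"] M Z True by simp
  next
    case False
    let ?b = "hd B" and ?c = "last B"
    have in_sets: "?u \<in> set A" "?v \<in> set D" "?b \<in> set B" "?c \<in> set B" using ne False by auto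
    have "\<not> H ?u ?b"
    proof
      assume ub: "H ?u ?b"
      have "distinct (rev A @ B @ [w] @ D @ [x])" using dZ Z by auto
      moreover have "successively H (rev A @ B @ [w] @ D @ [x])"
        using s(1,6) ne False ub x(2) uv ad_H ad_sym
        by (auto simp: successively_append_iff successively_Cons last_rev)
      moreover have "H x (hd (rev A @ B @ [w] @ D @ [x]))"
        using gx(1) ne ad_H by (simp add: hd_rev)
      ultimately show False using no_cyc_list[of "rev A @ B @ [w] @ D @ [x]"] M Z by simp
    qed
    moreover have "H ?u ?v \<or> H ?v ?b \<or> H ?u ?b"
    proof (rule claw)
      show "ad x ?u" "ad x ?v" "ad x ?b" using x uv gx(2) False by auto
      show "?u \<noteq> ?v" "?v \<noteq> ?b" "?u \<noteq> ?b" using in_sets dZ Z by auto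
    qed
    ultimately have vb: "H ?v ?b" using nuv by blast
    have "\<not> H ?v ?c"
    proof
      assume vc: "H ?v ?c"
      have "distinct (A @ [x] @ B @ rev D @ [w])" using dZ Z by auto
      moreover have "successively H (A @ [x] @ B @ rev D @ [w])"
        using s(3,5) ne False H_sym[OF vc] gw(2) ad_H ad_sym
        by (auto simp: successively_append_iff successively_Cons hd_rev last_rev)
      moreover have "H w (hd (A @ [x] @ B @ rev D @ [w]))"
        using w(1) uv ne ad_H by simp
      ultimately show False using no_cyc_list[of "A @ [x] @ B @ rev D @ [w]"] M Z by simp
    qed
    moreover have "H ?u ?v \<or> H ?v ?c \<or> H ?u ?c"
    proof (rule claw)
      show "ad w ?u" "ad w ?v" "ad w ?c" using w uv gw(1) False by auto
      show "?u \<noteq> ?v" "?v \<noteq> ?c" "?u \<noteq> ?c" using in_sets dZ Z by auto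
    qed
    ultimately have uc: "H ?u ?c" using nuv by blast
    have "distinct ([x] @ rev A @ rev B @ rev D @ [w])" using dZ Z by auto
    moreover have "successively H ([x] @ rev A @ rev B @ rev D @ [w])"
      using s ne False gx(1) gw(2) uc vb ad_H ad_sym H_sym
      by (simp add: successively_append_iff successively_Cons hd_rev last_rev)
    moreover have "H w x" using xw H_sym by blast
    ultimately show False using no_cyc_list[of "[x] @ rev A @ rev B @ rev D @ [w]"] M Z by simp
  qed
qed

lemma succ_ad_split:
  assumes "successively ad (x # A @ y # B @ [z])"
  shows "ad (last (x # A)) y" "ad y (hd (B @ [z]))" "successively H (x # A)" "successively H (B @ [z])"
  using assms succ_ad_H[OF assms] successively_append_iff[of _ "x # A" "y # B @ [z]"]
  by (auto simp: successively_Cons[of _ y])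

text \<open>
  Consecutive vertices of \<open>Z\<close> are only known to be H-adjacent; \<open>gin Z y\<close> says that both steps at
  the inner vertex \<open>y\<close> are edges of the graph, so that the claw condition can be used at \<open>y\<close>.
\<close>

definition gin :: "'a list \<Rightarrow> 'a \<Rightarrow> bool" where
  "gin Z y \<longleftrightarrow> (\<exists>i. 0 < i \<and> Suc i < length Z \<and> y = Z ! i \<and> ad y (Z ! (i - 1)) \<and> ad y (Z ! Suc i))"

lemma gin_segment:
  assumes "X \<noteq> []" "Y \<noteq> []" "successively ad (last X # T @ [hd Y])" "y \<in> set T"
  shows "gin (X @ T @ Y) y"
proof -
  obtain A D where T: "T = A @ y # D" using assms(4) by (meson split_list)
  have s: "successively ad (last X # A @ y # D @ [hd Y])" using assms(3) T by simp
  have l: "ad (last (X @ A)) y"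
  proof (cases "A = []")
    case True then show ?thesis using s by simp
  next
    case False then show ?thesis using s by (auto simp: successively_Cons successively_append_iff)
  qed
  have h: "ad y (hd (D @ Y))"
  proof (cases "D = []")
    case True then show ?thesis using s by (auto simp: successively_Cons successively_append_iff)
  next
    case False then show ?thesis using s by (auto simp: successively_Cons successively_append_iff)
  qed
  let ?i = "length (X @ A)"
  have Z: "X @ T @ Y = (X @ A) @ [y] @ (D @ Y)" using T by simp
  have i: "0 < ?i" using assms(1) by simp
  have "last (X @ A) = (X @ A) ! (?i - 1)" using assms(1) by (intro last_conv_nth) simp
  then have "(X @ T @ Y) ! (?i - 1) = last (X @ A)" unfolding Z using i by (metis diff_less nth_append zero_less_one)
  moreover have "(X @ T @ Y) ! Suc ?i = hd (D @ Y)" unfolding Z using assms(2)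
    by (subst hd_conv_nth) (auto simp: nth_append)
  moreover have "(X @ T @ Y) ! ?i = y" unfolding Z by (metis append_Cons nth_append_length)
  moreover have "Suc ?i < length (X @ T @ Y)" unfolding Z using assms(2) by simp
  ultimately show ?thesis unfolding gin_def using i l h ad_sym by metis
qed

lemma diamond_nth:
  assumes dZ: "distinct Z" and sZ: "successively H Z" and M: "M < length Z"
    and x: "ad x (hd Z)" "ad x (last Z)" and w: "ad w (hd Z)" "ad w (last Z)"
    and g: "gin Z x" "gin Z w" and "x \<noteq> w"
  shows "\<not> H x w"
proof
  assume xw: "H x w"
  have main: False
    if i: "0 < i" "Suc i < length Z" "x = Z ! i" "ad x (Z ! (i - 1))" "ad x (Z ! Suc i)"
      and j: "0 < j" "Suc j < length Z" "w = Z ! j" "ad w (Z ! (j - 1))" "ad w (Z ! Suc j)"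
      and ij: "i < j" and x: "ad x (hd Z)" "ad x (last Z)" and w: "ad w (hd Z)" "ad w (last Z)"
      and xw: "H x w"
    for i j x w
  proof -
    let ?A = "take i Z" and ?B = "take (j - Suc i) (drop (Suc i) Z)" and ?D = "drop (Suc j) Z"
    have "drop (Suc i) Z = ?B @ drop j Z" using ij
      by (metis Suc_leI append_take_drop_id drop_drop le_add_diff_inverse2)
    then have Z: "Z = ?A @ [x] @ ?B @ [w] @ ?D"
      using i j by (metis Cons_nth_drop_Suc Suc_lessD append_Cons append_Nil append_take_drop_id)
    have h: "hd (?B @ [w]) = Z ! Suc i"
    proof (cases "j = Suc i")
      case True then show ?thesis using j by simp
    next
      case False then show ?thesis using ij j by (simp add: hd_drop_conv_nth)
    qed
    have l: "last (x # ?B) = Z ! (j - 1)"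
    proof (cases "j = Suc i")
      case True then show ?thesis using i by simp
    next
      case False
      then have "?B \<noteq> []" using ij j by simp
      then have "last (x # ?B) = ?B ! (length ?B - 1)" by (simp add: last_conv_nth)
      also have "\<dots> = Z ! Suc (j - 2)" using False ij j by simp
      also have "Suc (j - 2) = j - 1" using False ij by simp
      finally show ?thesis .
    qed
    show False
    proof (rule diamond[OF Z _ _ dZ sZ M x w _ _ _ _ xw])
      show "?A \<noteq> []" "?D \<noteq> []" using i j by auto
      show "ad x (last ?A)" using i
        by (metis One_nat_def Suc_lessD Suc_pred last_snoc take_Suc_conv_app_nth)
      show "ad x (hd (?B @ [w]))" using h i by simp
      show "ad w (last (x # ?B))" using l j by simp
      show "ad w (hd ?D)" using j by (simp add: hd_drop_conv_nth)
    qed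
  qed
  obtain i where i: "0 < i" "Suc i < length Z" "x = Z ! i" "ad x (Z ! (i - 1))" "ad x (Z ! Suc i)"
    using g(1) unfolding gin_def by blast
  obtain j where j: "0 < j" "Suc j < length Z" "w = Z ! j" "ad w (Z ! (j - 1))" "ad w (Z ! Suc j)"
    using g(2) unfolding gin_def by blast
  have "i < j \<or> j < i" using i j \<open>x \<noteq> w\<close> by (metis linorder_neqE_nat)
  then show False using main[OF i j _ x w xw] main[OF j i _ w x H_sym[OF xw]] by blast
qed

text \<open>Three such neighbours would form a claw at \<open>hd Z\<close>, making two of them
  H-adjacent against \<open>diamond_nth\<close>. They all lie on \<open>Z\<close>, since one off
  \<open>Z\<close> would close it to a cycle. \<open>X\<close> takes in the vertices where a step of
  \<open>Z\<close> may fail to be an edge.\<close>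

lemma common_nb_le2:
  assumes dZ: "distinct Z" and sZ: "successively H Z" and M: "M < length Z"
    and g: "\<And>y. y \<in> set Z - X \<Longrightarrow> y \<noteq> hd Z \<Longrightarrow> y \<noteq> last Z \<Longrightarrow> gin Z y"
  shows "card {y. ad (hd Z) y \<and> ad (last Z) y \<and> y \<notin> X} \<le> 2"
proof (rule ccontr)
  let ?Y = "{y. ad (hd Z) y \<and> ad (last Z) y \<and> y \<notin> X}"
  assume "\<not> card ?Y \<le> 2"
  then have "3 \<le> card ?Y" by simp
  then obtain T where T: "T \<subseteq> ?Y" "card T = 3" by (meson obtain_subset_with_card_n)
  then obtain a b c where abc: "a \<in> ?Y" "b \<in> ?Y" "c \<in> ?Y" "a \<noteq> b" "b \<noteq> c" "a \<noteq> c"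
    by (auto simp: card_3_iff)
  have ne: "Z \<noteq> []" using M by auto
  have inZ: "y \<in> set Z" if "y \<in> ?Y" for y
  proof (rule ccontr)
    assume "y \<notin> set Z"
    then have "distinct (Z @ [y])" using dZ by simp
    moreover have "successively H (Z @ [y])" using sZ that ad_H ne by (auto simp: successively_append_iff)
    moreover have "H (last (Z @ [y])) (hd (Z @ [y]))" using that ad_H ad_sym ne by auto
    ultimately show False using no_cyc_list[of "Z @ [y]"] M by simp
  qed
  have gY: "gin Z y" if "y \<in> ?Y" for y 
  proof (rule g)
    show "y \<in> set Z - X" using that inZ[OF that] by auto
    show "y \<noteq> hd Z" "y \<noteq> last Z" using that by auto
  qed
  have "\<not> H x w" if "x \<in> ?Y" "w \<in> ?Y" "x \<noteq> w" for x w
    using diamond_nth[OF dZ sZ M] gY that ad_sym by blast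
  moreover have "H a b \<or> H b c \<or> H a c" using claw[of "hd Z" a b c] abc by auto
  ultimately show False using abc by blast
qed

end

section \<open>Nodes\<close>

context sgraph
begin

text \<open>
  A rerouted cycle enters and leaves \<open>I\<close> through \<open>x\<close>, where the path outside the cycle is
  attached, or through \<open>p\<close> and \<open>q\<close>, where the cycle leaves \<open>I\<close>; the paths that omit one of
  the three serve the reroutings that visit the omitted vertex at another time.
\<close>

definition node :: "'a set \<Rightarrow> 'a \<Rightarrow> 'a \<Rightarrow> 'a \<Rightarrow> bool" where
  "node I p x q \<longleftrightarrow> p \<noteq> x \<and> x \<noteq> q \<and> p \<noteq> q \<and> hpath H I p x \<and> hpath H I q x \<and> hpath H I p q \<and>
     hpath H (I - {x}) p q \<and> hpath H (I - {q}) p x \<and> hpath H (I - {p}) q x"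

lemma hpath_H_rev: "hpath H A u v \<Longrightarrow> hpath H A v u" by (rule hpath_rev) simp

lemma card_singleton: "card {a} = 1" by simp

lemma node_sym: "node I p x q \<Longrightarrow> node I q x p"
  unfolding node_def using hpath_H_rev by auto

lemma nodeD:
  assumes "node I p x q"
  shows "p \<noteq> x" "x \<noteq> q" "p \<noteq> q" "p \<in> I" "x \<in> I" "q \<in> I" "finite I"
    "Suc (card (I - {x})) = card I" "Suc (card (I - {q})) = card I" "Suc (card (I - {p})) = card I"
proof -
  show a: "p \<noteq> x" "x \<noteq> q" "p \<noteq> q" "p \<in> I" "x \<in> I" "q \<in> I" "finite I"
    using assms unfolding node_def by (auto dest: hpath_hd_in hpath_last_in hpath_finite)
  show "Suc (card (I - {x})) = card I" "Suc (card (I - {q})) = card I" "Suc (card (I - {p})) = card I"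
    using card_Suc_Diff1[OF a(7)] a(4-6) by auto
qed

lemma nodeH:
  assumes "node I p x q"
  shows "hpath H I p x" "hpath H I q x" "hpath H I p q" "hpath H (I - {x}) p q" "hpath H (I - {q}) p x"
    "hpath H (I - {p}) q x"
  using assms unfolding node_def by auto

text \<open>The critical path is the one from \<open>q\<close> to \<open>x\<close> through all
  vertices, with \<open>c\<close> in its middle: \<open>q\<close>, \<open>c\<close>,
  \<open>p\<close>, ..., \<open>x\<close> if \<open>H c q\<close>, and \<open>q\<close>, ...,
  \<open>p\<close>, \<open>c\<close>, \<open>x\<close> if \<open>H c x\<close>.\<close>

lemma node_extend:
  assumes "node I p x q" "c \<notin> I" "H c p" "H c q \<or> H c x"
  shows "node (insert c I) c x q"
proof -
  note n = assms(1)[unfolded node_def]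
  have i: "insert c I - {x} = insert c (I - {x})" "insert c I - {q} = insert c (I - {q})"
    "insert c I - {c} = I"
    using nodeD[OF assms(1)] assms(2) by auto
  have "hpath H (insert c I) q x"
    using assms(4)
  proof
    assume "H c q"
    moreover have "hpath H (insert c (I - {q})) c x" using n hpath_Cons[of H "I - {q}" p x c] assms by auto
    ultimately have "hpath H (insert q (insert c (I - {q}))) q x"
      using hpath_Cons[of H "insert c (I - {q})" c x q] H_sym assms(2) nodeD[OF assms(1)] by auto
    then show ?thesis using nodeD[OF assms(1)] by (simp add: insert_commute insert_absorb)
  next
    assume "H c x"
    moreover have "hpath H (insert c (I - {x})) q c"
      using n hpath_snoc[of H "I - {x}" q p c] assms hpath_H_rev H_sym by auto
    ultimately have "hpath H (insert x (insert c (I - {x}))) q x"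
      using hpath_snoc[of H "insert c (I - {x})" q c x] H_sym assms(2) nodeD[OF assms(1)] by auto
    then show ?thesis using nodeD[OF assms(1)] by (simp add: insert_commute insert_absorb)
  qed
  moreover have "hpath H (insert c I) c x" "hpath H (insert c I) c q"
    using n assms by (auto intro: hpath_Cons)
  moreover have "hpath H (insert c I - {x}) c q" "hpath H (insert c I - {q}) c x"
    unfolding i using n assms(2,3) by (auto intro: hpath_Cons)
  moreover have "hpath H (insert c I - {c}) q x" unfolding i using n by auto
  ultimately show ?thesis unfolding node_def using nodeD[OF assms(1)] assms(2) by auto
qed

end

text \<open>
  What is common to two views of a configuration: \<open>u\<close> is either the vertex \<open>p1\<close> at which the
  cycle leaves the first node, or its successor on the cycle, and \<open>B\<close> is the rest of the node.
\<close>

locale half = claw_graph +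
  fixes u :: 'a and S :: "'a list" and B :: "'a set" and q1 x1 :: 'a
    and I2 :: "'a set" and p2 x2 q2 :: 'a and S2 R :: "'a list"
  assumes node2: "node I2 p2 x2 q2"
    and hpB: "hpath H B q1 x1" and hpuB: "hpath H (insert u B) q1 u"
    and chS: "successively ad (u # S @ [p2])"
    and chS2: "successively ad (q1 # S2 @ [q2])" and S2_ne: "S2 \<noteq> []"
    and chR: "successively ad (x1 # R @ [x2])" and R_ne: "R \<noteq> []"
    and dist: "distinct (u # S @ S2 @ R)"
    and dBI: "B \<inter> I2 = {}" and dSB: "set (u # S @ S2 @ R) \<inter> (B \<union> I2) = {}"
    and cardM: "Suc (card B + card I2 + length S + length S2) = M"
begin

lemmas nh2 = nodeH[OF node2] and n2 = nodeD[OF node2]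

lemma seg_u: "hpath H (set (u # S)) u (last (u # S))"
proof -
  have "successively ad ((u # S) @ [p2])" using chS by simp
  then have "successively ad (u # S)" using successively_append_iff by blast
  then show ?thesis using hpI[of "u # S" H] succ_ad_H dist by simp
qed

lemma u_link: "H (last (u # S)) p2" "H p2 (last (u # S))"
proof -
  have "successively ad ((u # S) @ [p2])" using chS by simp
  then have "ad (last (u # S)) p2" unfolding successively_append_iff by simp
  then show "H (last (u # S)) p2" "H p2 (last (u # S))" using ad_H ad_sym by auto
qed

lemma seg_S2: "hpath H (set S2) (hd S2) (last S2)"
  using hpI[of "S2" H] S2_ne chS2 dist succ_ad_H by (auto simp: successively_append_iff successively_Cons)

lemma S2_link: "H q1 (hd S2)" "H (hd S2) q1" "H (last S2) q2" "H q2 (last S2)"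
proof -
  have "ad q1 (hd S2)" "ad (last S2) q2"
    using chS2 S2_ne by (auto simp: successively_append_iff successively_Cons)
  then show "H q1 (hd S2)" "H (hd S2) q1" "H (last S2) q2" "H q2 (last S2)" using ad_H ad_sym by auto
qed

lemma seg_R: "hpath H (set R) (hd R) (last R)"
  using hpI[of "R" H] R_ne chR dist succ_ad_H by (auto simp: successively_append_iff successively_Cons)

lemma R_link: "H x1 (hd R)" "H (hd R) x1" "H (last R) x2" "H x2 (last R)"
proof -
  have "ad x1 (hd R)" "ad (last R) x2"
    using chR R_ne by (auto simp: successively_append_iff successively_Cons)
  then show "H x1 (hd R)" "H (hd R) x1" "H (last R) x2" "H x2 (last R)" using ad_H ad_sym by auto
qed

lemma cards: "card (set (u # S)) = Suc (length S)" "card (set S2) = length S2" "card (set R) = length R"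
  "0 < length R"
  using dist R_ne by (auto simp: distinct_card)

lemma disj:
  "set (u # S) \<inter> set S2 = {}" "set (u # S) \<inter> set R = {}" "set S2 \<inter> set R = {}"
  "set (u # S) \<inter> B = {}" "set S2 \<inter> B = {}" "set R \<inter> B = {}"
  "set (u # S) \<inter> I2 = {}" "set S2 \<inter> I2 = {}" "set R \<inter> I2 = {}" "B \<inter> I2 = {}"
  using dist dSB dBI by auto

lemma disj_single:
  assumes "v \<in> I2"
  shows "set (u # S) \<inter> {v} = {}" "set S2 \<inter> {v} = {}" "set R \<inter> {v} = {}" "B \<inter> {v} = {}"
  using assms disj(7-10) by (simp_all only: disjoint_iff) auto

lemma disj_subR:
  assumes "R1 \<subseteq> set R"
  shows "set (u # S) \<inter> R1 = {}" "set S2 \<inter> R1 = {}" "B \<inter> R1 = {}" "I2 \<inter> R1 = {}"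
  using assms disj(2,3,6,9) by (simp_all only: disjoint_iff) blast+

lemmas rv = hpath_H_rev

text \<open>Otherwise \<open>u\<close>, \<open>S\<close>, \<open>p2\<close> .. \<open>q2\<close>,
  \<open>rev S2\<close>, \<open>q1\<close> .. \<open>x1\<close>, \<open>R\<close>, \<open>x2\<close>
  is a cycle through the old one and all of \<open>R\<close>. The next two lemmas run through
  \<open>R\<close> from \<open>x2\<close> to \<open>x1\<close> instead and end with
  \<open>S2\<close>.\<close>

lemma not_u_x2: "\<not> H u x2"
proof
  assume "H u x2"
  then have ux: "H x2 u" by (rule H_sym)
  show False
    by (rule no_cyc6[OF seg_u nh2(4) seg_S2[THEN rv] hpB seg_R hpath_single u_link(1) S2_link(4,2) R_link(1,3) ux])
      ((use cards cardM n2(8-10) card_singleton[of x2] card_singleton[of q2] in linarith), (use disj disj_single[OF n2(5)] disj_single[OF n2(6)] in blast)+)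
qed

lemma not_u_q2: "\<not> H u q2"
proof
  assume "H u q2"
  then have ux: "H q2 u" by (rule H_sym)
  show False
    by (rule no_cyc6[OF seg_u nh2(5) seg_R[THEN rv] hpB[THEN rv] seg_S2 hpath_single
          u_link(1) R_link(4,2) S2_link(1,3) ux])
      ((use cards cardM n2(8-10) card_singleton[of x2] card_singleton[of q2] in linarith), (use disj disj_single[OF n2(5)] disj_single[OF n2(6)] in blast)+)
qed

lemma not_u_f: "\<not> H u (last S2)"
proof
  assume "H u (last S2)"
  then have ux: "H (last S2) u" by (rule H_sym)
  show False
    by (rule no_cyc5[OF seg_u nh2(1) seg_R[THEN rv] hpB[THEN rv] seg_S2
          u_link(1) R_link(4,2) S2_link(1) ux])
      ((use cards cardM n2(8-10) card_singleton[of x2] card_singleton[of q2] in linarith), (use disj disj_single[OF n2(5)] disj_single[OF n2(6)] in blast)+)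
qed

lemma R_prefix:
  assumes "r \<in> set R"
  obtains R1 where "R1 \<subseteq> set R" "hpath H R1 (hd R) r" "0 < card R1"
proof -
  obtain A D where R: "R = A @ r # D" using assms by (meson split_list)
  have "successively H R" using chR R_ne succ_ad_H by (auto simp: successively_append_iff successively_Cons)
  then have "successively H (A @ [r])" using R by (auto simp: successively_append_iff)
  then have "hpath H (set (A @ [r])) (hd (A @ [r])) (last (A @ [r]))" using dist R by (intro hpI) auto
  moreover have "hd (A @ [r]) = hd R" using R by (cases A) auto
  ultimately show ?thesis using R by (intro that[of "set (A @ [r])"]) (auto simp: card_gt_0_iff)
qed

text \<open>Only the part \<open>R1\<close> of \<open>R\<close> up to \<open>r\<close> is traversed,
  so at least one vertex is gained.\<close>

lemma not_u_R: assumes "r \<in> set R" shows "\<not> H u r"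
proof
  assume "H u r"
  then have ur: "H r u" by (rule H_sym)
  obtain R1 where R1: "R1 \<subseteq> set R" "hpath H R1 (hd R) r" "0 < card R1" using assms by (rule R_prefix)
  show False
    by (rule no_cyc5[OF seg_u nh2(3) seg_S2[THEN rv] hpB R1(2)
          u_link(1) S2_link(4,2) R_link(1) ur])
      ((use cards cardM n2(8-10) R1(3) in linarith), (use disj disj_subR[OF R1(1)] in blast)+)
qed

section \<open>Common neighbours across the nodes, and vertices attached to \<open>R\<close>\<close>

lemma hpath_list:
  assumes "hpath H A a b"
  obtains P where "P \<noteq> []" "hd P = a" "last P = b" "distinct P" "successively H P" "set P = A"
    "length P = card A"
  using assms distinct_card unfolding hpath_def by metis

lemma succ_H: "successively H (u # S @ [p2])" "successively H (q1 # S2 @ [q2])" "successively H (x1 # R @ [x2])"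
  "successively H S" "successively H S2" "successively H R"
proof -
  show *: "successively H (u # S @ [p2])" "successively H (q1 # S2 @ [q2])" "successively H (x1 # R @ [x2])"
    using chS chS2 chR succ_ad_H by auto
  show "successively H S" "successively H S2" "successively H R"
    using * by (auto simp: successively_Cons successively_append_iff)
qed

lemma disjD:
  "x \<in> set S \<Longrightarrow> x \<noteq> u \<and> x \<notin> set S2 \<and> x \<notin> set R \<and> x \<notin> B \<and> x \<notin> I2"
  "x \<in> set S2 \<Longrightarrow> x \<noteq> u \<and> x \<notin> set S \<and> x \<notin> set R \<and> x \<notin> B \<and> x \<notin> I2"
  "x \<in> set R \<Longrightarrow> x \<noteq> u \<and> x \<notin> set S \<and> x \<notin> set S2 \<and> x \<notin> B \<and> x \<notin> I2"
  "x \<in> B \<Longrightarrow> x \<noteq> u \<and> x \<notin> set S \<and> x \<notin> set S2 \<and> x \<notin> set R \<and> x \<notin> I2"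
  "x \<in> I2 \<Longrightarrow> x \<noteq> u \<and> x \<notin> set S \<and> x \<notin> set S2 \<and> x \<notin> set R \<and> x \<notin> B"
  using dist dSB dBI by auto

lemma u_notin: "u \<notin> set S" "u \<notin> set S2" "u \<notin> set R" "u \<notin> B" "u \<notin> I2"
  using dist dSB dBI by auto

lemma dists: "distinct S" "distinct S2" "distinct R" using dist by auto

lemma U_list:
  obtains U where "U \<noteq> []" "hd U = u" "H (last U) p2" "successively H U" "set U = insert u (set S)"
    "length U = Suc (length S)" "distinct U" "U = u # S"
proof -
  have "successively H ((u # S) @ [p2])" using succ_H(1) by simp
  then have "successively H (u # S)" using successively_append_iff by blast
  then show ?thesis using that[of "u # S"] u_link(1) u_notin dists by simp
qed

text \<open>\<open>Z\<close> is the cycle of \<open>not_u_q2\<close> opened at the pair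
  \<open>u q2\<close>. Along \<open>S\<close> and \<open>S2\<close> it runs on edges of the graph,
  so only \<open>B\<close>, \<open>I2\<close> and \<open>R\<close> are excluded. The next two lemmas
  open the cycles of \<open>not_u_x2\<close> and \<open>not_u_f\<close> in the same way.\<close>

lemma common_nb_q2: "card {y. ad u y \<and> ad q2 y \<and> y \<notin> B \<union> I2 \<union> set R} \<le> 2"
proof -
  obtain U where U: "U \<noteq> []" "hd U = u" "H (last U) p2" "successively H U" "set U = insert u (set S)"
    "length U = Suc (length S)" "distinct U" "U = u # S" by (rule U_list)
  obtain P2 where P2: "P2 \<noteq> []" "hd P2 = p2" "last P2 = x2" "distinct P2" "successively H P2"
    "set P2 = I2 - {q2}" "length P2 = card (I2 - {q2})" using hpath_list[OF nh2(5)] .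
  obtain PB where PB: "PB \<noteq> []" "hd PB = x1" "last PB = q1" "distinct PB" "successively H PB"
    "set PB = B" "length PB = card B" using hpath_list[OF hpB[THEN rv]] .
  define Z where "Z = U @ P2 @ rev R @ PB @ S2 @ [q2]"
  have ends: "hd Z = u" "last Z = q2" unfolding Z_def using U by auto
  have "distinct Z" unfolding Z_def
    using P2(4) PB(4) U(7) dists u_notin n2(4-6) by (auto simp: P2(6) PB(6) U(5) dest: disjD)
  moreover have "successively H Z" unfolding Z_def
    by (simp add: successively_append_iff hd_rev last_rev U(1-4) P2(1-3,5) PB(1-3,5) succ_H(4-6) S2_ne R_ne R_link S2_link)
  moreover have "M < length Z" unfolding Z_def using P2(7) PB(7) U(6) cardM n2(9) cards(4)
    by (simp only: length_append length_rev list.size; linarith)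
  moreover have "gin Z y" if "y \<in> set Z - (B \<union> I2 \<union> set R)" "y \<noteq> hd Z" "y \<noteq> last Z" for y
  proof -
    have "y \<in> set S \<or> y \<in> set S2" using that ends unfolding Z_def by (auto simp: P2(6) PB(6) U(5))
    then show ?thesis
    proof
      assume "y \<in> set S"
      then have "gin ([u] @ S @ (P2 @ rev R @ PB @ S2 @ [q2])) y"
        using chS by (intro gin_segment) (simp_all add: P2)
      then show ?thesis unfolding Z_def U(8) by simp
    next
      assume "y \<in> set S2"
      then have "gin ((U @ P2 @ rev R @ PB) @ S2 @ [q2]) y"
        using chS2 by (intro gin_segment) (simp_all add: PB)
      then show ?thesis unfolding Z_def by simp
    qed
  qed
  ultimately show ?thesis using common_nb_le2[of Z "B \<union> I2 \<union> set R"] ends by simp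
qed

lemma common_nb_x2: "card {y. ad u y \<and> ad x2 y \<and> y \<notin> B \<union> I2 \<union> set R} \<le> 2"
proof -
  obtain U where U: "U \<noteq> []" "hd U = u" "H (last U) p2" "successively H U" "set U = insert u (set S)"
    "length U = Suc (length S)" "distinct U" "U = u # S" by (rule U_list)
  obtain P2 where P2: "P2 \<noteq> []" "hd P2 = p2" "last P2 = q2" "distinct P2" "successively H P2"
    "set P2 = I2 - {x2}" "length P2 = card (I2 - {x2})" using hpath_list[OF nh2(4)] .
  obtain PB where PB: "PB \<noteq> []" "hd PB = q1" "last PB = x1" "distinct PB" "successively H PB"
    "set PB = B" "length PB = card B" using hpath_list[OF hpB] .
  define Z where "Z = U @ P2 @ rev S2 @ PB @ R @ [x2]"
  have ends: "hd Z = u" "last Z = x2" unfolding Z_def using U by auto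
  have "distinct Z" unfolding Z_def
    using P2(4) PB(4) U(7) dists u_notin n2(4-6) by (auto simp: P2(6) PB(6) U(5) dest: disjD)
  moreover have "successively H Z" unfolding Z_def
    by (simp add: successively_append_iff hd_rev last_rev U(1-4) P2(1-3,5) PB(1-3,5) succ_H(4-6) S2_ne R_ne R_link S2_link)
  moreover have "M < length Z" unfolding Z_def using P2(7) PB(7) U(6) cardM n2(8) cards(4)
    by (simp only: length_append length_rev list.size; linarith)
  moreover have "gin Z y" if "y \<in> set Z - (B \<union> I2 \<union> set R)" "y \<noteq> hd Z" "y \<noteq> last Z" for y
  proof -
    have "y \<in> set S \<or> y \<in> set S2" using that ends unfolding Z_def by (auto simp: P2(6) PB(6) U(5))
    then show ?thesis
    proof
      assume "y \<in> set S"
      then have "gin ([u] @ S @ (P2 @ rev S2 @ PB @ R @ [x2])) y"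
        using chS by (intro gin_segment) (simp_all add: P2)
      then show ?thesis unfolding Z_def U(8) by simp
    next
      assume y: "y \<in> set S2"
      have "successively ad (q2 # rev S2 @ [q1])" using chS2 succ_ad_rev[of "q1 # S2 @ [q2]"] by simp
      then have "gin ((U @ P2) @ rev S2 @ (PB @ R @ [x2])) y"
        using y by (intro gin_segment) (simp_all add: P2 PB)
      then show ?thesis unfolding Z_def by simp
    qed
  qed
  ultimately show ?thesis using common_nb_le2[of Z "B \<union> I2 \<union> set R"] ends by simp
qed

lemma common_nb_f: "card {y. ad u y \<and> ad (last S2) y \<and> y \<notin> B \<union> I2 \<union> set R} \<le> 2"
proof -
  obtain U where U: "U \<noteq> []" "hd U = u" "H (last U) p2" "successively H U" "set U = insert u (set S)"
    "length U = Suc (length S)" "distinct U" "U = u # S" by (rule U_list)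
  obtain P2 where P2: "P2 \<noteq> []" "hd P2 = p2" "last P2 = x2" "distinct P2" "successively H P2"
    "set P2 = I2" "length P2 = card I2" using hpath_list[OF nh2(1)] .
  obtain PB where PB: "PB \<noteq> []" "hd PB = x1" "last PB = q1" "distinct PB" "successively H PB"
    "set PB = B" "length PB = card B" using hpath_list[OF hpB[THEN rv]] .
  define T where "T = butlast S2"
  define f where "f = last S2"
  have S2: "S2 = T @ [f]" unfolding T_def f_def using S2_ne by simp
  define Z where "Z = U @ P2 @ rev R @ PB @ S2"
  have ends: "hd Z = u" "last Z = f" unfolding Z_def using U S2 by auto
  have "distinct Z" unfolding Z_def
    using P2(4) PB(4) U(7) dists u_notin n2(4-6) by (auto simp: P2(6) PB(6) U(5) dest: disjD)
  moreover have "successively H Z" unfolding Z_def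
    by (simp add: successively_append_iff hd_rev last_rev U(1-4) P2(1-3,5) PB(1-3,5) succ_H(4-6) S2_ne R_ne R_link S2_link)
  moreover have "M < length Z" unfolding Z_def using P2(7) PB(7) U(6) cardM cards(4)
    by (simp only: length_append length_rev list.size; linarith)
  moreover have "gin Z y" if "y \<in> set Z - (B \<union> I2 \<union> set R)" "y \<noteq> hd Z" "y \<noteq> last Z" for y
  proof -
    have "y \<in> set S \<or> y \<in> set T" using that ends unfolding Z_def by (auto simp: P2(6) PB(6) U(5) S2)
    then show ?thesis
    proof
      assume "y \<in> set S"
      then have "gin ([u] @ S @ (P2 @ rev R @ PB @ S2)) y"
        using chS by (intro gin_segment) (simp_all add: P2)
      then show ?thesis unfolding Z_def U(8) by simp
    next
      assume y: "y \<in> set T"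
      have "successively ad ((q1 # T @ [f]) @ [q2])" using chS2 unfolding S2 by simp
      then have "successively ad (q1 # T @ [f])" using successively_append_iff by blast
      then have "gin ((U @ P2 @ rev R @ PB) @ T @ [f]) y"
        using y by (intro gin_segment) (simp_all add: PB)
      then show ?thesis unfolding Z_def S2 by simp
    qed
  qed
  ultimately show ?thesis using common_nb_le2[of Z "B \<union> I2 \<union> set R"] ends f_def by simp
qed

text \<open>If \<open>y\<close> is off the cycle, it leads from \<open>R\<close> to \<open>u\<close>
  and the cycle grows. If \<open>y\<close> lies on a segment between \<open>a\<close> and
  \<open>b\<close>, then \<open>r\<close> cannot be inserted on either side of \<open>y\<close>, so
  the claw at \<open>y\<close> makes \<open>a b\<close> H-adjacent; the cycle can bypass
  \<open>y\<close>, which is then free to lead from \<open>R\<close> to \<open>u\<close>.\<close>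

lemma R_attach:
  assumes y: "y \<notin> B" "y \<notin> I2" "y \<notin> set R" and r: "r \<in> set R" "ad y r"
  shows "\<not> H y u"
proof
  assume yu: "H y u"
  then have y_u: "y \<noteq> u" by auto
  obtain A D where R: "R = A @ r # D" using r by (meson split_list)
  define A' where "A' = A @ [r]"
  obtain U where U: "U \<noteq> []" "hd U = u" "H (last U) p2" "successively H U" "set U = insert u (set S)"
    "length U = Suc (length S)" "distinct U" "U = u # S" by (rule U_list)
  obtain PB where PB: "PB \<noteq> []" "hd PB = q1" "last PB = x1" "distinct PB" "successively H PB"
    "set PB = B" "length PB = card B" using hpath_list[OF hpB] .
  \<comment> \<open>When \<open>r\<close> is inserted next to \<open>y\<close>, the cycle keeps its
    old course and passes through \<open>B\<close> and \<open>u\<close> directly, without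
    \<open>R\<close>.\<close>
  obtain Pu where Pu: "Pu \<noteq> []" "hd Pu = q1" "last Pu = u" "distinct Pu" "successively H Pu"
    "set Pu = insert u B" "length Pu = card (insert u B)" using hpath_list[OF hpuB] .
  obtain P2 where P2: "P2 \<noteq> []" "hd P2 = p2" "last P2 = q2" "distinct P2" "successively H P2"
    "set P2 = I2" "length P2 = card I2" using hpath_list[OF nh2(3)] .
  have Pul: "length Pu = Suc (card B)" using Pu(7) u_notin(4) hpath_finite[OF hpB] by simp
  have "x1 # R @ [x2] = (x1 # A') @ (D @ [x2])" using R A'_def by simp
  then have "successively H (x1 # A')" using succ_H(3) successively_append_iff by metis
  then have A': "A' \<noteq> []" "H x1 (hd A')" "last A' = r" "successively H A'" "set A' \<subseteq> set R" "distinct A'"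
    using R dists(3) by (auto simp: A'_def successively_Cons)
  have lA: "0 < length A'" using A'(1) by simp
  have rR: "r \<notin> B" "r \<notin> I2" "r \<notin> set S" "r \<notin> set S2" "r \<noteq> u" "r \<noteq> y"
    using r(1) y by (auto dest: disjD)
  have yr: "H y r" "H r y" using r ad_H ad_sym by auto
  have AS: "x \<in> set A' \<Longrightarrow> x \<in> set R" for x using A' by auto
  consider "y \<notin> set S" "y \<notin> set S2" | "y \<in> set S" | "y \<in> set S2" by blast
  then show False
  proof cases
    case 1
    let ?Z = "PB @ A' @ [y] @ U @ P2 @ rev S2"
    have "distinct ?Z" using PB(4) P2(4) U(7) dists A'(6) u_notin y 1 y_u
      by (auto simp: PB(6) P2(6) U(5) dest: disjD AS)
    moreover have "successively H ?Z"
      by (simp add: successively_append_iff successively_Cons hd_rev last_rev A'(1-4) PB(1-3,5) P2(1-3,5) U(1-4) succ_H(5)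
          yr yu S2_ne S2_link)
    moreover have "H (last ?Z) (hd ?Z)" by (simp add: S2_ne PB(1,2) S2_link last_rev)
    moreover have "M < length ?Z" using PB(7) P2(7) U(6) cardM
      by (simp only: length_append length_rev list.size; linarith)
    ultimately show False using no_cyc_list[of ?Z] by (simp add: U(1))
  next
    case 2
    then obtain Sa Sb where S: "S = Sa @ y # Sb" by (meson split_list)
    define a b where ab_def: "a = last (u # Sa)" "b = hd (Sb @ [p2])"
    have ady: "ad a y" "ad y b" and chs: "successively H (u # Sa)" "successively H (Sb @ [p2])"
      using succ_ad_split[OF chS[unfolded S append.assoc append_Cons]] unfolding ab_def by blast+
    have sub: "x \<in> set Sa \<Longrightarrow> x \<in> set S" "x \<in> set Sb \<Longrightarrow> x \<in> set S" for x using S by auto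
    have ds: "distinct Sa" "distinct Sb" "set Sa \<inter> set Sb = {}" "y \<notin> set Sa" "y \<notin> set Sb"
      using S dists(1) by auto
    have len: "length S = Suc (length Sa + length Sb)" using S by simp
    define W where "W = Pu @ Sa"
    have W: "W \<noteq> []" "hd W = q1" "last W = a" "successively H W" "set W = insert u B \<union> set Sa"
      "length W = Suc (card B + length Sa)"
      using Pu chs(1) Pul unfolding W_def ab_def by (auto simp: successively_append_iff successively_Cons)
    define Q where "Q = Sb @ P2"
    have Q: "Q \<noteq> []" "hd Q = b" "last Q = q2" "set Q = set Sb \<union> I2" "length Q = length Sb + card I2"
      using P2 unfolding Q_def ab_def by (auto simp: hd_append)
    have sQ: "successively H Q" unfolding Q_def using chs(2) P2(1,2,5)
      by (auto simp: successively_append_iff)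
    have dW: "distinct W" unfolding W_def using Pu(4) ds sub u_notin
      by (auto simp: Pu(6) dest: disjD sub)
    have dQ: "distinct Q" unfolding Q_def using P2(4) ds by (auto simp: P2(6) dest: disjD sub)
    have "\<not> H a r"
    proof
      assume ar: "H a r"
      let ?Z = "W @ [r] @ [y] @ Q @ rev S2"
      have "distinct ?Z" using dW dQ ds dists(2) u_notin rR y y_u 2
        by (auto simp: W(5) Q(4) dest: disjD sub)
      moreover have "successively H ?Z"
        by (simp add: successively_append_iff successively_Cons hd_rev last_rev W(1-4) Q(1-3) sQ succ_H(5)
          yr ar ad_H[OF ady(2)] S2_ne S2_link)
      moreover have "H (last ?Z) (hd ?Z)" by (simp add: S2_ne W(1,2) S2_link last_rev)
      moreover have "M < length ?Z" using W(6) Q(5) cardM len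
        by (simp only: length_append length_rev list.size; linarith)
      ultimately show False using no_cyc_list[of ?Z] by (simp add: W(1))
    qed
    moreover have "\<not> H r b"
    proof
      assume ar: "H r b"
      let ?Z = "W @ [y] @ [r] @ Q @ rev S2"
      have "distinct ?Z" using dW dQ ds dists(2) u_notin rR y y_u 2
        by (auto simp: W(5) Q(4) dest: disjD sub)
      moreover have "successively H ?Z"
        by (simp add: successively_append_iff successively_Cons hd_rev last_rev W(1-4) Q(1-3) sQ succ_H(5)
          yr ar ad_H[OF ady(1)] S2_ne S2_link)
      moreover have "H (last ?Z) (hd ?Z)" by (simp add: S2_ne W(1,2) S2_link last_rev)
      moreover have "M < length ?Z" using W(6) Q(5) cardM len
        by (simp only: length_append length_rev list.size; linarith)
      ultimately show False using no_cyc_list[of ?Z] by (simp add: W(1))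
    qed
    moreover have "a \<noteq> r" "r \<noteq> b" "a \<noteq> b"
    proof -
      have "a \<in> insert u (set Sa)" unfolding ab_def by auto
      moreover have "b \<in> insert p2 (set Sb)" unfolding ab_def by (cases Sb) auto
      moreover have "r \<noteq> p2" "u \<noteq> p2" using n2(4) rR u_notin by auto
      moreover have "p2 \<notin> set Sa" using n2(4) by (auto dest: disjD sub)
      moreover have "u \<notin> set Sb" "r \<notin> set Sa" "r \<notin> set Sb" using u_notin rR sub by blast+
      ultimately show "a \<noteq> r" "r \<noteq> b" "a \<noteq> b" using rR ds(3) by auto
    qed
    ultimately have ab: "H a b" using claw[of y a r b] ady r ad_sym by blast
    define Ua where "Ua = u # Sa"
    have Ua: "Ua \<noteq> []" "hd Ua = u" "last Ua = a" "successively H Ua" "set Ua = insert u (set Sa)"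
      "length Ua = Suc (length Sa)" "distinct Ua"
      using chs(1) ds(1) u_notin sub unfolding Ua_def ab_def by auto
    let ?Z = "PB @ A' @ [y] @ Ua @ Q @ rev S2"
    have "distinct ?Z" using PB(4) dQ ds dists(2) A'(6) u_notin y y_u 2
      Ua(7) by (auto simp: PB(6) Q(4) Ua(5) dest: disjD AS sub)
    moreover have "successively H ?Z"
      by (simp add: successively_append_iff successively_Cons hd_rev last_rev A'(1-4) PB(1-3,5) Q(1-3) sQ
          Ua(1-4) succ_H(5) yr yu ab S2_ne S2_link)
    moreover have "H (last ?Z) (hd ?Z)" by (simp add: S2_ne PB(1,2) S2_link last_rev)
    moreover have "M < length ?Z" using PB(7) Q(5) cardM len Ua(6) lA
      by (simp only: length_append length_rev list.size; linarith)
    ultimately show False using no_cyc_list[of ?Z] by (simp add: PB(1))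
  next
    case 3
    then obtain Sa Sb where S: "S2 = Sa @ y # Sb" by (meson split_list)
    define a b where ab_def: "a = last (q1 # Sa)" "b = hd (Sb @ [q2])"
    have ady: "ad a y" "ad y b" and chs: "successively H (q1 # Sa)" "successively H (Sb @ [q2])"
      using succ_ad_split[OF chS2[unfolded S append.assoc append_Cons]] unfolding ab_def by blast+
    have sub: "x \<in> set Sa \<Longrightarrow> x \<in> set S2" "x \<in> set Sb \<Longrightarrow> x \<in> set S2" for x using S by auto
    have ds: "distinct Sa" "distinct Sb" "set Sa \<inter> set Sb = {}" "y \<notin> set Sa" "y \<notin> set Sb"
      using S dists(2) by auto
    have len: "length S2 = Suc (length Sa + length Sb)" using S by simp
    have q1B: "q1 \<in> B" using hpath_hd_in[OF hpB] .
    define Q where "Q = P2 @ rev Sb"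
    have Q: "Q \<noteq> []" "hd Q = p2" "last Q = b" "set Q = set Sb \<union> I2" "length Q = length Sb + card I2"
      using P2 unfolding Q_def ab_def by (auto simp: hd_append last_rev)
    have sQ: "successively H Q" unfolding Q_def using chs(2) P2(1,3,5)
      by (auto simp: successively_append_iff hd_rev intro: H_sym)
    have dQ: "distinct Q" unfolding Q_def using P2(4) ds by (auto simp: P2(6) dest: disjD sub)
    have W: "rev Sa @ P \<noteq> []" "hd (rev Sa @ P) = a" "last (rev Sa @ P) = last P"
      "successively H (rev Sa @ P)" "hd (rev Sa @ P @ Y) = a"
      if "P \<noteq> []" "hd P = q1" "successively H P" for P Y
      using that chs(1) unfolding ab_def by (auto simp: hd_append hd_rev last_rev successively_append_iff successively_Cons intro: H_sym)
    note Wu = W[OF Pu(1,2,5), unfolded Pu(3)] and WB = W[OF PB(1,2,5), unfolded PB(3)]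
    have "\<not> H a r"
    proof
      assume ar: "H a r"
      let ?Z = "(rev Sa @ Pu) @ S @ Q @ [y] @ [r]"
      have "distinct ?Z" using Pu(4) dQ ds dists(1) u_notin rR y y_u 3
        by (auto simp: Pu(6) Q(4) dest: disjD sub)
      moreover have "S \<noteq> [] \<Longrightarrow> H u (hd S)" using succ_H(1) by (auto simp: successively_Cons)
      then have "successively H ?Z"
        using succ_H(1) Q(1,2) by (auto simp: successively_append_iff[of _ "rev Sa @ Pu"] successively_append_iff[of _ S] successively_append_iff[of _ Q]
          Wu(1-4) Q(1-3) sQ H_sym[OF ad_H[OF ady(2)]] yr successively_Cons[of _ u] hd_append simp del: append_assoc)
      moreover have "H (last ?Z) (hd ?Z)" using H_sym[OF ar] Wu(5) by (simp add: hd_append2 Pu(1))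
      moreover have "M < length ?Z" using Pul Q(5) cardM len
        by (simp only: length_append length_rev list.size; linarith)
      ultimately show False using no_cyc_list[of ?Z] by simp
    qed
    moreover have "\<not> H r b"
    proof
      assume ar: "H r b"
      let ?Z = "(rev Sa @ Pu) @ S @ Q @ [r] @ [y]"
      have "distinct ?Z" using Pu(4) dQ ds dists(1) u_notin rR y y_u 3
        by (auto simp: Pu(6) Q(4) dest: disjD sub)
      moreover have "S \<noteq> [] \<Longrightarrow> H u (hd S)" using succ_H(1) by (auto simp: successively_Cons)
      then have "successively H ?Z"
        using succ_H(1) Q(1,2) by (auto simp: successively_append_iff[of _ "rev Sa @ Pu"] successively_append_iff[of _ S] successively_append_iff[of _ Q]
          Wu(1-4) Q(1-3) sQ H_sym[OF ar] yr successively_Cons[of _ u] hd_append simp del: append_assoc)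
      moreover have "H (last ?Z) (hd ?Z)" using H_sym[OF ad_H[OF ady(1)]] Wu(5)
        by (simp add: hd_append2 Pu(1))
      moreover have "M < length ?Z" using Pul Q(5) cardM len
        by (simp only: length_append length_rev list.size; linarith)
      ultimately show False using no_cyc_list[of ?Z] by simp
    qed
    moreover have "a \<noteq> r" "r \<noteq> b" "a \<noteq> b"
    proof -
      have "a \<in> insert q1 (set Sa)" unfolding ab_def by auto
      moreover have "b \<in> insert q2 (set Sb)" unfolding ab_def by (cases Sb) auto
      moreover have "r \<noteq> q2" "r \<noteq> q1" "q1 \<noteq> q2" using n2(6) rR q1B by (auto dest: disjD)
      moreover have "q2 \<notin> set Sa" using n2(6) by (auto dest: disjD sub)
      moreover have "q1 \<notin> set Sb" using q1B by (auto dest: disjD sub)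
      moreover have "r \<notin> set Sa" "r \<notin> set Sb" using rR sub by blast+
      ultimately show "a \<noteq> r" "r \<noteq> b" "a \<noteq> b" using ds(3) by auto
    qed
    ultimately have ab: "H b a" using claw[of y a r b] ady r ad_sym H_sym by blast
    let ?Z = "(rev Sa @ PB) @ A' @ [y] @ U @ Q"
    have "distinct ?Z" using PB(4) dQ ds dists(1) A'(6) U(7) u_notin y y_u 3
      by (auto simp: PB(6) Q(4) U(5) dest: disjD AS sub)
    moreover have "successively H ?Z"
      by (auto simp: successively_append_iff[of _ "rev Sa @ PB"] successively_append_iff[of _ A'] successively_append_iff[of _ U]
          successively_Cons[of _ y] A'(1-4) WB(1-4) Q(1-3) sQ U(1-4) yr yu hd_append simp del: append_assoc)
    moreover have "H (last ?Z) (hd ?Z)" using ab WB(5) Q(1,3) by (simp add: hd_append2 PB(1))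
    moreover have "M < length ?Z" using PB(7) Q(5) U(6) cardM len lA
      by (simp only: length_append length_rev list.size; linarith)
    ultimately show False using no_cyc_list[of ?Z] by (simp add: PB(1))
  qed
qed

end

section \<open>Configurations\<close>

context sgraph
begin

lemma pick_common:
  assumes H: "H h h'" "\<not> ad h h'" and Os: "Os \<subseteq> V" "\<And>z. z \<in> Os \<Longrightarrow> \<not> ad h z \<and> \<not> ad h' z \<and> z \<noteq> h \<and> z \<noteq> h'"
    and B: "finite B" "card B < 2 + card Os"
  shows "\<exists>y. ad h y \<and> ad h' y \<and> y \<notin> B"
proof (rule ccontr)
  assume c: "\<not> ?thesis"
  then have "card {y. ad h y \<and> ad h' y} \<le> card B" using B(1) by (intro card_mono) auto
  then show False using common_nb_card[OF H Os] B(2) by simp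
qed

lemma fin_common [simp]: "finite {y. ad a y \<and> P y}"
  by (rule finite_subset[OF _ fin_nb[of a]]) auto

text \<open>For reroutings that visit \<open>I\<close> twice, the first time from \<open>p\<close> to \<open>v\<close>.\<close>

definition spl :: "'a set \<Rightarrow> 'a \<Rightarrow> 'a \<Rightarrow> 'a \<Rightarrow> 'a \<Rightarrow> bool" where
  "spl I p x q v \<longleftrightarrow> (\<exists>A \<subseteq> I. hpath H A p v \<and> hpath H (I - A) q x)"

lemma node_spl: "node I p x q \<Longrightarrow> spl I p x q p"
  unfolding spl_def by (rule exI[of _ "{p}"]) (use nodeD nodeH in auto)

lemma spl_extend:
  assumes "spl I p x q v" "c \<notin> I" "H c p"
  shows "spl (insert c I) c x q v"
proof -
  obtain A where A: "A \<subseteq> I" "hpath H A p v" "hpath H (I - A) q x" using assms(1) unfolding spl_def by blast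
  have "c \<notin> A" using A assms by auto
  moreover from this have "hpath H (insert c A) c v" using hpath_Cons[OF A(2)] assms by blast
  moreover have "insert c I - insert c A = I - A" using assms(2) by auto
  ultimately show ?thesis unfolding spl_def using A by (intro exI[of _ "insert c A"]) auto
qed

lemma spl_extend_new:
  assumes "node I p x q" "c \<notin> I"
  shows "spl (insert c I) c x q c"
proof -
  have "insert c I - {c} = I" using assms(2) by auto
  then show ?thesis unfolding spl_def using nodeH(2)[OF assms(1)] by (intro exI[of _ "{c}"]) auto
qed

lemma clique_hp:
  assumes "finite A" "u \<in> A" "v \<in> A" "u \<noteq> v" and cl: "\<And>a b. a \<in> A \<Longrightarrow> b \<in> A \<Longrightarrow> a \<noteq> b \<Longrightarrow> H a b"
  shows "hpath H A u v"
proof -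
  obtain P where P: "distinct P" "set P = A - {u, v}" using assms(1) finite_distinct_list[of "A - {u, v}"] by auto
  let ?Q = "u # P @ [v]"
  have d: "distinct ?Q" using P assms(4) by auto
  have s: "set ?Q = A" using P assms(2,3) by auto
  have "successively H ?Q" unfolding successively_conv_nth
  proof (intro allI impI)
    fix i assume i: "Suc i < length ?Q"
    then have "?Q ! i \<in> A" "?Q ! Suc i \<in> A" using s nth_mem by (metis Suc_lessD)+
    moreover have "?Q ! i \<noteq> ?Q ! Suc i" using nth_eq_iff_index_eq[OF d, of i "Suc i"] i by simp
    ultimately show "H (?Q ! i) (?Q ! Suc i)" using cl by blast
  qed
  then show ?thesis using hpI[of ?Q H] d s by simp
qed

lemma clique_node:
  assumes "finite I" "p \<in> I" "x \<in> I" "q \<in> I" "p \<noteq> x" "x \<noteq> q" "p \<noteq> q"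
    and cl: "\<And>a b. a \<in> I \<Longrightarrow> b \<in> I \<Longrightarrow> a \<noteq> b \<Longrightarrow> H a b"
  shows "node I p x q" "v \<in> I \<Longrightarrow> v \<noteq> x \<Longrightarrow> v \<noteq> q \<Longrightarrow> spl I p x q v"
proof -
  show "node I p x q" unfolding node_def
    using assms by (intro conjI clique_hp) auto
  assume v: "v \<in> I" "v \<noteq> x" "v \<noteq> q"
  show "spl I p x q v" unfolding spl_def
  proof (intro exI[of _ "{p, v}"] conjI)
    show "{p, v} \<subseteq> I" using assms v by auto
    show "hpath H {p, v} p v"
      using clique_hp[of "{p, v}" p v] assms(2) v cl by (cases "p = v") auto
    show "hpath H (I - {p, v}) q x" using assms v by (intro clique_hp) auto
  qed
qed

end

text \<open>
  The longest cycle is \<open>I1\<close>, \<open>S1\<close>, \<open>I2\<close>, \<open>rev S2\<close>: both segments are listed from the first node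
  to the second, and so is the path \<open>R\<close> outside the cycle.
\<close>

locale cfg = claw_graph +
  fixes I1 :: "'a set" and p1 x1 q1 :: 'a and I2 :: "'a set" and p2 x2 q2 :: 'a
    and S1 S2 R :: "'a list"
  assumes node1: "node I1 p1 x1 q1" and node2: "node I2 p2 x2 q2"
    and S1_ne: "S1 \<noteq> []" and S2_ne: "S2 \<noteq> []" and R_ne: "R \<noteq> []"
    and chS1: "successively ad (p1 # S1 @ [p2])"
    and chS2: "successively ad (q1 # S2 @ [q2])"
    and chR: "successively ad (x1 # R @ [x2])"
    and dist: "distinct (S1 @ S2 @ R)" and dI: "I1 \<inter> I2 = {}"
    and dSI: "set (S1 @ S2 @ R) \<inter> (I1 \<union> I2) = {}"
    and cardM: "card I1 + card I2 + length S1 + length S2 = M"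
begin

lemmas n1 = nodeD[OF node1] and n2 = nodeD[OF node2]
lemmas nh1 = nodeH[OF node1] and nh2 = nodeH[OF node2]
lemmas rv = hpath_H_rev

lemma succ_ad_rev_ends: "successively ad (a # P @ [b]) \<longleftrightarrow> successively ad (b # rev P @ [a])"
  using succ_ad_rev[of "a # P @ [b]"] by simp

text \<open>With \<open>cfg_sides\<close> this generates the symmetries of a configuration:
  exchanging the nodes reverses all three lists, exchanging the segments swaps each \<open>p\<close>
  with its \<open>q\<close>. Facts are proved at one corner and transported.\<close>

lemma cfg_ends: "cfg V ad M I2 p2 x2 q2 I1 p1 x1 q1 (rev S1) (rev S2) (rev R)"
proof unfold_locales
  show "successively ad (p2 # rev S1 @ [p1])" "successively ad (q2 # rev S2 @ [q1])"
    "successively ad (x2 # rev R @ [x1])" using chS1 chS2 chR succ_ad_rev_ends by auto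
qed (use node1 node2 S1_ne S2_ne R_ne dist dI dSI cardM in auto)

lemma cfg_sides: "cfg V ad M I1 q1 x1 p1 I2 q2 x2 p2 S2 S1 R"
  by unfold_locales (use node_sym[OF node1] node_sym[OF node2] S1_ne S2_ne R_ne chS1 chS2 chR dist dI dSI cardM in auto)

lemma half_p: "half V ad M p1 S1 (I1 - {p1}) q1 x1 I2 p2 x2 q2 S2 R"
proof unfold_locales
  show "hpath H (insert p1 (I1 - {p1})) q1 p1" using nh1(3)[THEN rv] n1(4) by (simp add: insert_absorb)
qed (use node2 nh1 n1 S2_ne R_ne chS1 chS2 chR dist dI dSI cardM in auto)

lemma half_c: "half V ad M (hd S1) (tl S1) I1 q1 x1 I2 p2 x2 q2 S2 R"
proof -
  obtain c S' where S1: "S1 = c # S'" using S1_ne by (cases S1) auto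
  have c: "ad p1 c" "c \<notin> I1" using chS1 S1 dSI by auto
  have "half V ad M c S' I1 q1 x1 I2 p2 x2 q2 S2 R"
  proof unfold_locales
    show "hpath H (insert c I1) q1 c" using hpath_snoc[OF nh1(3)[THEN rv]] c ad_H by auto
    show "successively ad (c # S' @ [p2])" using chS1 S1 by simp
  qed (use node2 nh1 n1 S2_ne R_ne chS2 chR dist dI dSI cardM S1 in auto)
  then show ?thesis using S1 by simp
qed

lemma cfgD:
  "x \<in> set S1 \<Longrightarrow> x \<notin> set S2 \<and> x \<notin> set R \<and> x \<notin> I1 \<and> x \<notin> I2"
  "x \<in> set S2 \<Longrightarrow> x \<notin> set S1 \<and> x \<notin> set R \<and> x \<notin> I1 \<and> x \<notin> I2"
  "x \<in> set R \<Longrightarrow> x \<notin> set S1 \<and> x \<notin> set S2 \<and> x \<notin> I1 \<and> x \<notin> I2"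
  "x \<in> I1 \<Longrightarrow> x \<notin> set S1 \<and> x \<notin> set S2 \<and> x \<notin> set R \<and> x \<notin> I2"
  "x \<in> I2 \<Longrightarrow> x \<notin> set S1 \<and> x \<notin> set S2 \<and> x \<notin> set R \<and> x \<notin> I1"
  using dist dI dSI by auto

lemma dists: "distinct S1" "distinct S2" "distinct R" using dist by auto

lemma edges: "ad p1 (hd S1)" "ad (last S1) p2" "ad q1 (hd S2)" "ad (last S2) q2" "ad x1 (hd R)" "ad (last R) x2"
  "ad (hd S1) p1" "ad p2 (last S1)" "ad (hd S2) q1" "ad q2 (last S2)" "ad (hd R) x1" "ad x2 (last R)"
  using chS1 chS2 chR S1_ne S2_ne R_ne ad_sym
  by (auto simp: successively_Cons successively_append_iff)

lemmas lk = edges[THEN ad_H]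

lemma segs: "hpath H (set S1) (hd S1) (last S1)" "hpath H (set S2) (hd S2) (last S2)" "hpath H (set R) (hd R) (last R)"
proof -
  have "successively ad S1" "successively ad S2" "successively ad R"
    using chS1 chS2 chR by (auto simp: successively_Cons successively_append_iff)
  then show "hpath H (set S1) (hd S1) (last S1)" "hpath H (set S2) (hd S2) (last S2)" "hpath H (set R) (hd R) (last R)"
    using S1_ne S2_ne R_ne dists succ_ad_H hpI by metis+
qed

lemma cards: "card (set S1) = length S1" "card (set S2) = length S2" "card (set R) = length R"
  "0 < length R"
  using dists R_ne by (auto simp: distinct_card)

text \<open>Here \<open>x1\<close> is visited alone, at the beginning of \<open>R\<close>, and its
  node is crossed from \<open>p1\<close> to \<open>q1\<close> without it.\<close>

lemma not_x1: "\<not> H x1 q2" "\<not> H x1 (last S2)"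
proof -
  show "\<not> H x1 q2"
  proof
    assume "H x1 q2"
    then have c: "H q2 x1" by (rule H_sym)
    show False
      by (rule no_cyc7[OF hpath_single segs(3) nh2(5)[THEN rv] segs(1)[THEN rv] nh1(4) segs(2) hpath_single
            lk(5,6,8,7,3,4) c])
        ((use cards cardM card_singleton[of x1] card_singleton[of q2] n1(8-10) n2(8-10) in linarith),
         (use n1(4-6) n2(4-6) in \<open>auto dest: cfgD; fail\<close>)+)
  qed
  show "\<not> H x1 (last S2)"
  proof
    assume "H x1 (last S2)"
    then have c: "H (last S2) x1" by (rule H_sym)
    show False
      by (rule no_cyc6[OF hpath_single segs(3) nh2(1)[THEN rv] segs(1)[THEN rv] nh1(4) segs(2)
            lk(5,6,8,7,3) c])
        ((use cards cardM card_singleton[of x1] n1(8-10) n2(8-10) in linarith),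
         (use n1(4-6) n2(4-6) in \<open>auto dest: cfgD; fail\<close>)+)
  qed
qed

end

context cfg
begin

interpretation E: cfg V ad M I2 p2 x2 q2 I1 p1 x1 q1 "rev S1" "rev S2" "rev R" by (rule cfg_ends)
interpretation D: cfg V ad M I1 q1 x1 p1 I2 q2 x2 p2 S2 S1 R by (rule cfg_sides)

lemma nonadj:
  "\<not> H p1 x2" "\<not> H p1 q2" "\<not> H p1 (last S2)" "\<not> H (hd S1) x2" "\<not> H (hd S1) q2" "\<not> H (hd S1) (last S2)"
  "\<not> H x1 q2" "\<not> H x1 (last S2)"
  "\<not> H q1 x2" "\<not> H q1 p2" "\<not> H q1 (last S1)" "\<not> H (hd S2) x2" "\<not> H (hd S2) p2" "\<not> H (hd S2) (last S1)"
  "\<not> H x1 p2" "\<not> H x1 (last S1)"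
  using half.not_u_x2[OF half_p] half.not_u_q2[OF half_p] half.not_u_f[OF half_p]
    half.not_u_x2[OF half_c] half.not_u_q2[OF half_c] half.not_u_f[OF half_c] not_x1
    half.not_u_x2[OF D.half_p] half.not_u_q2[OF D.half_p] half.not_u_f[OF D.half_p]
    half.not_u_x2[OF D.half_c] half.not_u_q2[OF D.half_c] half.not_u_f[OF D.half_c] D.not_x1
  by blast+

lemma nonadj_R:
  assumes "r \<in> set R"
  shows "\<not> H p1 r" "\<not> H (hd S1) r" "\<not> H q1 r" "\<not> H (hd S2) r"
    "\<not> H p2 r" "\<not> H (last S1) r" "\<not> H q2 r" "\<not> H (last S2) r"
proof -
  interpret ED: cfg V ad M I2 q2 x2 p2 I1 q1 x1 p1 "rev S2" "rev S1" "rev R" by (rule E.cfg_sides)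
  show "\<not> H p1 r" "\<not> H (hd S1) r" "\<not> H q1 r" "\<not> H (hd S2) r"
    "\<not> H p2 r" "\<not> H (last S1) r" "\<not> H q2 r" "\<not> H (last S2) r"
    using half.not_u_R[OF half_p] half.not_u_R[OF half_c] half.not_u_R[OF D.half_p] half.not_u_R[OF D.half_c]
      half.not_u_R[OF E.half_p] half.not_u_R[OF E.half_c] half.not_u_R[OF ED.half_p] half.not_u_R[OF ED.half_c]
      assms S1_ne S2_ne by (simp_all add: hd_rev)
qed

text \<open>The reroutings of \<open>not_u_x2\<close> and its companions with a vertex
  \<open>v\<close> inside the node in place of \<open>u\<close>: the cycle visits \<open>I1\<close>
  twice, once in \<open>A\<close> and once in the rest. The start \<open>w\<close> may be any vertex
  H-adjacent to \<open>hd S1\<close>; later \<open>q1\<close> takes this role too.\<close>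

lemma cut_far:
  assumes A: "A \<subseteq> I1" "hpath H A w v" "H w (hd S1)" "hpath H (I1 - A) q1 x1"
  shows "\<not> H v x2" "\<not> H v q2" "\<not> H v (last S2)" "r \<in> set R \<Longrightarrow> \<not> H v r"
proof -
  have fA: "finite A" "finite I1" using A(1) n1(7) finite_subset by auto
  have cA: "card A + card (I1 - A) = card I1" using A(1) fA
    by (metis card_Diff_subset card_mono le_add_diff_inverse)
  have AD: "x \<in> A \<Longrightarrow> x \<in> I1" for x using A by auto
  show "\<not> H v x2"
  proof
    assume "H v x2"
    then have c: "H x2 v" by (rule H_sym)
    show False
      by (rule no_cyc7[OF A(2)[THEN rv] segs(1) nh2(4) segs(2)[THEN rv] A(4) segs(3) hpath_single
            A(3) lk(2,10,9,5,6) c])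
        ((use cards cardM card_singleton[of x2] n1(8-10) n2(8-10) cA in linarith),
         (use n2(4-6) in \<open>auto dest: cfgD AD; fail\<close>)+)
  qed
  show "\<not> H v q2"
  proof
    assume "H v q2"
    then have c: "H q2 v" by (rule H_sym)
    show False
      by (rule no_cyc7[OF A(2)[THEN rv] segs(1) nh2(5) segs(3)[THEN rv] A(4)[THEN rv] segs(2) hpath_single
            A(3) lk(2,12,11,3,4) c])
        ((use cards cardM card_singleton[of q2] n1(8-10) n2(8-10) cA in linarith),
         (use n2(4-6) in \<open>auto dest: cfgD AD; fail\<close>)+)
  qed
  show "\<not> H v (last S2)"
  proof
    assume "H v (last S2)"
    then have c: "H (last S2) v" by (rule H_sym)
    show False
      by (rule no_cyc6[OF A(2)[THEN rv] segs(1) nh2(1) segs(3)[THEN rv] A(4)[THEN rv] segs(2)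
            A(3) lk(2,12,11,3) c])
        ((use cards cardM n1(8-10) n2(8-10) cA in linarith),
         (use n2(4-6) in \<open>auto dest: cfgD AD; fail\<close>)+)
  qed
  assume r: "r \<in> set R"
  show "\<not> H v r"
  proof
    assume "H v r"
    then have c: "H r v" by (rule H_sym)
    obtain R1 where R1: "R1 \<subseteq> set R" "hpath H R1 (hd R) r" "0 < card R1"
      using half.R_prefix[OF half_p r] .
    have RD: "x \<in> R1 \<Longrightarrow> x \<in> set R" for x using R1 by auto
    show False
      by (rule no_cyc6[OF A(2)[THEN rv] segs(1) nh2(3) segs(2)[THEN rv] A(4) R1(2)
            A(3) lk(2,10,9,5) c])
        ((use cards cardM n1(8-10) n2(8-10) cA R1(3) in linarith),
         (use n2(4-6) in \<open>auto dest: cfgD AD RD; fail\<close>)+)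
  qed
qed

lemma spl_far:
  assumes "spl I1 p1 x1 q1 v"
  shows "\<not> H v x2" "\<not> H v q2" "\<not> H v (last S2)" "r \<in> set R \<Longrightarrow> \<not> H v r"
proof -
  obtain A where A: "A \<subseteq> I1" "hpath H A p1 v" "hpath H (I1 - A) q1 x1" using assms unfolding spl_def by blast
  show "\<not> H v x2" "\<not> H v q2" "\<not> H v (last S2)" "r \<in> set R \<Longrightarrow> \<not> H v r"
    using cut_far[OF A(1,2) lk(1) A(3)] by blast+
qed

text \<open>Both nodes are visited twice: \<open>v\<close> .. \<open>p1\<close>, \<open>S1\<close>,
  \<open>p2\<close> .. \<open>x2\<close>, \<open>rev R\<close>, \<open>x1\<close> ..
  \<open>q1\<close>, \<open>S2\<close>, \<open>q2\<close> .. \<open>w\<close>. This is why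
  \<open>p2\<close> and \<open>q2\<close> change roles in the second splitting.\<close>

lemma spl_spl:
  assumes "spl I1 p1 x1 q1 v" "spl I2 q2 x2 p2 w"
  shows "\<not> H v w"
proof
  assume "H v w"
  then have c: "H w v" by (rule H_sym)
  obtain A where A: "A \<subseteq> I1" "hpath H A p1 v" "hpath H (I1 - A) q1 x1" using assms(1) unfolding spl_def by blast
  have fA: "finite A" "finite I1" using A(1) n1(7) finite_subset by auto
  have cA: "card A + card (I1 - A) = card I1" using A(1) fA
    by (metis card_Diff_subset card_mono le_add_diff_inverse)
  obtain B where B: "B \<subseteq> I2" "hpath H B q2 w" "hpath H (I2 - B) p2 x2" using assms(2) unfolding spl_def by blast
  have fB: "finite B" "finite I2" using B(1) n2(7) finite_subset by auto
  have cB: "card B + card (I2 - B) = card I2" using B(1) fB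
    by (metis card_Diff_subset card_mono le_add_diff_inverse)
  have AD: "x \<in> A \<Longrightarrow> x \<in> I1" "y \<in> B \<Longrightarrow> y \<in> I2" for x y using A B by auto
  show False
    by (rule no_cyc7[OF A(2)[THEN rv] segs(1) B(3) segs(3)[THEN rv] A(3)[THEN rv] segs(2) B(2)
          lk(1,2,12,11,3,4) c])
      ((use cards cardM cA cB in linarith), (auto dest: cfgD AD; fail)+)
qed

lemma extend:
  assumes "S1 = c # S'" "H c q1 \<or> H c x1"
  shows "S' \<noteq> []" "cfg V ad M (insert c I1) c x1 q1 I2 p2 x2 q2 S' S2 R"
proof -
  show S': "S' \<noteq> []" using assms nonadj(11,16) H_sym by auto
  have c: "c \<notin> I1" "H c p1" using dSI assms(1) lk(7) by auto
  show "cfg V ad M (insert c I1) c x1 q1 I2 p2 x2 q2 S' S2 R"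
  proof unfold_locales
    show "node (insert c I1) c x1 q1" using node_extend[OF node1 c assms(2)] .
    show "card (insert c I1) + card I2 + length S' + length S2 = M" using cardM c n1(7) assms(1) by simp
  qed (use node2 S' S2_ne R_ne chS1 chS2 chR dist dI dSI assms(1) in auto)
qed

lemma attach:
  assumes "y \<notin> I1" "y \<notin> I2" "y \<notin> set R" "r \<in> set R" "ad y r"
  shows "\<not> H y p1" "\<not> H y (hd S1)" "\<not> H y q1" "\<not> H y (hd S2)"
  using half.R_attach[OF half_p _ assms(2-5)] half.R_attach[OF half_c _ assms(2-5)]
    half.R_attach[OF D.half_p _ assms(2-5)] half.R_attach[OF D.half_c _ assms(2-5)] assms(1) by auto

lemma common_le2:
  "card {y. ad p1 y \<and> ad q2 y \<and> y \<notin> I1 \<union> I2 \<union> set R} \<le> 2"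
  "card {y. ad p1 y \<and> ad x2 y \<and> y \<notin> I1 \<union> I2 \<union> set R} \<le> 2"
  "card {y. ad p1 y \<and> ad (last S2) y \<and> y \<notin> I1 \<union> I2 \<union> set R} \<le> 2"
  "card {y. ad (hd S1) y \<and> ad q2 y \<and> y \<notin> I1 \<union> I2 \<union> set R} \<le> 2"
  "card {y. ad (hd S1) y \<and> ad x2 y \<and> y \<notin> I1 \<union> I2 \<union> set R} \<le> 2"
  "card {y. ad (hd S1) y \<and> ad (last S2) y \<and> y \<notin> I1 \<union> I2 \<union> set R} \<le> 2"
proof -
  have *: "card {y. ad p1 y \<and> ad z y \<and> y \<notin> I1 \<union> I2 \<union> set R} \<le>
    card {y. ad p1 y \<and> ad z y \<and> y \<notin> (I1 - {p1}) \<union> I2 \<union> set R}" for z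
    by (rule card_mono) (auto intro: finite_subset[OF _ fin_nb[of p1]])
  show "card {y. ad p1 y \<and> ad q2 y \<and> y \<notin> I1 \<union> I2 \<union> set R} \<le> 2"
    "card {y. ad p1 y \<and> ad x2 y \<and> y \<notin> I1 \<union> I2 \<union> set R} \<le> 2"
    "card {y. ad p1 y \<and> ad (last S2) y \<and> y \<notin> I1 \<union> I2 \<union> set R} \<le> 2"
    using half.common_nb_q2[OF half_p] half.common_nb_x2[OF half_p] half.common_nb_f[OF half_p]
      order_trans[OF *] by blast+
  show "card {y. ad (hd S1) y \<and> ad q2 y \<and> y \<notin> I1 \<union> I2 \<union> set R} \<le> 2"
    "card {y. ad (hd S1) y \<and> ad x2 y \<and> y \<notin> I1 \<union> I2 \<union> set R} \<le> 2"
    "card {y. ad (hd S1) y \<and> ad (last S2) y \<and> y \<notin> I1 \<union> I2 \<union> set R} \<le> 2"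
    using half.common_nb_q2[OF half_c] half.common_nb_x2[OF half_c] half.common_nb_f[OF half_c] by blast+
qed

end

section \<open>Light and heavy neighbours of the nodes\<close>

text \<open>\<open>Rmin\<close> compares \<open>R\<close> with paths between any two vertices of the
  cycle, so that shortcuts ending away from \<open>x1\<close> and \<open>x2\<close> count too. As
  \<open>R'\<close> is nonempty, \<open>x1\<close> and \<open>x2\<close> may still be
  adjacent.\<close>

locale clique_cfg = cfg +
  assumes p6: "\<lbrakk>ad a b; ad b c; ad c d; ad d e; ad e f; \<not> ad a c; \<not> ad a d; \<not> ad a e; \<not> ad a f;
      \<not> ad b d; \<not> ad b e; \<not> ad b f; \<not> ad c e; \<not> ad c f; \<not> ad d f\<rbrakk> \<Longrightarrow> heavy a \<or> heavy f"
    and cl1: "v \<in> I1 \<Longrightarrow> v \<noteq> x1 \<Longrightarrow> ad x1 v"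
      "v \<in> I1 \<Longrightarrow> w \<in> I1 \<Longrightarrow> v \<noteq> w \<Longrightarrow> H v w"
    and cl2: "v \<in> I2 \<Longrightarrow> v \<noteq> x2 \<Longrightarrow> ad x2 v"
      "v \<in> I2 \<Longrightarrow> w \<in> I2 \<Longrightarrow> v \<noteq> w \<Longrightarrow> H v w"
    and maximal: "\<not> ad x1 (hd S1)" "\<not> ad x1 (hd S2)" "\<not> ad x2 (last S1)" "\<not> ad x2 (last S2)"
    and Rmin: "\<lbrakk>successively ad (a # R' @ [b]); a \<noteq> b; R' \<noteq> []; {a, b} \<subseteq> I1 \<union> I2 \<union> set S1 \<union> set S2;
      set R' \<inter> (I1 \<union> I2 \<union> set S1 \<union> set S2) = {}\<rbrakk> \<Longrightarrow> length R \<le> length R'"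
begin

lemma clique_cfg_ends: "clique_cfg V ad M I2 p2 x2 q2 I1 p1 x1 q1 (rev S1) (rev S2) (rev R)"
proof (intro clique_cfg.intro clique_cfg_axioms.intro)
  show "cfg V ad M I2 p2 x2 q2 I1 p1 x1 q1 (rev S1) (rev S2) (rev R)" by (rule cfg_ends)
  show "length (rev R) \<le> length R'"
    if "successively ad (a # R' @ [b])" "a \<noteq> b" "R' \<noteq> []" "{a, b} \<subseteq> I2 \<union> I1 \<union> set (rev S1) \<union> set (rev S2)"
      "set R' \<inter> (I2 \<union> I1 \<union> set (rev S1) \<union> set (rev S2)) = {}" for a b R'
    using Rmin[of a R' b] that by (simp add: Un_ac)
qed (use p6 cl1 cl2 maximal S1_ne S2_ne in \<open>auto simp: hd_rev last_rev; fail\<close>)+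

lemma clique_cfg_sides: "clique_cfg V ad M I1 q1 x1 p1 I2 q2 x2 p2 S2 S1 R"
proof (intro clique_cfg.intro clique_cfg_axioms.intro)
  show "cfg V ad M I1 q1 x1 p1 I2 q2 x2 p2 S2 S1 R" by (rule cfg_sides)
  show "length R \<le> length R'"
    if "successively ad (a # R' @ [b])" "a \<noteq> b" "R' \<noteq> []" "{a, b} \<subseteq> I1 \<union> I2 \<union> set S2 \<union> set S1"
      "set R' \<inter> (I1 \<union> I2 \<union> set S2 \<union> set S1) = {}" for a b R'
    using Rmin[of a R' b] that by (simp add: Un_ac)
qed (use p6 cl1 cl2 maximal in \<open>auto; fail\<close>)+

lemma nonadj_ad:
  "\<not> ad p1 x2" "\<not> ad p1 q2" "\<not> ad p1 (last S2)" "\<not> ad (hd S1) x2" "\<not> ad (hd S1) q2" "\<not> ad (hd S1) (last S2)"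
  "\<not> ad x1 q2" "\<not> ad x1 (last S2)"
  using nonadj ad_H by blast+

lemma RC: "set R \<inter> (I1 \<union> I2 \<union> set S1 \<union> set S2) = {}"
  using cfgD(3) by auto

lemma x12: "x1 \<noteq> x2" using n1(5) n2(5) dI by auto

lemma R_V: "z \<in> set R \<Longrightarrow> z \<in> V"
  using gin_segment[of "[x1]" "[x2]" R z] chR ad_V unfolding gin_def by auto

abbreviation W where "W \<equiv> x1 # R @ [x2]"

lemma W_walk:
  assumes "i \<le> length R" "Suc i \<le> j" "j \<le> Suc (length R)"
  shows "successively ad (x1 # take i R)" "last (x1 # take i R) = W ! i"
    "successively ad (drop (j - 1) R @ [x2])" "hd (drop (j - 1) R @ [x2]) = W ! j"
proof -
  have *: "W = (x1 # take i R) @ (drop i R @ [x2])" "W = (x1 # take (j - 1) R) @ (drop (j - 1) R @ [x2])" by simp_all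
  then show "successively ad (x1 # take i R)" "successively ad (drop (j - 1) R @ [x2])"
    using chR successively_append_iff by metis+
  have "length (x1 # take i R) = Suc i" using assms by simp
  then have "last (x1 # take i R) = (x1 # take i R) ! i" by (metis diff_Suc_1 last_conv_nth list.discI)
  also have "\<dots> = W ! i" using *(1) assms by (metis nth_append \<open>length (x1 # take i R) = Suc i\<close> lessI)
  finally show "last (x1 # take i R) = W ! i" .
  have "length (x1 # take (j - 1) R) = j" using assms by simp
  then show "hd (drop (j - 1) R @ [x2]) = W ! j" using *(2)
    by (metis Nil_is_append_conv hd_conv_nth list.discI nth_append_length_plus add.right_neutral)
qed

text \<open>A chord would shorten \<open>R\<close>. Only the chord \<open>x1 x2\<close> escapes,
  since the shortened path would have no inner vertex.\<close>

lemma W_nonadj: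
  assumes "i + 2 \<le> j" "j \<le> Suc (length R)" "\<not> (i = 0 \<and> j = Suc (length R))"
  shows "\<not> ad (W ! i) (W ! j)"
proof
  assume a: "ad (W ! i) (W ! j)"
  have ij: "i \<le> length R" "Suc i \<le> j" using assms by auto
  note w = W_walk[OF ij assms(2)]
  let ?R = "take i R @ drop (j - 1) R"
  have ne: "?R \<noteq> []" using assms R_ne by auto
  have "successively ad ((x1 # take i R) @ (drop (j - 1) R @ [x2]))"
    using w a by (subst successively_append_iff) auto
  then have "successively ad (x1 # ?R @ [x2])" by simp
  moreover have "set ?R \<inter> (I1 \<union> I2 \<union> set S1 \<union> set S2) = {}" using RC set_take_subset[of i R] set_drop_subset[of "j - 1" R] by auto
  ultimately have "length R \<le> length ?R" using Rmin[of x1 ?R x2] ne x12 n1(5) n2(5) by auto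
  then show False using assms by auto
qed

text \<open>The two vertices would be H-adjacent but not adjacent, hence have a common neighbour.
  Off the cycle it replaces at least two inner vertices of \<open>W\<close>; on the cycle it is the
  end of a shorter path.\<close>

lemma W_far:
  assumes ij: "i + 3 \<le> j" "j \<le> Suc (length R)" "\<not> (i = 0 \<and> j = Suc (length R))"
    and nx12: "\<not> ad x1 x2" and h: "heavy (W ! i)" "heavy (W ! j)"
  shows False
proof -
  have na: "\<not> ad (W ! i) (W ! j)" using W_nonadj[of i j] ij by auto
  have ij': "i \<le> length R" "Suc i \<le> j" using ij by auto
  note w = W_walk[OF ij' ij(2)]
  have dW: "distinct W" using dists(3) n1(5) n2(5) x12 by (auto dest: cfgD)
  have ne: "W ! i \<noteq> W ! j" using dW ij by (subst nth_eq_iff_index_eq) auto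
  have "set W \<subseteq> V" using R_V edges ad_V by auto
  then have "W ! i \<in> V" "W ! j \<in> V" using ij nth_mem[of i W] nth_mem[of j W] by auto
  then have HH: "H (W ! i) (W ! j)" using heavy_H h ne by blast
  have "2 \<le> card {y. ad (W ! i) y \<and> ad (W ! j) y}" using common_nb_card[OF HH na, of "{}"] by simp
  then have "{y. ad (W ! i) y \<and> ad (W ! j) y} \<noteq> {}" by (metis card.empty not_numeral_le_zero)
  then obtain y where y: "ad (W ! i) y" "ad (W ! j) y" by blast
  have sub: "set (take i R) \<subseteq> set R" "set (drop (j - 1) R) \<subseteq> set R" by (simp_all add: set_take_subset set_drop_subset)
  have jx: "j \<le> length R \<Longrightarrow> drop (j - 1) R \<noteq> [] \<and> length (drop (j - 1) R) < length R" using ij by auto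
  show False
  proof (cases "y \<in> I1 \<union> I2 \<union> set S1 \<union> set S2")
    case False
    let ?R = "take i R @ [y] @ drop (j - 1) R"
    have "successively ad (y # (drop (j - 1) R @ [x2]))"
      using w(3,4) y(2)[THEN ad_sym] by (simp add: successively_Cons)
    then have "successively ad ((x1 # take i R) @ (y # (drop (j - 1) R @ [x2])))"
      using w(1,2) y(1) unfolding successively_append_iff[of ad "x1 # take i R"] by simp
    then have "successively ad (x1 # ?R @ [x2])" by simp
    moreover have "set ?R \<inter> (I1 \<union> I2 \<union> set S1 \<union> set S2) = {}" using RC sub False by auto
    ultimately have "length R \<le> length ?R" using Rmin[of x1 ?R x2] x12 n1(5) n2(5) by auto
    then show False using ij by auto
  next
    case y_in: True
    have drop_path: False if "ad (hd (drop (j - 1) R @ [x2])) z" "z \<noteq> x2" "z \<in> I1 \<union> I2 \<union> set S1 \<union> set S2" "j \<le> length R" for z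
    proof -
      have "successively ad (z # (drop (j - 1) R @ [x2]))"
        using w(3) that(1)[THEN ad_sym] by (auto simp: successively_Cons)
      moreover have "set (drop (j - 1) R) \<inter> (I1 \<union> I2 \<union> set S1 \<union> set S2) = {}" using RC sub by auto
      ultimately show False using Rmin[of z "drop (j - 1) R" x2] jx[OF that(4)] that n2(5) by auto
    qed
    show False
    proof (cases "i = 0")
      case True
      then have "j \<le> length R" using ij by auto
      moreover have "y \<noteq> x2" using y True nx12 by auto
      ultimately show False using drop_path[of y] y w(4) y_in by auto
    next
      case i0: False
      show False
      proof (cases "y = x1")
        case True
        then have "j \<le> length R" using y(2)[THEN ad_sym] nx12 ij by (cases "j = Suc (length R)") (auto simp: nth_append)
        then show False using drop_path[of x1] y True w(4) x12 n1(5) by auto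
      next
        case False
        have "successively ad ((x1 # take i R) @ [y])" using w(1,2) y by (subst successively_append_iff) auto
        then have "successively ad (x1 # take i R @ [y])" by simp
        moreover have "set (take i R) \<inter> (I1 \<union> I2 \<union> set S1 \<union> set S2) = {}" using RC sub by auto
        moreover have "take i R \<noteq> []" using i0 R_ne by auto
        ultimately have "length R \<le> length (take i R)" using Rmin[of x1 "take i R" y] False y_in n1(5) by auto
        then show False using ij by auto
      qed
    qed
  qed
qed

section \<open>The case that \<open>hd S1\<close> and \<open>last S2\<close> are light\<close>

lemma V_in: "p1 \<in> V" "x1 \<in> V" "q1 \<in> V" "p2 \<in> V" "x2 \<in> V" "q2 \<in> V" "hd S1 \<in> V" "hd S2 \<in> V"
  "last S1 \<in> V" "last S2 \<in> V"
  using edges ad_V by blast+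

lemma node_ad: "ad x1 p1" "ad p1 x1" "ad x1 q1" "ad q1 x1" "ad x2 p2" "ad p2 x2" "ad x2 q2" "ad q2 x2"
  using cl1 cl2 n1 n2 ad_sym by auto

lemma R_nonadj:
  assumes "r \<in> set R"
  shows "\<not> ad p1 r" "\<not> ad (hd S1) r" "\<not> ad r q2" "\<not> ad r (last S2)" "\<not> ad r p1" "\<not> ad r (hd S1)"
  using nonadj_R[OF assms] ad_H ad_sym by blast+

lemma R_light: "heavy u \<Longrightarrow> u \<in> {p1, hd S1, q1, hd S2, p2, last S1, q2, last S2} \<Longrightarrow> r \<in> set R \<Longrightarrow> \<not> heavy r"
proof
  assume h: "heavy u" "u \<in> {p1, hd S1, q1, hd S2, p2, last S1, q2, last S2}" "r \<in> set R" "heavy r"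
  have "r \<in> V" using h(3) R_V by blast
  moreover have "u \<noteq> r" using h(2,3) n1(4,6) n2(4,6) S1_ne S2_ne hd_in_set[OF S1_ne] last_in_set[OF S1_ne]
      hd_in_set[OF S2_ne] last_in_set[OF S2_ne] by (auto dest: cfgD)
  moreover have "u \<in> V" using h(2) V_in by auto
  ultimately have "H u r" using heavy_H h by blast
  then show False using nonadj_R[OF h(3)] h(2) by auto
qed

text \<open>Windows of six vertices on \<open>hd S1\<close>, \<open>p1\<close>, \<open>x1\<close>,
  \<open>R\<close>, \<open>x2\<close>, \<open>q2\<close>, \<open>last S2\<close> are induced paths
  (an edge \<open>x1 x2\<close> bypasses \<open>R\<close>). A light end makes the other end heavy,
  until two heavy vertices exclude each other or both ends are light.\<close>

lemma hd_S1_or_last_S2_heavy: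
  assumes c: "\<not> heavy (hd S1)" and f: "\<not> heavy (last S2)"
  shows False
proof -
  note na = nonadj_ad edges node_ad
  have Hpq: "\<not> (heavy p1 \<and> heavy q2)" "\<not> (heavy x1 \<and> heavy q2)" "\<not> (heavy p1 \<and> heavy x2)"
    using nonadj(1,2,7) heavy_H V_in by (metis n1(4) n2(5,6) dI disjoint_iff n1(5))+
  have mx: "\<not> ad (hd S1) x1" "\<not> ad x2 (last S2)" using maximal ad_sym by blast+
  show False
  proof (cases "ad x1 x2")
    case True
    then show False using p6[of "hd S1" p1 x1 x2 q2 "last S2"] na mx c f ad_sym by blast
  next
    case x12: False
    note far = W_far[OF _ _ _ x12]
    have ch: "successively ad (x1 # R @ [x2])" by (rule chR)
    note nr = R_nonadj
    consider r where "R = [r]" | r1 r2 where "R = [r1, r2]" | r1 r2 r3 R' where "R = r1 # r2 # r3 # R'"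
      using R_ne by (metis list.exhaust)
    then show False
    proof cases
      case 1
      note F = 1 na mx nr[of r] x12 ch
      have "heavy (hd S1) \<or> heavy q2"
        by (rule p6[of _ p1 x1 r x2]) (use F in auto)
      moreover have "heavy p1 \<or> heavy (last S2)"
        by (rule p6[of _ x1 r x2 q2]) (use F in auto)
      ultimately show False using c f Hpq by blast
    next
      case 2
      have nn: "\<not> ad x1 r2" "\<not> ad r1 x2" using W_nonadj[of 0 2] W_nonadj[of 1 3] 2 by auto
      note F = 2 na mx nr[of r1] nr[of r2] nn x12 ch
      have "heavy (hd S1) \<or> heavy x2"
        by (rule p6[of _ p1 x1 r1 r2]) (use F in auto)
      moreover have "heavy p1 \<or> heavy q2"
        by (rule p6[of _ x1 r1 r2 x2]) (use F in auto)
      moreover have "heavy x1 \<or> heavy (last S2)"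
        by (rule p6[of _ r1 r2 x2 q2]) (use F in auto)
      ultimately show False using c f Hpq by blast
    next
      case 3
      have nn: "\<not> ad x1 r2" "\<not> ad r1 r3" "\<not> ad x1 r3"
        using W_nonadj[of 0 2] W_nonadj[of 1 3] W_nonadj[of 0 3] 3 by auto
      have "heavy (hd S1) \<or> heavy r3"
        by (rule p6[of _ p1 x1 r1 r2]) (use 3 na mx nr[of r1] nr[of r2] nr[of r3] nn x12 ch in auto)
      \<comment> \<open>The heavy \<open>r3\<close> makes \<open>p1\<close>, \<open>q2\<close> and
        \<open>x1\<close> light. Windows shifted along \<open>R\<close> then have two light ends or
        produce a heavy vertex three steps beyond \<open>r3\<close>.\<close>
      then have r3: "heavy r3" using c by blast
      have lq: "\<not> heavy p1" "\<not> heavy q2" using R_light[of _ r3] r3 3 by auto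
      have x1l: "\<not> heavy x1" using far[of 0 3] r3 3 by auto
      consider "R' = []" | r4 where "R' = [r4]" | r4 r5 where "R' = [r4, r5]"
        | r4 r5 r6 R'' where "R' = r4 # r5 # r6 # R''"
        by (metis list.exhaust)
      then show False
      proof cases
        case a: 1
        have nn': "\<not> ad r1 x2" "\<not> ad r2 x2" using W_nonadj[of 1 4] W_nonadj[of 2 4] 3 a by auto
        have "heavy x1 \<or> heavy q2"
          by (rule p6[of _ r1 r2 r3 x2]) (use 3 a na mx nr[of r1] nr[of r2] nr[of r3] nn nn' x12 ch in auto)
        then show False using x1l lq by blast
      next
        case a: 2
        have nn': "\<not> ad x1 r4" "\<not> ad r1 r4" "\<not> ad r2 r4" "\<not> ad r1 x2" "\<not> ad r2 x2" "\<not> ad r3 x2"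
          using W_nonadj[of 0 4] W_nonadj[of 1 4] W_nonadj[of 2 4] W_nonadj[of 1 5] W_nonadj[of 2 5] W_nonadj[of 3 5] 3 a by auto
        note F = 3 a na mx nr[of r1] nr[of r2] nr[of r3] nr[of r4] nn nn' x12 ch
        have "heavy p1 \<or> heavy r4"
          by (rule p6[of _ x1 r1 r2 r3]) (use F in auto)
        then have "\<not> heavy r1" using far[of 1 4] lq 3 a by auto
        moreover have "heavy r1 \<or> heavy q2"
          by (rule p6[of _ r2 r3 r4 x2]) (use F in auto)
        ultimately show False using lq by blast
      next
        case a: 3
        have nn': "\<not> ad x1 r4" "\<not> ad r1 r4" "\<not> ad r2 r4" "\<not> ad r1 r5" "\<not> ad r2 r5" "\<not> ad r3 r5"
          "\<not> ad r1 x2" "\<not> ad r2 x2" "\<not> ad r3 x2" "\<not> ad r4 x2"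
          using W_nonadj[of 0 4] W_nonadj[of 1 4] W_nonadj[of 2 4] W_nonadj[of 1 5] W_nonadj[of 2 5] W_nonadj[of 3 5]
            W_nonadj[of 1 6] W_nonadj[of 2 6] W_nonadj[of 3 6] W_nonadj[of 4 6] 3 a by auto
        note F = 3 a na mx nr[of r1] nr[of r2] nr[of r3] nr[of r4] nr[of r5] nn nn' x12 ch
        have "heavy p1 \<or> heavy r4"
          by (rule p6[of _ x1 r1 r2 r3]) (use F in auto)
        then have "\<not> heavy r1" using far[of 1 4] lq 3 a by auto
        moreover have "heavy r1 \<or> heavy x2"
          by (rule p6[of _ r2 r3 r4 r5]) (use F in auto)
        moreover have "\<not> heavy x2" using far[of 3 6] r3 3 a by auto
        ultimately show False by blast
      next
        case a: 4
        have nn': "\<not> ad x1 r4" "\<not> ad r1 r4" "\<not> ad r2 r4" "\<not> ad r1 r5" "\<not> ad r2 r5" "\<not> ad r3 r5"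
          "\<not> ad r1 r6" "\<not> ad r2 r6" "\<not> ad r3 r6" "\<not> ad r4 r6"
          using W_nonadj[of 0 4] W_nonadj[of 1 4] W_nonadj[of 2 4] W_nonadj[of 1 5] W_nonadj[of 2 5] W_nonadj[of 3 5]
            W_nonadj[of 1 6] W_nonadj[of 2 6] W_nonadj[of 3 6] W_nonadj[of 4 6] 3 a by auto
        note F = 3 a na mx nr[of r1] nr[of r2] nr[of r3] nr[of r4] nr[of r5] nn nn' x12 ch
        have "heavy p1 \<or> heavy r4"
          by (rule p6[of _ x1 r1 r2 r3]) (use F in auto)
        then have "\<not> heavy r1" using far[of 1 4] lq 3 a by auto
        moreover have "heavy r1 \<or> heavy r6"
          by (rule p6[of _ r2 r3 r4 r5]) (use F in auto)
        moreover have "\<not> heavy r6" using far[of 3 6] r3 3 a by auto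
        ultimately show False by blast
      qed
    qed
  qed
qed

section \<open>The case that \<open>hd S1\<close> and \<open>hd S2\<close> are heavy\<close>

lemma S_V: "z \<in> set S1 \<Longrightarrow> z \<in> V" "z \<in> set S2 \<Longrightarrow> z \<in> V"
  using gin_segment[of "[p1]" "[p2]" S1 z] gin_segment[of "[q1]" "[q2]" S2 z] chS1 chS2 ad_V
  unfolding gin_def by auto

lemma heavy_far: "heavy u \<Longrightarrow> \<not> H u v \<Longrightarrow> u \<in> V \<Longrightarrow> v \<in> V \<Longrightarrow> u \<noteq> v \<Longrightarrow> \<not> heavy v"
  using heavy_H by blast

lemma distinct_vertices:
  "hd S1 \<noteq> hd S2" "hd S1 \<noteq> x2" "hd S1 \<noteq> q2" "hd S1 \<noteq> p2" "hd S1 \<noteq> last S2" "hd S2 \<noteq> x2" "hd S2 \<noteq> p2" "hd S2 \<noteq> q2"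
  "hd S2 \<noteq> last S1" "last S1 \<noteq> last S2" "hd S1 \<noteq> x1" "hd S2 \<noteq> x1" "hd S1 \<noteq> p1" "hd S1 \<noteq> q1"
  "last S2 \<noteq> x1" "last S2 \<noteq> p1" "last S2 \<noteq> q1" "last S1 \<noteq> x1" "last S1 \<noteq> p1" "last S1 \<noteq> q1"
  "x1 \<noteq> q2" "x1 \<noteq> p2" "p1 \<noteq> x2" "p1 \<noteq> q2" "q1 \<noteq> x2" "q1 \<noteq> p2" "p1 \<noteq> p2" "q1 \<noteq> q2"
  "last S2 \<noteq> q2" "last S2 \<noteq> x2" "last S1 \<noteq> x2"
  using hd_in_set[OF S1_ne] last_in_set[OF S1_ne] hd_in_set[OF S2_ne] last_in_set[OF S2_ne] n1(4-6) n2(4-6)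
  by (auto dest: cfgD)

text \<open>The vertices avoided are all those that \<open>T_path\<close> may place after
  \<open>x1\<close>.\<close>

definition far :: "'a \<Rightarrow> bool" where
  "far v \<longleftrightarrow> \<not> ad v x2 \<and> \<not> ad v q2 \<and> \<not> ad v (last S2) \<and> (\<forall>r \<in> set R. \<not> ad v r)"

text \<open>The continuation of an induced path beyond \<open>x1\<close>: along \<open>R\<close>,
  then through \<open>x2\<close> and \<open>q2\<close> as far as room remains, or across the edge
  \<open>x1 x2\<close> if there is one.\<close>

lemma T_path:
  obtains t2 t3 t4 where "{t2, t3, t4} \<subseteq> {x2, q2, last S2} \<union> set R" "ad x1 t2" "ad t2 t3" "ad t3 t4"
    "\<not> ad x1 t3" "\<not> ad x1 t4" "\<not> ad t2 t4"
proof (cases "ad x1 x2")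
  case True
  then show ?thesis using that[of x2 q2 "last S2"] nonadj_ad edges node_ad maximal by auto
next
  case False
  consider r where "R = [r]" | r1 r2 where "R = [r1, r2]" | r1 r2 r3 R' where "R = r1 # r2 # r3 # R'"
    using R_ne by (metis list.exhaust)
  then show ?thesis
  proof cases
    case 1
    then show ?thesis using that[of r x2 q2] False chR node_ad nonadj_ad R_nonadj[of r] by auto
  next
    case 2
    have nn: "\<not> ad x1 r2" "\<not> ad r1 x2" using W_nonadj[of 0 2] W_nonadj[of 1 3] 2 by auto
    then show ?thesis using that[of r1 r2 x2] False chR 2 by auto
  next
    case 3
    have nn: "\<not> ad x1 r2" "\<not> ad r1 r3" "\<not> ad x1 r3"
      using W_nonadj[of 0 2] W_nonadj[of 1 3] W_nonadj[of 0 3] 3 by auto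
    then show ?thesis using that[of r1 r2 r3] chR 3 by auto
  qed
qed

text \<open>An induced path from \<open>g\<close> to \<open>x1\<close> with at most five vertices is
  filled up to six from \<open>T_path\<close> and then has two light ends. In the last case
  \<open>x1\<close> is itself the sixth vertex and has to be light. Chords of the walk are excluded
  by the shorter cases.\<close>

lemma left_path:
  assumes lt: "\<forall>t \<in> {x2, q2, last S2} \<union> set R. \<not> heavy t"
    and g: "\<not> heavy g" "far g" "\<not> ad g x1" and a: "ad g a" "far a"
  shows "\<not> ad a x1"
    and "\<lbrakk>ad a b; far b\<rbrakk> \<Longrightarrow> \<not> ad b x1"
    and "\<lbrakk>ad a b; far b; ad b c; far c\<rbrakk> \<Longrightarrow> \<not> ad c x1"
    and "\<lbrakk>ad a b; far b; ad b c; far c; ad c e; far e; \<not> heavy x1\<rbrakk> \<Longrightarrow> \<not> ad e x1"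
proof -
  obtain t2 t3 t4 where t: "{t2, t3, t4} \<subseteq> {x2, q2, last S2} \<union> set R" "ad x1 t2" "ad t2 t3" "ad t3 t4"
    "\<not> ad x1 t3" "\<not> ad x1 t4" "\<not> ad t2 t4" by (rule T_path)
  have f: "\<not> ad v t2 \<and> \<not> ad v t3 \<and> \<not> ad v t4" if "far v" for v using that t(1) unfolding far_def by auto
  have l: "\<not> heavy t2" "\<not> heavy t3" "\<not> heavy t4" using t(1) lt by auto
  have s3: "\<not> ad a x1" if "ad g a" "far a" for a
    using p6[of g a x1 t2 t3 t4] g t l f that by blast
  have s4: "\<not> ad b x1" if "ad g a" "far a" "ad a b" "far b" for a b
    using p6[of g a b x1 t2 t3] s3 g t l f that by blast
  have s5: "\<not> ad c x1" if "ad g a" "far a" "ad a b" "far b" "ad b c" "far c" for a b c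
    using p6[of g a b c x1 t2] s3 s4[of a b] s4[of b c] s4[of a c] g t l f that by blast
  have s6: "\<not> ad e x1" if "ad g a" "far a" "ad a b" "far b" "ad b c" "far c" "ad c e" "far e" "\<not> heavy x1" for a b c e
    using p6[of g a b c e x1] s3 s4 s5[of a b e] s5[of a c e] s5[of b c e] s5[of a b c] g f that by blast
  show "\<not> ad a x1" using s3 a by blast
  show "\<lbrakk>ad a b; far b\<rbrakk> \<Longrightarrow> \<not> ad b x1" using s4 a by blast
  show "\<lbrakk>ad a b; far b; ad b c; far c\<rbrakk> \<Longrightarrow> \<not> ad c x1" using s5 a by blast
  show "\<lbrakk>ad a b; far b; ad b c; far c; ad c e; far e; \<not> heavy x1\<rbrakk> \<Longrightarrow> \<not> ad e x1" using s6 a by blast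
qed

text \<open>
  If the vertices \<open>c\<close> and \<open>d\<close> next to the first node are both heavy, they are H-adjacent and can
  be added to the node together, which then is extended further along \<open>S1\<close>.
\<close>

context
  fixes c d :: 'a and S1' S2' :: "'a list"
  assumes S1: "S1 = c # S1'" and S2: "S2 = d # S2'" and cd: "H c d" and ne: "S1' \<noteq> []" "S2' \<noteq> []"
begin

abbreviation J0 where "J0 \<equiv> insert d (insert c I1)"

lemma cd_notin: "c \<notin> I1" "d \<notin> I1" "c \<noteq> d" "H c p1" "H p1 c" "H d q1" "H q1 d" "H d c"
  using S1 S2 cd lk(1,3,7,9) H_sym by (auto dest: cfgD)

lemma end_node: "node J0 c x1 d"
proof -
  have s: "J0 - {x1} = insert d (insert c (I1 - {x1}))" "J0 - {d} = insert c I1" "J0 - {c} = insert d I1"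
    using cd_notin n1(5) by auto
  have "hpath H (insert d I1) d x1" using hpath_Cons[OF nh1(2)] cd_notin by auto
  then have a: "hpath H J0 c x1" using hpath_Cons[of H "insert d I1" d x1 c] cd cd_notin by (simp add: insert_commute)
  have "hpath H (insert c I1) c x1" using hpath_Cons[OF nh1(1)] cd_notin by auto
  then have b: "hpath H J0 d x1" using hpath_Cons[of H "insert c I1" c x1 d] cd_notin by simp
  have "hpath H (insert c I1) c q1" using hpath_Cons[OF nh1(3)] cd_notin by auto
  then have e: "hpath H J0 c d" using hpath_snoc[of H "insert c I1" c q1 d] cd_notin by auto
  have "hpath H (insert c (I1 - {x1})) c q1" using hpath_Cons[OF nh1(4)] cd_notin by auto
  then have f: "hpath H (J0 - {x1}) c d" using hpath_snoc[of H "insert c (I1 - {x1})" c q1 d] cd_notin s(1) by auto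
  show ?thesis unfolding node_def
    using a b e f \<open>hpath H (insert c I1) c x1\<close> \<open>hpath H (insert d I1) d x1\<close> cd_notin n1(5) s by auto
qed

lemma end_spl:
  assumes "v \<in> J0" "v \<noteq> x1" "v \<noteq> q1" "v \<noteq> d"
  shows "spl J0 c x1 d v"
proof (cases "v = c")
  case True
  then show ?thesis using node_spl[OF end_node] by simp
next
  case False
  then have "spl I1 p1 x1 q1 v"
    using assms clique_node(2)[of I1 p1 x1 q1 v] n1 cl1(2) by auto
  then obtain A where A: "A \<subseteq> I1" "hpath H A p1 v" "hpath H (I1 - A) q1 x1" unfolding spl_def by blast
  have "hpath H (insert c A) c v" using hpath_Cons[OF A(2)] A(1) cd_notin by auto
  moreover have "hpath H (insert d (I1 - A)) d x1" using hpath_Cons[OF A(3)] cd_notin by auto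
  moreover have "J0 - insert c A = insert d (I1 - A)" using A(1) cd_notin by auto
  ultimately show ?thesis unfolding spl_def using A(1) by (intro exI[of _ "insert c A"]) auto
qed

lemma end_cfg: "cfg V ad M J0 c x1 d I2 p2 x2 q2 S1' S2' R"
proof unfold_locales
  show "node J0 c x1 d" by (rule end_node)
  show "card J0 + card I2 + length S1' + length S2' = M" using cardM cd_notin n1(7) S1 S2 by simp
qed (use node2 ne R_ne chS1 chS2 chR dist dI dSI S1 S2 in auto)

lemma end_extend:
  "S1' = Ext @ S \<Longrightarrow> \<forall>z \<in> set Ext. H z d \<or> H z x1 \<Longrightarrow>
    cfg V ad M (J0 \<union> set Ext) (last (c # Ext)) x1 d I2 p2 x2 q2 S S2' R \<and>
    (\<forall>v \<in> J0 \<union> set Ext. v \<notin> {x1, q1, d} \<longrightarrow> spl (J0 \<union> set Ext) (last (c # Ext)) x1 d v)"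
proof (induction Ext arbitrary: S rule: rev_induct)
  case Nil
  then show ?case using end_cfg end_spl by auto
next
  case (snoc z Ext)
  let ?I = "J0 \<union> set Ext" and ?a = "last (c # Ext)"
  have IH: "cfg V ad M ?I ?a x1 d I2 p2 x2 q2 (z # S) S2' R"
    "\<forall>v \<in> ?I. v \<notin> {x1, q1, d} \<longrightarrow> spl ?I ?a x1 d v"
    using snoc.IH[of "z # S"] snoc.prems by auto
  interpret F: cfg V ad M ?I ?a x1 d I2 p2 x2 q2 "z # S" S2' R by (rule IH(1))
  have z: "z \<notin> ?I" "H z ?a" using F.dSI F.lk(7) by auto
  have I: "J0 \<union> set (Ext @ [z]) = insert z ?I" by auto
  have "cfg V ad M (insert z ?I) z x1 d I2 p2 x2 q2 S S2' R"
    using F.extend(2)[OF refl] snoc.prems(2) by auto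
  moreover have "spl (insert z ?I) z x1 d v" if "v \<in> insert z ?I" "v \<notin> {x1, q1, d}" for v
  proof (cases "v = z")
    case True
    then show ?thesis using spl_extend_new[OF F.node1 z(1)] by simp
  next
    case False
    then show ?thesis using spl_extend[OF _ z] IH(2) that by blast
  qed
  ultimately show ?case unfolding I by simp
qed

text \<open>The path enters the extension from its far end: \<open>d\<close>,
  \<open>last (c # Ext)\<close>, back to \<open>c\<close>, \<open>p1\<close>, ...,
  \<open>x1\<close>. It sets \<open>q1\<close> free for the separate visit in
  \<open>cut_far\<close>.\<close>

lemma end_path:
  assumes "S1' = Ext @ S" "H d (last (c # Ext))"
  shows "hpath H (J0 \<union> set Ext - {q1}) d x1"
proof -
  have "successively ad ((p1 # c # Ext) @ (S @ [p2]))" using chS1 S1 assms(1) by simp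
  then have "successively H (p1 # c # Ext)" using successively_append_iff succ_ad_H by blast
  then have s: "successively H (c # Ext)" by (auto simp: successively_Cons)
  have dc: "distinct (c # Ext)" using dists(1) S1 assms(1) by auto
  have "hpath H (set (c # Ext)) c (last (c # Ext))" using hpI[OF _ dc s] by simp
  then have 1: "hpath H (set (c # Ext)) (last (c # Ext)) c" by (rule rv)
  have sub: "z \<in> set (c # Ext) \<Longrightarrow> z \<in> set S1" for z using S1 assms(1) by auto
  have dS: "d \<in> set S2" using S2 by simp
  then have "d \<notin> set (c # Ext)" "d \<notin> I1" using sub cfgD(2)[OF dS] by blast+
  then have 2: "hpath H (insert d (set (c # Ext))) d c" using hpath_Cons[OF 1 assms(2)] by blast
  have "insert d (set (c # Ext)) \<inter> (I1 - {q1}) = {}" using \<open>d \<notin> I1\<close> sub by (auto dest: cfgD)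
  then have "hpath H (insert d (set (c # Ext)) \<union> (I1 - {q1})) d x1"
    using hpath_join[OF 2 nh1(5) cd_notin(4)] by blast
  moreover have "insert d (set (c # Ext)) \<union> (I1 - {q1}) = J0 \<union> set Ext - {q1}"
    using sub n1(6) cd_notin S2 cfgD(4)[OF n1(6)] by auto
  ultimately show ?thesis by simp
qed

end

text \<open>The vertex \<open>g\<close> beyond the extended node is light, so
  \<open>left_path\<close> applies to walks from it. Its neighbour \<open>a\<close> in the node
  turns out to be heavy, and a far common neighbour leads from \<open>a\<close> to
  \<open>x1\<close>, either at once or via \<open>c\<close> and \<open>p1\<close>.\<close>

lemma not_both_hd_heavy:
  assumes hc: "heavy (hd S1)" and hd: "heavy (hd S2)"
  shows False
proof -
  obtain c S1' d S2' where S: "S1 = c # S1'" "S2 = d # S2'" using S1_ne S2_ne by (metis list.exhaust)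
  have cd: "c = hd S1" "d = hd S2" using S by auto
  note dv = distinct_vertices[folded cd] and na = nonadj[folded cd] and na_ad = nonadj_ad[folded cd]
  note ed = edges[folded cd] and mx = maximal[folded cd] and Vi = V_in[folded cd]
  have h: "heavy c" "heavy d" using hc hd cd by auto
  have Hcd: "H c d" using heavy_H h Vi dv by blast
  have light: "\<not> heavy x2" "\<not> heavy q2" "\<not> heavy p2" "\<not> heavy (last S1)" "\<not> heavy (last S2)"
    using heavy_far[OF h(1)] heavy_far[OF h(2)] na dv Vi by blast+
  have lR: "r \<in> set R \<Longrightarrow> \<not> heavy r" for r using R_light[OF hc] by simp
  have lt: "\<forall>t \<in> {x2, q2, last S2} \<union> set R. \<not> heavy t" using light lR by blast
  have ne: "S1' \<noteq> []" "S2' \<noteq> []" using light h S by auto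
  have dV: "d \<in> V" and cV: "c \<in> V" using Vi by auto
  \<comment> \<open>Each alternative makes \<open>z\<close> H-adjacent to \<open>d\<close> or
    \<open>x1\<close>, heaviness because \<open>d\<close> is heavy; where \<open>Q\<close> first
    fails, \<open>g\<close> is light and adjacent to neither.\<close>
  define Q where "Q z \<longleftrightarrow> heavy z \<or> ad z x1 \<or> ad z d" for z
  define Ext where "Ext = takeWhile Q S1'"
  define S where "S = dropWhile Q S1'"
  define a where "a = last (c # Ext)"
  define I where "I = insert d (insert c I1) \<union> set Ext"
  have S1': "S1' = Ext @ S" unfolding Ext_def S_def by simp
  have ExtS: "z \<in> set Ext \<Longrightarrow> z \<in> set S1" for z using S(1) S1' by auto
  have QE: "z \<in> set Ext \<Longrightarrow> Q z" for z unfolding Ext_def by (rule set_takeWhileD[THEN conjunct2])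
  have QH: "H z d \<or> H z x1" if "z \<in> set Ext" for z
  proof -
    have "z \<noteq> d" "z \<in> V" using ExtS[OF that] S(2) S_V by (auto dest: cfgD)
    then show ?thesis using QE[OF that] heavy_H[OF _ h(2) _ dV] ad_H unfolding Q_def by blast
  qed
  have ext: "cfg V ad M I a x1 d I2 p2 x2 q2 S S2' R"
    "v \<in> I \<Longrightarrow> v \<noteq> x1 \<Longrightarrow> v \<noteq> q1 \<Longrightarrow> v \<noteq> d \<Longrightarrow> spl I a x1 d v" for v
    using end_extend[OF S Hcd ne S1'] QH unfolding I_def a_def by auto
  interpret F: cfg V ad M I a x1 d I2 p2 x2 q2 S S2' R by (rule ext(1))
  have lS2: "last S2' = last S2" using S(2) ne by simp
  define g where "g = hd S"
  have nQ: "\<not> Q g" unfolding g_def S_def using F.S1_ne[unfolded S_def] by (rule hd_dropWhile)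
  then have g: "\<not> heavy g" "\<not> ad g x1" "\<not> ad g d" unfolding Q_def by auto
  have gS: "g \<in> set S" unfolding g_def using F.S1_ne by simp
  have far_I: "far v" if "v \<in> I" "v \<noteq> x1" "v \<noteq> q1" "v \<noteq> d" for v
    using F.spl_far[OF ext(2)[OF that]] ad_H unfolding far_def lS2 by blast
  have far_g: "far g" using F.nonadj(4-6) F.nonadj_R(2) ad_H unfolding far_def lS2 g_def by blast
  have inI: "a \<in> I" "c \<in> I" "p1 \<in> I" "q1 \<in> I" using F.n1(4) n1(4,6) unfolding I_def by auto
  have aneq: "a \<noteq> x1" "a \<noteq> d" "a \<noteq> q1"
  proof -
    have "a \<in> set S1" using ExtS S(1) unfolding a_def by (cases Ext) (auto simp: last_in_set)
    then show "a \<noteq> x1" "a \<noteq> d" "a \<noteq> q1" using n1(5,6) S(2) by (auto dest: cfgD)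
  qed
  have far: "far a" "far c" "far p1" using far_I inI aneq dv n1(1,3) S(2) n1(4) by (auto dest: cfgD)
  have Hga: "ad g a" using F.edges(7) unfolding g_def .
  note L = left_path[OF lt g(1) far_g g(2) Hga far(1)]
  have cp: "ad c p1" using ed(7) .
  have ax: "\<not> ad a x1" using L(1) by blast
  \<comment> \<open>Otherwise \<open>g\<close>, \<open>c\<close>, \<open>p1\<close>,
    \<open>x1\<close> is a walk excluded by \<open>left_path\<close>; for the next claim it is
    \<open>g\<close>, \<open>a\<close>, \<open>c\<close>, \<open>p1\<close>,
    \<open>x1\<close>.\<close>
  have ac': "a \<noteq> c"
  proof
    assume "a = c"
    then show False using L(2)[of p1] cp far(3) node_ad by blast
  qed
  have ac: "\<not> ad a c" using L(3)[of c p1] cp far node_ad by blast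
  define r where "r = last R"
  have r: "r \<in> set R" "ad x2 r" "\<not> heavy r" using R_ne ed(12) lR unfolding r_def by auto
  have dfar: "\<not> ad d x2" "s \<in> set R \<Longrightarrow> \<not> ad d s" for s
    using na(12) nonadj_R(4)[of s] ad_H cd by blast+
  have q1far: "\<not> ad q1 x2" "s \<in> set R \<Longrightarrow> \<not> ad q1 s" for s
    using na(9) nonadj_R(3)[of s] ad_H by blast+
  have r_nadj: "\<not> ad v r" if "far v" for v using that r(1) unfolding far_def by blast
  have q2r: "\<not> ad q2 r" "\<not> ad (last S2) r" using R_nonadj[OF r(1)] ad_sym by blast+
  have q1_notin: "q1 \<in> I" "q1 \<noteq> x1" "q1 \<noteq> d" using inI n1(2) S(2) n1(6) by (auto dest: cfgD)
  \<comment> \<open>\<open>q1\<close> is visited on its own, next to \<open>g\<close>, while the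
    rest of the node is walked from \<open>d\<close> to \<open>x1\<close>.\<close>
  have factE: "\<not> ad q1 q2 \<and> \<not> ad q1 (last S2)" if "H d a" "ad g q1"
  proof -
    have "hpath H (I - {q1}) d x1" using end_path[OF S Hcd ne S1'] that(1) unfolding I_def a_def by blast
    then show ?thesis
      using F.cut_far[of "{q1}" q1 q1] q1_notin ad_H ad_sym that(2) lS2 unfolding g_def
      by (metis empty_subsetI hpath_single insert_subset)
  qed
  \<comment> \<open>The walk \<open>g\<close>, \<open>a\<close>, \<open>d\<close>,
    \<open>q1\<close>, \<open>x1\<close> contradicts \<open>left_path\<close> once \<open>d\<close>
    and \<open>q1\<close> are far; induced six-vertex paths rule out their adjacencies to
    \<open>q2\<close> and \<open>last S2\<close>.\<close>
  have ad_ad: "\<not> ad a d"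
  proof
    assume aad: "ad a d"
    then have Hda: "H d a" using ad_H ad_sym by blast
    have dq: "ad d q1" using ed(9) .
    have gd: "\<not> ad g d" by (rule g(3))
    have "\<not> ad d q2"
    proof
      assume "ad d q2"
      then show False using p6[of g a d q2 x2 r] Hga aad node_ad r g far_g far(1) dfar r(1) q2r unfolding far_def by blast
    qed
    moreover have "\<not> ad d (last S2)"
    proof
      assume "ad d (last S2)"
      then show False using p6[of g a d "last S2" q2 x2] calculation Hga aad node_ad ed g far_g far(1) dfar mx(4) light ad_sym
        unfolding far_def by blast
    qed
    moreover have "\<not> ad q1 q2"
    proof
      assume q: "ad q1 q2"
      then have "\<not> ad g q1" using factE[OF Hda] by blast
      then show False
        using p6[of g a d q1 q2 x2] p6[of g a q1 q2 x2 r] q calculation Hga aad dq node_ad r g far_g far(1)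
          dfar q1far r(1) q2r light unfolding far_def by blast
    qed
    moreover have "\<not> ad q1 (last S2)"
    proof
      assume q: "ad q1 (last S2)"
      then have "\<not> ad g q1" using factE[OF Hda] by blast
      then show False
        using p6[of g a d q1 "last S2" q2] p6[of g a q1 "last S2" q2 x2] q calculation Hga aad dq node_ad ed g
          far_g far(1) dfar q1far mx(4) light ad_sym unfolding far_def by blast
    qed
    ultimately have "far d" "far q1" using dfar q1far unfolding far_def by auto
    then show False using L(3)[of d q1] aad dq node_ad by blast
  qed
  have Ext_ne: "Ext \<noteq> []" using ac' unfolding a_def by auto
  then have aE: "a \<in> set Ext" unfolding a_def by simp
  then have ha: "heavy a" using QE[OF aE] ax ad_ad unfolding Q_def by blast
  have aV: "a \<in> V" using ExtS[OF aE] S_V by blast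
  have Hda: "H a z" if "heavy z" "z \<in> V" "a \<noteq> z" for z using heavy_H ha aV that by blast
  obtain Ext' where Ext': "Ext = Ext' @ [a]" using Ext_ne unfolding a_def by (metis append_butlast_last_id last_ConsR)
  \<comment> \<open>The predecessor of \<open>a\<close>. Without \<open>a\<close> and
    \<open>q1\<close> the node is still walked from \<open>d\<close> to \<open>x1\<close>, now
    entering at \<open>a'\<close>, so \<open>a\<close> and \<open>q1\<close> can be the part visited
    separately.\<close>
  define a' where "a' = last (c # Ext')"
  have "successively ad (p1 # c # Ext' @ [a] @ S @ [p2])" using chS1 S(1) S1' Ext' by simp
  then have "successively ad ((p1 # c # Ext') @ (a # S @ [p2]))" by simp
  then have aa': "ad a a'" unfolding successively_append_iff a'_def using ad_sym by auto
  have a'_in: "a' = c \<or> a' \<in> set Ext" unfolding a'_def Ext' by (cases "Ext' = []") auto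
  have a'S: "a' \<in> set S1" using a'_in ExtS S(1) by auto
  have "far a'"
    using far_I[of a'] a'_in inI(2) cfgD(1)[OF a'S] n1(5,6) S(2) unfolding I_def by auto
  then have "\<not> ad a' x1" using L(2) aa' by blast
  then have Hda': "H d a'"
    using a'_in Hcd H_sym QE[of a'] heavy_H[OF h(2) _ dV, of a'] S_V(1)[OF a'S] cfgD(1)[OF a'S] S(2) ad_H ad_sym
    unfolding Q_def by (metis list.set_intros(1))
  have factE': "\<not> ad q1 q2 \<and> \<not> ad q1 (last S2)" if "ad a q1"
  proof -
    have S1'': "S1' = Ext' @ (a # S)" using S1' Ext' by simp
    have aS: "a \<in> set (c # S1')" "a \<notin> insert c (set Ext')" using dists(1) S(1) S1'' by auto
    have "hpath H (insert d (insert c I1) \<union> set Ext' - {q1}) d x1"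
      using end_path[OF S Hcd ne S1''] Hda' unfolding a'_def by blast
    moreover have "I - {a, q1} = insert d (insert c I1) \<union> set Ext' - {q1}"
      unfolding I_def Ext' using aS aneq(2) S(1) cfgD(1)[of a] by auto
    ultimately have "hpath H (I - {a, q1}) d x1" by simp
    moreover have "hpath H {a, q1} a q1" using clique_hp[of "{a, q1}" a q1] ad_H that H_sym aneq(3) by auto
    ultimately show ?thesis
      using F.cut_far[of "{a, q1}" a q1] inI(1,4) F.lk(1) ad_H lS2 by auto
  qed
  \<comment> \<open>These two sets hold at most four vertices. Every neighbour of \<open>a\<close>
    outside them, except possibly \<open>p2\<close>, turns out to be far.\<close>
  define B1 where "B1 = {y. ad a y \<and> ad x2 y \<and> y \<notin> I \<union> I2 \<union> set R}"
  define B2 where "B2 = {y. ad a y \<and> ad q2 y \<and> y \<notin> I \<union> I2 \<union> set R}"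
  have B: "card B1 \<le> 2" "card B2 \<le> 2" "finite B1" "finite B2"
    using F.common_le2(1,2) unfolding B1_def B2_def by auto
  have good: "\<not> ad y x2 \<and> \<not> ad y q2 \<and> (\<forall>s \<in> set R. \<not> ad y s)"
    if y: "ad a y" "y \<notin> B1" "y \<notin> B2" "y \<noteq> p2" for y
  proof -
    have yR: "y \<notin> set R" using F.nonadj_R(1) y(1) ad_H by blast
    have yI2: "y \<notin> I2"
    proof
      assume "y \<in> I2"
      moreover have "y \<noteq> x2" "y \<noteq> q2" using far(1) y(1) unfolding far_def by auto
      ultimately have "spl I2 q2 x2 p2 y" using clique_node(2)[of I2 q2 x2 p2 y] n2 cl2(2) y(4) by auto
      then show False using F.spl_spl[OF node_spl[OF F.node1]] y(1) ad_H by blast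
    qed
    show ?thesis
    proof (cases "y \<in> I")
      case True
      then consider "far y" | "y = q1" using far_I y(1) ax ad_ad by blast
      then show ?thesis
      proof cases
        case 1 then show ?thesis unfolding far_def by blast
      next
        case 2 then show ?thesis using factE' y(1) q1far by blast
      qed
    next
      case False
      then have "\<not> ad y s" if "s \<in> set R" for s
        using F.attach(1)[OF False yI2 yR that] ad_H y(1) ad_sym by blast
      moreover have "\<not> ad y x2" "\<not> ad y q2" using y False yI2 yR ad_sym unfolding B1_def B2_def by blast+
      ultimately show ?thesis by blast
    qed
  qed
  have finish: "far y" if y: "ad a y" "y \<notin> B1" "y \<notin> B2" "y \<noteq> p2" for y
  proof -
    note gy = good[OF y]
    have "\<not> ad y (last S2)"
    proof
      assume yf: "ad y (last S2)"
      show False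
      proof (cases "ad g y")
        case True
        then show False using p6[of g y "last S2" q2 x2 r] yf gy ed node_ad r g far_g mx(4) q2r ad_sym r(1)
          unfolding far_def by blast
      next
        case False
        then show False using p6[of g a y "last S2" q2 x2] yf y(1) Hga gy ed node_ad r g far_g far(1) mx(4) light ad_sym
          unfolding far_def by blast
      qed
    qed
    then show ?thesis using gy unfolding far_def by blast
  qed
  have f_in: "last S2 \<in> set S2" using S2_ne by simp
  note rD = cfgD(3)[OF r(1)] and fD = cfgD(2)[OF f_in]
  show False
  proof (cases "heavy x1")
    case True
    have Hax: "H a x1" using Hda[OF True] Vi aneq by blast
    \<comment> \<open>Three common non-neighbours give at least 5 common neighbours, against at most
      4 excluded ones.\<close>
    have "\<exists>y. ad a y \<and> ad x1 y \<and> y \<notin> B1 \<union> B2"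
    proof (rule pick_common[OF Hax ax, of "{q2, last S2, c}"])
      show "{q2, last S2, c} \<subseteq> V" using Vi by auto
      show "finite (B1 \<union> B2)" using B by simp
      have "card {q2, last S2, c} = 3" using dv by auto
      then show "card (B1 \<union> B2) < 2 + card {q2, last S2, c}" using card_Un_le[of B1 B2] B by linarith
      show "\<not> ad a z \<and> \<not> ad x1 z \<and> z \<noteq> a \<and> z \<noteq> x1" if "z \<in> {q2, last S2, c}" for z
        using that far(1) ac ac' na_ad dv mx aE ExtS[OF aE] F.nonadj fD n2(6) cfgD(1)[OF ExtS[OF aE]]
        unfolding far_def by auto
    qed
    then obtain y where y: "ad a y" "ad x1 y" "y \<notin> B1" "y \<notin> B2" by blast
    have "y \<noteq> p2" using y(2) na(15) ad_H by blast
    then show False using L(2)[OF y(1)] finish[OF y(1,3,4)] y(2) ad_sym by blast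
  next
    case False
    have Hac: "H a c" using Hda[OF h(1) cV ac'] .
    \<comment> \<open>Now \<open>p2\<close> is excluded too: five common non-neighbours give at
      least 7 common neighbours, against at most 5 excluded ones.\<close>
    have "\<exists>y. ad a y \<and> ad c y \<and> y \<notin> B1 \<union> B2 \<union> {p2}"
    proof (rule pick_common[OF Hac ac, of "{r, x1, x2, q2, last S2}"])
      show "{r, x1, x2, q2, last S2} \<subseteq> V" using Vi R_V r by auto
      show "finite (B1 \<union> B2 \<union> {p2})" using B by simp
      have "card {r, x1, x2, q2, last S2} = 5"
        using dv rD fD f_in n1(5) n2(5,6) n2(2) x12 by (auto simp: card_insert_if)
      then show "card (B1 \<union> B2 \<union> {p2}) < 2 + card {r, x1, x2, q2, last S2}"
        using card_Un_le[of B1 B2] card_Un_le[of "B1 \<union> B2" "{p2}"] B by simp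
      show "\<not> ad a z \<and> \<not> ad c z \<and> z \<noteq> a \<and> z \<noteq> c" if "z \<in> {r, x1, x2, q2, last S2}" for z
        using that far(1,2) ax mx(1) dv r(1) rD fD n1(5) n2(5,6) cfgD(1)[OF ExtS[OF aE]] ExtS[OF aE] S(1) ad_commute[of c x1]
        unfolding far_def by auto
    qed
    then obtain y where y: "ad a y" "ad c y" "y \<notin> B1" "y \<notin> B2" "y \<noteq> p2" by blast
    show False
      using L(4)[OF y(1) finish[OF y(1,3,4,5)] _ far(2) cp far(3) False] y(2) ad_sym node_ad by blast
  qed
qed

end

section \<open>A segment with heavy ends\<close>

context cfg
begin

text \<open>The node may cease to be a clique, as new vertices are only asked to be H-adjacent to
  \<open>q1\<close>; but it can still be split at every vertex other than \<open>x1\<close> and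
  \<open>q1\<close>.\<close>

lemma extend_opposite:
  assumes "\<forall>v \<in> I1. v \<notin> {x1, q1} \<longrightarrow> spl I1 p1 x1 q1 v"
  shows "S1 = Ext @ S \<Longrightarrow> \<forall>z \<in> set Ext. H z q1 \<Longrightarrow>
    cfg V ad M (I1 \<union> set Ext) (last (p1 # Ext)) x1 q1 I2 p2 x2 q2 S S2 R \<and>
    (\<forall>v \<in> I1 \<union> set Ext. v \<notin> {x1, q1} \<longrightarrow> spl (I1 \<union> set Ext) (last (p1 # Ext)) x1 q1 v)"
proof (induction Ext arbitrary: S rule: rev_induct)
  case Nil
  have "cfg V ad M I1 p1 x1 q1 I2 p2 x2 q2 S1 S2 R" by unfold_locales
  then show ?case using assms Nil by simp
next
  case (snoc z Ext)
  let ?I = "I1 \<union> set Ext" and ?a = "last (p1 # Ext)"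
  have IH: "cfg V ad M ?I ?a x1 q1 I2 p2 x2 q2 (z # S) S2 R"
    "\<forall>v \<in> ?I. v \<notin> {x1, q1} \<longrightarrow> spl ?I ?a x1 q1 v"
    using snoc.IH[of "z # S"] snoc.prems by auto
  interpret F: cfg V ad M ?I ?a x1 q1 I2 p2 x2 q2 "z # S" S2 R by (rule IH(1))
  have z: "z \<notin> ?I" "H z ?a" using F.dSI F.lk(7) by auto
  have I: "I1 \<union> set (Ext @ [z]) = insert z ?I" by auto
  have "cfg V ad M (insert z ?I) z x1 q1 I2 p2 x2 q2 S S2 R"
    using F.extend(2)[OF refl] snoc.prems(2) by auto
  moreover have "spl (insert z ?I) z x1 q1 v" if "v \<in> insert z ?I" "v \<notin> {x1, q1}" for v
  proof (cases "v = z")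
    case True
    then show ?thesis using spl_extend_new[OF F.node1 z(1)] by simp
  next
    case False
    then show ?thesis using spl_extend[OF _ z] IH(2) that by blast
  qed
  ultimately show ?case unfolding I by simp
qed

lemma extend_opposite_max:
  assumes "\<forall>v \<in> I1. v \<notin> {x1, q1} \<longrightarrow> spl I1 p1 x1 q1 v" "H p1 q1"
  obtains I p S where "cfg V ad M I p x1 q1 I2 p2 x2 q2 S S2 R"
    "\<forall>v \<in> I. v \<notin> {x1, q1} \<longrightarrow> spl I p x1 q1 v" "H p q1" "\<not> H (hd S) q1" "last S = last S1"
proof -
  let ?E = "takeWhile (\<lambda>z. H z q1) S1" and ?S = "dropWhile (\<lambda>z. H z q1) S1"
  have *: "S1 = ?E @ ?S" "\<forall>z \<in> set ?E. H z q1" by (auto dest: set_takeWhileD)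
  note e = extend_opposite[OF assms(1) *]
  have "?S \<noteq> []" by (rule cfg.S1_ne[OF conjunct1[OF e]])
  moreover have "H (last (p1 # ?E)) q1"
    using *(2) assms(2) last_in_set[of ?E] by (cases "?E = []") (auto simp del: takeWhile_eq_Nil_iff)
  moreover have "last ?S = last S1" using *(1) \<open>?S \<noteq> []\<close> by (metis last_appendR)
  ultimately show ?thesis using e that hd_dropWhile[of "\<lambda>z. H z q1" S1] by blast
qed

text \<open>Let \<open>a\<close>, \<open>b\<close> be the neighbours of \<open>y\<close> along the
  cycle. If \<open>x1\<close> is H-adjacent to one of them, the detour \<open>x1\<close>,
  \<open>R\<close>, \<open>x2\<close> fits between it and \<open>y\<close>. Otherwise the claw at
  \<open>y\<close> makes \<open>a b\<close> H-adjacent, and \<open>y\<close> is free to lead from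
  \<open>x2\<close> to \<open>q1\<close>.\<close>

lemma no_common_nb_x:
  assumes y: "y \<in> set S1" "ad y x1" "ad y x2" "H y q1"
  shows False
proof -
  obtain Sa Sb where S: "S1 = Sa @ y # Sb" using y by (meson split_list)
  define a b where ab_def: "a = last (p1 # Sa)" "b = hd (Sb @ [p2])"
  have ady: "ad a y" "ad y b" and chs: "successively H (p1 # Sa)" "successively H (Sb @ [p2])"
    using succ_ad_split[OF chS1[unfolded S append.assoc append_Cons]] unfolding ab_def by blast+
  have sub: "x \<in> set Sa \<Longrightarrow> x \<in> set S1" "x \<in> set Sb \<Longrightarrow> x \<in> set S1" for x using S by auto
  have ds: "distinct Sa" "distinct Sb" "set Sa \<inter> set Sb = {}" "y \<notin> set Sa" "y \<notin> set Sb"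
    using S dists(1) by auto
  have len: "length S1 = Suc (length Sa + length Sb)" using S by simp
  have yD: "y \<notin> I1" "y \<notin> I2" "y \<notin> set R" "y \<notin> set S2" using cfgD(1)[OF y(1)] by auto
  have sH: "successively H R" "successively H S2"
    using chR chS2 succ_ad_H by (auto simp: successively_Cons successively_append_iff)
  have yx: "H y x1" "H y x2" "H x1 y" "H x2 y" using y ad_H ad_sym by auto
  have lRx: "H (last R) x2" "H x2 (last R)" "H x1 (hd R)" "H (hd R) x1" using lk by auto
  obtain P2 where P2: "P2 \<noteq> []" "hd P2 = p2" "last P2 = q2" "distinct P2" "successively H P2"
    "set P2 = I2 - {x2}" "length P2 = card (I2 - {x2})" using half.hpath_list[OF half_p nh2(4)] .
  obtain Pq where Pq: "Pq \<noteq> []" "hd Pq = q1" "last Pq = p1" "distinct Pq" "successively H Pq"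
    "set Pq = I1 - {x1}" "length Pq = card (I1 - {x1})" using half.hpath_list[OF half_p nh1(4)[THEN rv]] .
  obtain Pp where Pp: "Pp \<noteq> []" "hd Pp = p1" "last Pp = x1" "distinct Pp" "successively H Pp"
    "set Pp = I1 - {q1}" "length Pp = card (I1 - {q1})" using half.hpath_list[OF half_p nh1(5)] .
  define Q where "Q = Sb @ P2"
  have Q: "Q \<noteq> []" "hd Q = b" "last Q = q2" "set Q = set Sb \<union> (I2 - {x2})" "length Q = length Sb + card (I2 - {x2})"
    using P2 unfolding Q_def ab_def by (auto simp: hd_append)
  have sQ: "successively H Q" unfolding Q_def using chs(2) P2(1,2,5) by (auto simp: successively_append_iff)
  have dQ: "distinct Q" unfolding Q_def using P2(4) ds by (auto simp: P2(6) dest: cfgD sub)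
  have rQ: "successively H (rev Q)" "rev Q \<noteq> []" "hd (rev Q) = q2" "last (rev Q) = b"
    using sQ Q by (auto simp: hd_rev last_rev)
  define W where "W = Pq @ Sa"
  have W: "W \<noteq> []" "hd W = q1" "last W = a" "successively H W" "set W = (I1 - {x1}) \<union> set Sa"
    "length W = card (I1 - {x1}) + length Sa" "distinct W"
    using Pq chs(1) ds unfolding W_def ab_def
    by (auto simp: successively_append_iff successively_Cons Pq(6) dest: cfgD sub)
  define U where "U = rev Sa @ Pp"
  have U: "U \<noteq> []" "hd U = a" "last U = x1" "successively H U" "set U = (I1 - {q1}) \<union> set Sa"
    "length U = card (I1 - {q1}) + length Sa" "distinct U"
    using Pp chs(1) ds unfolding U_def ab_def
    by (auto simp: successively_append_iff successively_Cons hd_append hd_rev last_rev Pp(6) intro: H_sym dest: cfgD sub)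
  have "\<not> H a x1"
  proof
    assume ax: "H a x1"
    let ?Z = "W @ [x1] @ R @ [x2] @ [y] @ Q @ rev S2"
    have "distinct ?Z" using W(7) dQ ds dists yD n1(5) n2(5)
      by (auto simp: W(5) Q(4) dest: cfgD sub)
    moreover have "successively H ?Z"
      by (simp add: successively_append_iff successively_Cons hd_rev last_rev W(1-4) Q(1-3) sQ sH ax yx lRx
          ad_H[OF ady(2)] S2_ne R_ne lk)
    moreover have "H (last ?Z) (hd ?Z)" by (simp add: S2_ne W(1,2) lk last_rev)
    moreover have "M < length ?Z" using W(6) Q(5) cardM len n1(8) n2(8) cards(4)
      by (simp only: length_append length_rev list.size; linarith)
    ultimately show False using no_cyc_list[of ?Z] by simp
  qed
  moreover have "\<not> H x1 b"
  proof
    assume xb: "H x1 b"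
    let ?Z = "W @ [y] @ [x2] @ rev R @ [x1] @ Q @ rev S2"
    have "distinct ?Z" using W(7) dQ ds dists yD n1(5) n2(5)
      by (auto simp: W(5) Q(4) dest: cfgD sub)
    moreover have "successively H ?Z"
      by (simp add: successively_append_iff successively_Cons hd_rev last_rev W(1-4) Q(1-3) sQ sH xb yx lRx
          ad_H[OF ady(1)] S2_ne R_ne lk)
    moreover have "H (last ?Z) (hd ?Z)" by (simp add: S2_ne W(1,2) lk last_rev)
    moreover have "M < length ?Z" using W(6) Q(5) cardM len n1(8) n2(8) cards(4)
      by (simp only: length_append length_rev list.size; linarith)
    ultimately show False using no_cyc_list[of ?Z] by simp
  qed
  moreover have "a \<noteq> x1" "x1 \<noteq> b" "a \<noteq> b"
  proof -
    have "a \<in> insert p1 (set Sa)" unfolding ab_def by auto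
    moreover have "b \<in> insert p2 (set Sb)" unfolding ab_def by (cases Sb) auto
    moreover have "p1 \<noteq> x1" "p2 \<noteq> x1" "p1 \<noteq> p2" using n1(1,4,5) n2(4) by (auto dest: cfgD)
    moreover have "x1 \<notin> set Sa" "x1 \<notin> set Sb" "p1 \<notin> set Sb" "p2 \<notin> set Sa"
      using n1(4,5) n2(4) by (auto dest: cfgD sub)
    ultimately show "a \<noteq> x1" "x1 \<noteq> b" "a \<noteq> b" using ds(3) by auto
  qed
  ultimately have ab: "H b a" using claw[of y a x1 b] ady y(2) ad_sym H_sym by blast
  let ?Z = "U @ R @ [x2] @ [y] @ [q1] @ S2 @ rev Q"
  have "distinct ?Z" using U(7) dQ ds dists yD n1(6) n2(5)
    by (auto simp: U(5) Q(4) dest: cfgD sub)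
  moreover have "successively H ?Z"
    by (simp add: successively_append_iff successively_Cons U(1-4) rQ sQ sH yx lRx y(4) S2_ne R_ne lk Q(1))
  moreover have "H (last ?Z) (hd ?Z)" using ab U(1,2) rQ by simp
  moreover have "M < length ?Z" using U(6) Q(5) cardM len n1(9) n2(8) cards(4)
    by (simp only: length_append length_rev list.size; linarith)
  ultimately show False using no_cyc_list[of ?Z] by simp
qed

text \<open>\<open>y\<close> could be inserted between \<open>x1\<close> and
  \<open>q1\<close>.\<close>

lemma no_common_nb_x_off:
  assumes "y \<notin> I1 \<union> I2 \<union> set S1 \<union> set S2" "ad y x1" "ad y q1"
  shows False
proof -
  have l: "H x1 y" "H y q1" using assms ad_H ad_sym by auto
  show False
    by (rule no_cyc6[OF nh1(5) hpath_single hpath_single segs(2) nh2(3)[THEN rv] segs(1)[THEN rv] l lk(3,4,8,7)])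
      ((use cards cardM card_singleton[of y] card_singleton[of q1] n1(9) in linarith),
       (use assms(1) n1(6) in \<open>auto dest: cfgD; fail\<close>)+)
qed

end

text \<open>What remains of the cliques is that the nodes can be split (\<open>sp1\<close>,
  \<open>sp2\<close>) and that each \<open>p\<close> is H-adjacent to its \<open>q\<close>. In
  return the ends of \<open>S1\<close> are not even H-adjacent to \<open>q1\<close> and
  \<open>q2\<close>, respectively.\<close>

locale side = cfg +
  assumes p6: "\<lbrakk>ad a b; ad b c; ad c d; ad d e; ad e f; \<not> ad a c; \<not> ad a d; \<not> ad a e; \<not> ad a f;
      \<not> ad b d; \<not> ad b e; \<not> ad b f; \<not> ad c e; \<not> ad c f; \<not> ad d f\<rbrakk> \<Longrightarrow> heavy a \<or> heavy f"
    and sp1: "\<forall>v \<in> I1. v \<notin> {x1, q1} \<longrightarrow> spl I1 p1 x1 q1 v"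
    and sp2: "\<forall>v \<in> I2. v \<notin> {x2, q2} \<longrightarrow> spl I2 p2 x2 q2 v"
    and Hpq: "H p1 q1" "H p2 q2"
    and mxH: "\<not> H (hd S1) q1" "\<not> H (last S1) q2"
    and mx: "\<not> ad x1 (hd S2)" "\<not> ad x2 (last S2)"
    and adx: "ad x1 q1" "ad x2 q2"
    and hv: "heavy (hd S2)" "heavy (last S2)"
begin

lemma side_ends: "side V ad M I2 p2 x2 q2 I1 p1 x1 q1 (rev S1) (rev S2) (rev R)"
proof (intro side.intro side_axioms.intro)
  show "cfg V ad M I2 p2 x2 q2 I1 p1 x1 q1 (rev S1) (rev S2) (rev R)" by (rule cfg_ends)
qed (use p6 sp1 sp2 Hpq mxH mx adx hv S1_ne S2_ne in \<open>auto simp: hd_rev last_rev; fail\<close>)+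

lemma ad_nonadj:
  "\<not> ad p1 x2" "\<not> ad p1 q2" "\<not> ad p1 (last S2)" "\<not> ad (hd S1) x2" "\<not> ad (hd S1) q2" "\<not> ad (hd S1) (last S2)"
  "\<not> ad x1 q2" "\<not> ad x1 (last S2)"
  "\<not> ad q1 x2" "\<not> ad q1 p2" "\<not> ad q1 (last S1)" "\<not> ad (hd S2) x2" "\<not> ad (hd S2) p2" "\<not> ad (hd S2) (last S1)"
  "\<not> ad (hd S1) q1" "\<not> ad (last S1) q2"
  using nonadj mxH ad_H by blast+

lemma V_in: "p1 \<in> V" "x1 \<in> V" "q1 \<in> V" "p2 \<in> V" "x2 \<in> V" "q2 \<in> V" "hd S1 \<in> V" "hd S2 \<in> V"
  "last S1 \<in> V" "last S2 \<in> V" "hd R \<in> V" "last R \<in> V"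
  using edges adx ad_V ad_sym by blast+

lemma ends_in: "hd S1 \<in> set S1" "last S1 \<in> set S1" "hd S2 \<in> set S2" "last S2 \<in> set S2" "last R \<in> set R"
  using S1_ne S2_ne R_ne by auto

lemma distinct_vertices:
  "p1 \<noteq> last S2" "x1 \<noteq> last S2" "hd S1 \<noteq> last S2" "x1 \<noteq> hd S2" "x2 \<noteq> hd S2" "p2 \<noteq> hd S2" "last R \<noteq> hd S2"
  "p1 \<noteq> x2" "p1 \<noteq> q2" "q1 \<noteq> p2" "q1 \<noteq> x2" "q1 \<noteq> q2" "hd S1 \<noteq> q1" "hd S1 \<noteq> q2" "hd S1 \<noteq> x2" "hd S1 \<noteq> p2"
  "x1 \<noteq> x2" "x1 \<noteq> p2" "x1 \<noteq> q2" "x2 \<noteq> last S2" "last S1 \<noteq> q1" "last S1 \<noteq> q2" "q1 \<noteq> hd S2" "q1 \<noteq> last S2"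
  "q2 \<noteq> hd S2" "q2 \<noteq> last S2" "last R \<noteq> q1" "last R \<noteq> q2" "last R \<noteq> last S2" "last R \<noteq> x1" "last R \<noteq> x2"
  "last R \<noteq> p2" "last R \<noteq> hd S1" "last R \<noteq> last S1" "p2 \<noteq> last S1" "hd S1 \<noteq> hd S2"
  using ends_in n1(4-6) n2(4-6) by (auto dest: cfgD)

text \<open>Each of these vertices fails to be H-adjacent to one of the heavy vertices
  \<open>hd S2\<close>, \<open>last S2\<close>, whereas two heavy vertices always are.\<close>

lemma light: "\<not> heavy p1" "\<not> heavy x1" "\<not> heavy (hd S1)" "\<not> heavy x2" "\<not> heavy p2" "\<not> heavy (last R)"
proof -
  show "\<not> heavy p1" "\<not> heavy x1" "\<not> heavy (hd S1)"
    using heavy_H[OF _ hv(2)] nonadj V_in distinct_vertices by blast+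
  show "\<not> heavy x2" "\<not> heavy p2" using heavy_H[OF hv(1)] nonadj V_in distinct_vertices by blast+
  show "\<not> heavy (last R)"
    using heavy_H[OF _ hv(1), of "last R"] nonadj_R(4)[OF ends_in(5)] V_in distinct_vertices(7) H_sym by metis
qed

lemma R_far: "\<not> ad p1 (last R)" "\<not> ad (hd S1) (last R)" "\<not> ad q1 (last R)" "\<not> ad (hd S2) (last R)"
    "\<not> ad p2 (last R)" "\<not> ad (last S1) (last R)" "\<not> ad q2 (last R)" "\<not> ad (last S2) (last R)"
  using nonadj_R[OF ends_in(5)] ad_H by blast+

lemmas facts = ad_nonadj R_far light edges adx mx

text \<open>Inside a node \<open>y\<close> would be \<open>x1\<close>, \<open>x2\<close> or a vertex
  where the node can be split, and all of these are cut off from the opposite corner. Being next to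
  \<open>q1\<close> or \<open>hd S2\<close> keeps \<open>y\<close> off \<open>R\<close> and, by
  \<open>attach\<close>, away from \<open>last R\<close>.\<close>

lemma side_position:
  assumes "ad h y" "ad h' y" "h \<in> {q1, hd S2}" "h' \<in> {q2, last S2}" "y \<noteq> q1" "y \<noteq> q2"
  shows "y \<notin> I1 \<union> I2 \<union> set R" "\<not> ad y (last R)"
proof -
  interpret E: side V ad M I2 p2 x2 q2 I1 p1 x1 q1 "rev S1" "rev S2" "rev R" by (rule side_ends)
  have rS: "last (rev S2) = hd S2" using S2_ne by (simp add: last_rev)
  have Hy: "H y h" "H y h'" using assms ad_H ad_sym by blast+
  have "y \<notin> I1"
  proof
    assume "y \<in> I1"
    then consider "y = x1" | "spl I1 p1 x1 q1 y" using sp1 assms(5) by blast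
    then show False using nonadj(7,8) spl_far(2,3) Hy(2) assms(4) by cases blast+
  qed
  moreover have "y \<notin> I2"
  proof
    assume "y \<in> I2"
    then consider "y = x2" | "spl I2 p2 x2 q2 y" using sp2 assms(6) by blast
    then show False using E.nonadj(7,8)[unfolded rS] E.spl_far(2,3)[unfolded rS] Hy(1) assms(3) by cases blast+
  qed
  moreover have "y \<notin> set R" using nonadj_R(3,4) Hy(1) assms(3) H_sym by blast
  ultimately show *: "y \<notin> I1 \<union> I2 \<union> set R" by blast
  show "\<not> ad y (last R)"
  proof
    assume "ad y (last R)"
    then have "\<not> H y q1" "\<not> H y (hd S2)" using attach(3,4)[of y "last R"] * ends_in(5) by auto
    then show False using Hy(1) assms(3) by blast
  qed
qed

text \<open>If both pairs were H-adjacent by degree only, the four degrees would add up to at least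
  \<open>2 * card V\<close>, and one of the crossing pairs \<open>p1 q2\<close>,
  \<open>q1 p2\<close> would be H-adjacent as well.\<close>

lemma degree_sum: "ad p1 q1 \<or> ad p2 q2"
proof (rule ccontr)
  assume "\<not> ?thesis"
  then have "card V \<le> dg p1 + dg q1" "card V \<le> dg p2 + dg q2" using Hpq unfolding H_def by auto
  then have "card V \<le> dg p1 + dg q2 \<or> card V \<le> dg q1 + dg p2" by linarith
  then show False using nonadj(2,10) V_in distinct_vertices unfolding H_def by auto
qed

text \<open>Three common non-neighbours give at least 5 common neighbours, and adjacency to
  \<open>u\<close> or to \<open>v\<close> spoils at most two each.\<close>

lemma pick2:
  assumes "H h h'" "\<not> ad h h'" and "Os \<subseteq> V" "\<forall>z \<in> Os. \<not> ad h z \<and> \<not> ad h' z \<and> z \<noteq> h \<and> z \<noteq> h'"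
    and B: "card {y. ad u y \<and> ad h' y \<and> y \<notin> I1 \<union> I2 \<union> set R} \<le> 2"
      "card {y. ad v y \<and> ad w y \<and> y \<notin> I1 \<union> I2 \<union> set R} \<le> 2"
    and "w \<in> {h, h'}" "card Os = 3" "h \<in> {q1, hd S2}" "h' \<in> {q2, last S2}" "\<not> ad h q2 \<or> \<not> ad h' q2" "\<not> ad h q1 \<or> \<not> ad h' q1"
  shows "\<exists>y. ad h y \<and> ad h' y \<and> \<not> ad u y \<and> \<not> ad v y"
proof -
  let ?B1 = "{y. ad u y \<and> ad h' y \<and> y \<notin> I1 \<union> I2 \<union> set R}"
  let ?B2 = "{y. ad v y \<and> ad w y \<and> y \<notin> I1 \<union> I2 \<union> set R}"
  have "\<exists>y. ad h y \<and> ad h' y \<and> y \<notin> ?B1 \<union> ?B2"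
  proof (rule pick_common[OF assms(1-3)])
    show "card (?B1 \<union> ?B2) < 2 + card Os" using card_Un_le[of ?B1 ?B2] B assms(8) by linarith
    show "finite (?B1 \<union> ?B2)" by simp
  qed (use assms(4) in blast)
  then obtain y where y: "ad h y" "ad h' y" "y \<notin> ?B1 \<union> ?B2" by blast
  moreover have "y \<notin> I1 \<union> I2 \<union> set R"
    using side_position(1)[OF y(1,2) assms(9,10)] y(1,2) assms(11,12) by blast
  ultimately show ?thesis using assms(7) by blast
qed

text \<open>\<open>y\<close> replaces the missing edge \<open>q1 q2\<close> on the way from
  \<open>hd S1\<close> over \<open>p1\<close>, \<open>q1\<close>, \<open>q2\<close>,
  \<open>x2\<close> to \<open>last R\<close>. One of the shortcuts \<open>y p1\<close>,
  \<open>y x2\<close> still leaves six vertices, both together do not.\<close>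

lemma path_q1q2:
  assumes "ad p1 q1" "\<not> ad q1 q2" "ad q1 y" "ad q2 y" "\<not> ad y (hd S1)" "\<not> (ad y p1 \<and> ad y x2)"
  shows False
proof -
  have y: "y \<noteq> q1" "y \<noteq> q2" using assms by auto
  have yr: "\<not> ad y (last R)" using side_position(2)[OF assms(3,4) _ _ y] by simp
  show False
  proof (cases "ad y p1")
    case True
    then show False using p6[of "hd S1" p1 y q2 x2 "last R"] assms yr facts ad_sym by blast
  next
    case False
    then show False using p6[of "hd S1" p1 q1 y q2 x2] p6[of "hd S1" p1 q1 y x2 "last R"] assms yr facts ad_sym by blast
  qed
qed

lemma last_rev_S: "hd (rev S1) = last S1" "last (rev S1) = hd S1" "hd (rev S2) = last S2" "last (rev S2) = hd S2"
  using S1_ne S2_ne by (simp_all add: hd_rev last_rev)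

lemma case_H_q1_q2:
  assumes H12: "H q1 q2" and pq: "ad p1 q1"
  shows False
proof (cases "ad q1 q2")
  case True
  then show False using p6[of "hd S1" p1 q1 q2 x2 "last R"] pq facts ad_sym by blast
next
  case False
  interpret E: side V ad M I2 p2 x2 q2 I1 p1 x1 q1 "rev S1" "rev S2" "rev R" by (rule side_ends)
  interpret D: cfg V ad M I1 q1 x1 p1 I2 q2 x2 p2 S2 S1 R by (rule cfg_sides)
  note dv = distinct_vertices
  let ?c = "hd S1" and ?e = "last S1" and ?r = "last R"
  have B: "card {y. ad ?c y \<and> ad q2 y \<and> y \<notin> I1 \<union> I2 \<union> set R} \<le> 2"
    "card {y. ad p1 y \<and> ad q2 y \<and> y \<notin> I1 \<union> I2 \<union> set R} \<le> 2"
    "card {y. ad ?e y \<and> ad q1 y \<and> y \<notin> I1 \<union> I2 \<union> set R} \<le> 2"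
    using common_le2 E.common_le2(4) last_rev_S by (simp_all add: Un_commute)
  have irr: "\<not> ad q1 q2 \<or> \<not> ad q2 q2" "\<not> ad q1 q1 \<or> \<not> ad q2 q1" by auto
  show False
  proof (cases "ad p2 q2")
    case p2q2: False
    have "\<exists>y. ad q1 y \<and> ad q2 y \<and> \<not> ad ?c y \<and> \<not> ad p1 y"
    proof (rule pick2[OF H12 False, of "{?r, ?c, p2}", OF _ _ B(1,2)])
      show "{?r, ?c, p2} \<subseteq> V" using V_in by auto
      show "card {?r, ?c, p2} = 3" using dv by auto
      show "\<forall>z\<in>{?r, ?c, p2}. \<not> ad q1 z \<and> \<not> ad q2 z \<and> z \<noteq> q1 \<and> z \<noteq> q2"
        using facts p2q2 dv n2(3) ad_commute by auto
    qed (use irr in auto)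
    then show False using path_q1q2[OF pq False] ad_sym by blast
  next
    case p2q2: True
    \<comment> \<open>Seen from both nodes, \<open>path_q1q2\<close> leaves only a vertex adjacent
      to all of \<open>p1\<close>, \<open>x1\<close>, \<open>p2\<close>, \<open>x2\<close>, and
      every possible position of it is ruled out next.\<close>
    have bad: "ad y p1 \<and> ad y x2 \<and> ad y p2 \<and> ad y x1"
      if "ad q1 y" "ad q2 y" "\<not> ad ?c y" "\<not> ad ?e y" for y
      using path_q1q2[OF pq False that(1,2)] E.path_q1q2[OF p2q2 _ that(2,1)] False that(3,4) ad_sym last_rev_S by metis
    have no_bad: "\<not> (ad y p1 \<and> ad y x2 \<and> ad y p2 \<and> ad y x1)" if "ad q1 y" for y
    proof
      assume b: "ad y p1 \<and> ad y x2 \<and> ad y p2 \<and> ad y x1"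
      consider "y \<in> set S1" | "y \<in> set S2" | "y \<in> I1" | "y \<in> I2" | "y \<notin> I1 \<union> I2 \<union> set S1 \<union> set S2" by blast
      then show False
      proof cases
        case 1 then show False using no_common_nb_x b that ad_H ad_sym by blast
      next
        case 2 then show False using D.no_common_nb_x b ad_H by blast
      next
        case 3
        then have "spl I1 p1 x1 q1 y" using sp1 b that by auto
        then show False using spl_far(1) b ad_H by blast
      next
        case 4
        then have "y = q2 \<or> spl I2 p2 x2 q2 y" using sp2 b by auto
        then show False using E.spl_far(1) b ad_H nonadj(7) ad_sym by blast
      next
        case 5 then show False using no_common_nb_x_off b that ad_sym by blast
      qed
    qed
    have "\<exists>y. ad q1 y \<and> ad q2 y \<and> \<not> ad ?c y \<and> \<not> ad ?e y"
    proof (cases "?c = ?e")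
      case ce: False
      show ?thesis
      proof (rule pick2[OF H12 False, of "{?r, ?c, ?e}", OF _ _ B(1,3)])
        show "{?r, ?c, ?e} \<subseteq> V" using V_in by auto
        show "card {?r, ?c, ?e} = 3" using dv ce by auto
        show "\<forall>z\<in>{?r, ?c, ?e}. \<not> ad q1 z \<and> \<not> ad q2 z \<and> z \<noteq> q1 \<and> z \<noteq> q2"
          using facts dv ad_commute by auto
      qed (use irr in auto)
    next
      \<comment> \<open>When the two ends of \<open>S1\<close> coincide, one common non-neighbour is
        lost, but so is one of the two unwanted sets.\<close>
      case ce: True
      let ?B = "{y. ad ?c y \<and> ad q2 y \<and> y \<notin> I1 \<union> I2 \<union> set R}"
      have "\<exists>y. ad q1 y \<and> ad q2 y \<and> y \<notin> ?B"
      proof (rule pick_common[OF H12 False, of "{?r, ?c}"])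
        show "{?r, ?c} \<subseteq> V" using V_in by auto
        have "card {?r, ?c} = 2" using dv by auto
        then show "card ?B < 2 + card {?r, ?c}" using B(1) by linarith
        show "\<not> ad q1 z \<and> \<not> ad q2 z \<and> z \<noteq> q1 \<and> z \<noteq> q2" if "z \<in> {?r, ?c}" for z
          using that facts dv ad_commute by auto
      qed simp
      then obtain y where y: "ad q1 y" "ad q2 y" "y \<notin> ?B" by blast
      have yn: "y \<noteq> q1" "y \<noteq> q2" using y(1,2) ad_irr by auto
      have "y \<notin> I1 \<union> I2 \<union> set R" using side_position(1)[OF y(1,2) _ _ yn] by simp
      then show ?thesis using ce y by auto
    qed
    then show False using bad no_bad by blast
  qed
qed

text \<open>The crossing now uses \<open>last S2\<close> before \<open>q2\<close>. If
  \<open>y\<close> is adjacent to \<open>hd S1\<close>, the claws at \<open>y\<close> over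
  \<open>hd S1\<close> and \<open>q1\<close> keep it away from \<open>x2\<close> and
  \<open>q2\<close>.\<close>

lemma case_H_q1_last_S2:
  assumes n12: "\<not> H q1 q2" and H1f: "H q1 (last S2)" and pq: "ad p1 q1"
  shows False
proof (cases "ad q1 (last S2)")
  case True
  then show False using p6[of "hd S1" p1 q1 "last S2" q2 x2] pq n12 facts ad_sym ad_H by blast
next
  case False
  let ?c = "hd S1" and ?f = "last S2" and ?r = "last R"
  let ?B = "{y. ad p1 y \<and> ad ?f y \<and> y \<notin> I1 \<union> I2 \<union> set R}"
  have n12': "\<not> ad q1 q2" using n12 ad_H by blast
  have "\<exists>y. ad q1 y \<and> ad ?f y \<and> y \<notin> ?B"
  proof (rule pick_common[OF H1f False, of "{?r}"])
    show "{?r} \<subseteq> V" using V_in by auto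
    show "card ?B < 2 + card {?r}" using common_le2(3) by simp
    show "\<not> ad q1 z \<and> \<not> ad ?f z \<and> z \<noteq> q1 \<and> z \<noteq> ?f" if "z \<in> {?r}" for z
      using that facts distinct_vertices by auto
  qed simp
  then obtain y where y: "ad q1 y" "ad ?f y" "y \<notin> ?B" by blast
  have yn: "y \<noteq> q1" "y \<noteq> q2" using y n12' by auto
  note pos = side_position[OF y(1,2) _ _ yn]
  have yp: "\<not> ad p1 y" using pos(1) y by auto
  have yr: "\<not> ad y ?r" using pos(2) by simp
  show False
  proof (cases "ad y ?c")
    case True
    have "\<not> ad y x2" using claw[of y ?c x2 q1] True y(1) facts nonadj(4,9) mxH(1) distinct_vertices ad_sym H_sym by metis
    moreover have "\<not> ad y q2" using claw[of y ?c q2 q1] True y(1) nonadj(5) n12 mxH(1) distinct_vertices ad_sym H_sym by metis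
    ultimately show False using p6[of ?c y ?f q2 x2 ?r] True y yr facts ad_sym by blast
  next
    case False
    then show False using p6[of ?c p1 q1 y x2 ?r] p6[of ?c p1 q1 y q2 x2] p6[of p1 q1 y ?f q2 x2]
        y yp yr pq n12' \<open>\<not> ad q1 ?f\<close> facts ad_sym by blast
  qed
qed

lemma case_H_hd_S2_q2:
  assumes n12: "\<not> H q1 q2" and Hd2: "H (hd S2) q2" and pq: "ad p1 q1" and npq: "\<not> ad p2 q2"
  shows False
proof -
  interpret D: cfg V ad M I1 q1 x1 p1 I2 q2 x2 p2 S2 S1 R by (rule cfg_sides)
  let ?c = "hd S1" and ?d = "hd S2" and ?r = "last R"
  have n12': "\<not> ad q1 q2" using n12 ad_H by blast
  show False
  proof (cases "ad ?d q2")
    case True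
    have "\<not> ad ?c ?d"
      using claw[of ?d ?c q1 q2] True nonadj(5) n12 mxH(1) distinct_vertices edges ad_sym H_sym by metis
    then show False using p6[of ?c p1 ?d q2 x2 ?r] p6[of ?c p1 q1 ?d q2 x2] True n12' pq facts ad_sym by blast
  next
    case False
    have "\<exists>y. ad ?d y \<and> ad q2 y \<and> \<not> ad ?c y \<and> \<not> ad x2 y"
    proof (rule pick2[OF Hd2 False, of "{?r, x1, p2}" ?c x2 ?d])
      show "{?r, x1, p2} \<subseteq> V" using V_in by auto
      show "card {?r, x1, p2} = 3" using distinct_vertices by auto
      show "\<forall>z\<in>{?r, x1, p2}. \<not> ad ?d z \<and> \<not> ad q2 z \<and> z \<noteq> ?d \<and> z \<noteq> q2"
        using facts npq distinct_vertices n2(3) ad_commute by auto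
      show "card {y. ad ?c y \<and> ad q2 y \<and> y \<notin> I1 \<union> I2 \<union> set R} \<le> 2" by (rule common_le2)
      show "card {y. ad x2 y \<and> ad ?d y \<and> y \<notin> I1 \<union> I2 \<union> set R} \<le> 2"
        using D.common_le2(5) by (simp add: conj_commute conj_left_commute)
    qed (use n12' ad_commute in auto)
    then obtain y where y: "ad ?d y" "ad q2 y" "\<not> ad ?c y" "\<not> ad x2 y" by blast
    have yn: "y \<noteq> q1" "y \<noteq> q2" using y n12' ad_sym by auto
    have yr: "\<not> ad y ?r" using side_position(2)[OF y(1,2) _ _ yn] by simp
    note f = y yr n12' pq facts ad_sym False
    show False
    proof (cases "ad ?c ?d")
      case True
      then show False using p6[of ?c ?d y q2 x2 ?r] f by blast
    next
      case cd: False
      show False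
      proof (cases "ad p1 y")
        case True
        then show False using p6[of ?c p1 y q2 x2 ?r] f by blast
      next
        case py: False
        then show False using p6[of ?c p1 ?d y q2 x2] p6[of ?c p1 q1 y q2 x2] p6[of p1 q1 ?d y q2 x2] f cd by blast
      qed
    qed
  qed
qed

text \<open>A heavy \<open>q1\<close> would be H-adjacent to \<open>last S2\<close>, a heavy
  \<open>q2\<close> to \<open>hd S2\<close>; so both are light and may end an induced path. The
  crossing is made between \<open>hd S2\<close> and \<open>last S2\<close>, and the cases are the
  possible chords to \<open>hd S2\<close> and \<open>y\<close>.\<close>

lemma case_no_H:
  assumes n: "\<not> H q1 q2" "\<not> H q1 (last S2)" "\<not> H (hd S2) q2"
  shows False
proof -
  interpret D: cfg V ad M I1 q1 x1 p1 I2 q2 x2 p2 S2 S1 R by (rule cfg_sides)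
  let ?c = "hd S1" and ?d = "hd S2" and ?f = "last S2" and ?r = "last R"
  have n': "\<not> ad q1 q2" "\<not> ad q1 ?f" "\<not> ad ?d q2" using n ad_H by blast+
  have lq: "\<not> heavy q1" "\<not> heavy q2" using heavy_H hv n V_in distinct_vertices by blast+
  have pq: "ad p1 q1" using light_H_ad[OF Hpq(1)] light lq by blast
  have df: "?d \<noteq> ?f" using n'(2) edges by metis
  have Hdf: "H ?d ?f" using heavy_H hv V_in df by blast
  show False
  proof (cases "ad ?d ?f")
    case True
    have "\<not> ad ?c ?d"
      using claw[of ?d ?c q1 ?f] True nonadj(6) n(2) mxH(1) distinct_vertices edges ad_sym H_sym by metis
    then show False using p6[of ?c p1 ?d ?f q2 x2] p6[of ?c p1 q1 ?d ?f q2] True n' pq lq facts ad_sym by blast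
  next
    case False
    have "\<exists>y. ad ?d y \<and> ad ?f y \<and> \<not> ad ?c y \<and> \<not> ad x2 y"
    proof (rule pick2[OF Hdf False, of "{?r, x1, x2}" ?c x2 ?d])
      show "{?r, x1, x2} \<subseteq> V" using V_in by auto
      show "card {?r, x1, x2} = 3" using distinct_vertices by auto
      show "\<forall>z\<in>{?r, x1, x2}. \<not> ad ?d z \<and> \<not> ad ?f z \<and> z \<noteq> ?d \<and> z \<noteq> ?f"
        using facts distinct_vertices ad_commute by auto
      show "card {y. ad ?c y \<and> ad ?f y \<and> y \<notin> I1 \<union> I2 \<union> set R} \<le> 2" by (rule common_le2)
      show "card {y. ad x2 y \<and> ad ?d y \<and> y \<notin> I1 \<union> I2 \<union> set R} \<le> 2"
        using D.common_le2(5) by (simp add: conj_commute conj_left_commute)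
    qed (use n' ad_commute in auto)
    then obtain y where y: "ad ?d y" "ad ?f y" "\<not> ad ?c y" "\<not> ad x2 y" by blast
    have yn: "y \<noteq> q1" "y \<noteq> q2" using y n' ad_sym by auto
    have yr: "\<not> ad y ?r" using side_position(2)[OF y(1,2) _ _ yn] by simp
    note f = y yr n' pq lq facts ad_sym False
    show False
    proof (cases "ad ?c ?d")
      case True
      then show False using p6[of ?c ?d y q2 x2 ?r] p6[of ?c ?d y ?f q2 x2] f by blast
    next
      case cd: False
      show False
      proof (cases "ad p1 y")
        case True
        then show False using p6[of ?c p1 y q2 x2 ?r] p6[of ?c p1 y ?f q2 x2] f by blast
      next
        case py: False
        show False
        proof (cases "ad p1 ?d")
          case True
          then show False using p6[of ?c p1 ?d y q2 x2] p6[of ?c p1 ?d y ?f q2] f cd py by blast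
        next
          case pd: False
          show False
          proof (cases "ad q1 y")
            case True
            then show False using p6[of ?c p1 q1 y q2 x2] p6[of ?c p1 q1 y ?f q2] f cd py by blast
          next
            case qy: False
            then show False using p6[of ?c p1 q1 ?d y q2] p6[of p1 q1 ?d y ?f q2] f cd py pd by blast
          qed
        qed
      qed
    qed
  qed
qed

lemma side_False: False
proof -
  interpret E: side V ad M I2 p2 x2 q2 I1 p1 x1 q1 "rev S1" "rev S2" "rev R" by (rule side_ends)
  show False
    using case_H_q1_q2 E.case_H_q1_q2 case_H_q1_last_S2 E.case_H_q1_last_S2 case_H_hd_S2_q2 E.case_H_hd_S2_q2 case_no_H degree_sum last_rev_S H_commute by metis
qed

end

context clique_cfg
begin

text \<open>Both nodes are first extended along \<open>S1\<close> from its two ends, until the next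
  vertex is not H-adjacent to \<open>q1\<close> or \<open>q2\<close>, respectively;
  \<open>S2\<close> with its heavy ends is kept.\<close>

lemma not_both_ends_S2_heavy:
  assumes hd: "heavy (hd S2)" and hf: "heavy (last S2)"
  shows False
proof -
  have sp: "\<forall>v \<in> I1. v \<notin> {x1, q1} \<longrightarrow> spl I1 p1 x1 q1 v" "\<forall>v \<in> I2. v \<notin> {x2, q2} \<longrightarrow> spl I2 p2 x2 q2 v"
    using clique_node(2)[of I1 p1 x1 q1] clique_node(2)[of I2 p2 x2 q2] n1 n2 cl1(2) cl2(2) by auto
  have Hpq: "H p1 q1" "H p2 q2" using cl1(2) cl2(2) n1 n2 by auto
  obtain I p S where F: "cfg V ad M I p x1 q1 I2 p2 x2 q2 S S2 R"
    "\<forall>v \<in> I. v \<notin> {x1, q1} \<longrightarrow> spl I p x1 q1 v" "H p q1" "\<not> H (hd S) q1" "last S = last S1"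
    using extend_opposite_max[OF sp(1) Hpq(1)] by blast
  interpret F: cfg V ad M I p x1 q1 I2 p2 x2 q2 S S2 R by (rule F(1))
  interpret FE: cfg V ad M I2 p2 x2 q2 I p x1 q1 "rev S" "rev S2" "rev R" by (rule F.cfg_ends)
  obtain I' p' S' where G: "cfg V ad M I' p' x2 q2 I p x1 q1 S' (rev S2) (rev R)"
    "\<forall>v \<in> I'. v \<notin> {x2, q2} \<longrightarrow> spl I' p' x2 q2 v" "H p' q2" "\<not> H (hd S') q2" "last S' = last (rev S)"
    using FE.extend_opposite_max[OF sp(2) Hpq(2)] by blast
  interpret G: cfg V ad M I' p' x2 q2 I p x1 q1 S' "rev S2" "rev R" by (rule G(1))
  have "side V ad M I p x1 q1 I' p' x2 q2 (rev S') S2 R"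
  proof (intro side.intro side_axioms.intro)
    show "cfg V ad M I p x1 q1 I' p' x2 q2 (rev S') S2 R" using G.cfg_ends by simp
    show "\<not> H (hd (rev S')) q1" using G(5) F(4) G.S1_ne F.S1_ne by (simp add: hd_rev last_rev)
    show "\<not> H (last (rev S')) q2" using G(4) G.S1_ne by (simp add: last_rev)
  qed (use p6 F(2,3) G(2,3) maximal hd hf node_ad in blast)+
  then show False by (rule side.side_False)
qed

lemma clique_cfg_False: False
proof -
  interpret E: clique_cfg V ad M I2 p2 x2 q2 I1 p1 x1 q1 "rev S1" "rev S2" "rev R" by (rule clique_cfg_ends)
  interpret D: clique_cfg V ad M I1 q1 x1 p1 I2 q2 x2 p2 S2 S1 R by (rule clique_cfg_sides)
  have r: "hd (rev S1) = last S1" "last (rev S1) = hd S1" "hd (rev S2) = last S2" "last (rev S2) = hd S2"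
    using S1_ne S2_ne by (simp_all add: hd_rev last_rev)
  show False using hd_S1_or_last_S2_heavy D.hd_S1_or_last_S2_heavy not_both_hd_heavy E.not_both_hd_heavy[unfolded r] not_both_ends_S2_heavy D.not_both_ends_S2_heavy by blast
qed

end

section \<open>Existence of a configuration\<close>

lemma successively_shorten:
  assumes "successively E P" "P \<noteq> []"
  obtains Q where "Q \<noteq> []" "distinct Q" "successively E Q" "hd Q = hd P" "last Q = last P" "set Q \<subseteq> set P"
proof -
  have "\<exists>Q. Q \<noteq> [] \<and> distinct Q \<and> successively E Q \<and> hd Q = hd P \<and> last Q = last P \<and> set Q \<subseteq> set P"
    using assms
  proof (induction P rule: induct_list012)
    case 1
    then show ?case by simp
  next
    case (2 x)
    then show ?case by (intro exI[of _ "[x]"]) simp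
  next
    case (3 x y P)
    then obtain Q where Q: "Q \<noteq> []" "distinct Q" "successively E Q" "hd Q = y" "last Q = last (y # P)" "set Q \<subseteq> set (y # P)"
      by auto
    have xy: "E x y" using 3 by simp
    show ?case
    proof (cases "x \<in> set Q")
      case False
      then show ?thesis using Q xy by (intro exI[of _ "x # Q"]) (auto simp: successively_Cons)
    next
      case True
      then obtain U D where U: "Q = U @ x # D" by (meson split_list)
      then have "successively E (x # D)" using Q(3) by (simp add: successively_append_iff)
      moreover have "last (x # D) = last (x # y # P)" using Q(5) U by simp
      ultimately show ?thesis using Q(2,6) U by (intro exI[of _ "x # D"]) auto
    qed
  qed
  then show ?thesis using that by blast
qed

section \<open>A longest cycle with a path attached at two of its vertices\<close>

locale chord = claw_graph +
  fixes x1 :: 'a and A :: "'a list" and x2 :: 'a and B R :: "'a list"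
  assumes chC: "successively ad (x1 # A @ x2 # B)" and clC: "ad (last (x2 # B)) x1"
    and dC: "distinct (x1 # A @ x2 # B)" and lenC: "length (x1 # A @ x2 # B) = M"
    and chR: "successively ad (x1 # R @ [x2])" and R_ne: "R \<noteq> []" and dR: "distinct R"
    and RC: "set R \<inter> set (x1 # A @ x2 # B) = {}"
begin

lemma chord_ends: "chord V ad M x2 B x1 A (rev R)"
proof unfold_locales
  show "successively ad (x2 # rev R @ [x1])" using chR succ_ad_rev[of "x1 # R @ [x2]"] by simp
  show "successively ad (x2 # B @ x1 # A)" "ad (last (x1 # A)) x2"
    using chC clC successively_append_iff[of ad "x1 # A" "x2 # B"] successively_append_iff[of ad "x2 # B" "x1 # A"]
    by simp_all
qed (use dC lenC R_ne dR RC in auto)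

lemma chord_sides: "chord V ad M x1 (rev B) x2 (rev A) R"
proof unfold_locales
  have a: "successively ad (rev B @ [x2] @ rev A)"
    using chC succ_ad_rev[of "A @ [x2] @ B"] by (simp add: successively_Cons split: if_splits)
  show "successively ad (x1 # rev B @ x2 # rev A)"
    using a clC ad_sym by (auto simp: successively_Cons hd_append hd_rev)
  show "ad (last (x2 # rev A)) x1"
    using chC ad_sym by (auto simp: successively_Cons last_rev hd_append)
qed (use dC lenC chR R_ne dR RC in auto)

lemma ends_ad: "ad x1 (hd (A @ [x2]))" "ad (last (x1 # A)) x2" "ad x2 (hd (B @ [x1]))" "ad (last (x2 # B)) x1"
  "ad x1 (hd R)" "ad (last R) x2"
  using chC clC chR R_ne by (auto simp: successively_append_iff successively_Cons hd_append)

lemma H_parts: "successively H (x1 # R @ [x2])" "successively H A" "successively H (x2 # B)" "successively H B"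
  "successively H (A @ x2 # B)"
proof -
  have "successively H (x1 # A @ x2 # B)" using chC by (rule succ_ad_H)
  then show "successively H A" "successively H (x2 # B)" "successively H B" "successively H (A @ x2 # B)"
    by (auto simp: successively_append_iff successively_Cons)
qed (use chR succ_ad_H in blast)

lemma H_through_R: "successively H (x2 # Y) \<Longrightarrow> successively H (x1 # R @ x2 # Y)"
  using H_parts(1) successively_append_iff[of H "x1 # R" "[x2]"] successively_append_iff[of H "x1 # R" "x2 # Y"]
  by simp

lemma A_ne: "A \<noteq> []"
proof
  assume "A = []"
  moreover have "successively H (x1 # R @ x2 # B)" by (rule H_through_R[OF H_parts(3)])
  moreover have "H (last (x1 # R @ x2 # B)) (hd (x1 # R @ x2 # B))" using ad_H[OF clC] by simp
  moreover have "0 < length R" using R_ne by simp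
  ultimately show False using no_cyc_list[of "x1 # R @ x2 # B"] dC lenC dR RC by auto
qed

lemma B_ne: "B \<noteq> []"
  using chord.A_ne[OF chord_ends] .

lemma not_hd_R: "\<not> H (hd R) (hd A)"
proof
  assume "H (hd R) (hd A)"
  then have "successively H (x1 # hd R # (A @ x2 # B))" using H_parts(5) ad_H[OF ends_ad(5)] A_ne by (simp add: successively_Cons)
  moreover have "distinct (x1 # hd R # (A @ x2 # B))" using dC RC list.set_sel(1)[OF R_ne] by (auto simp del: hd_in_set)
  ultimately show False using no_cyc_list[of "x1 # hd R # (A @ x2 # B)"] lenC ad_H[OF clC] by simp
qed

text \<open>The claw at \<open>x1\<close> with \<open>hd R\<close> as third leaf:
  \<open>hd R\<close> is H-adjacent to neither neighbour of \<open>x1\<close> on the cycle, as it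
  could be inserted there.\<close>

lemma H_around: "H (hd A) (last B)"
proof -
  have "\<not> H (hd R) (last B)" using chord.not_hd_R[OF chord_sides] B_ne by (simp add: hd_rev)
  moreover have i: "hd R \<in> set R" "hd A \<in> set A" "last B \<in> set B" using R_ne A_ne B_ne by auto
  moreover have "hd R \<noteq> hd A" "hd A \<noteq> last B" "hd R \<noteq> last B" using i dC RC by auto
  moreover have "ad x1 (hd A)" "ad x1 (last B)" using ends_ad(1,4) ad_sym A_ne B_ne by auto
  ultimately show ?thesis using claw[of x1 "hd R" "hd A" "last B"] not_hd_R ends_ad(5) by blast
qed

lemma H_around': "H (last A) (hd B)"
  using chord.H_around[OF chord_ends] H_sym by blast

text \<open>Room is needed for \<open>p1\<close>, a nonempty \<open>S1\<close> and
  \<open>p2\<close>. A shorter \<open>A\<close> is absorbed by a cycle through \<open>R\<close>: its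
  last vertex leads from \<open>x2\<close> to \<open>hd B\<close>, and its first one, if different,
  from \<open>last B\<close> to \<open>x1\<close>.\<close>

lemma A_length: "3 \<le> length A"
proof (rule ccontr)
  assume "\<not> ?thesis"
  then consider s where "A = [s]" | s t where "A = [s, t]"
    using A_ne by (cases A rule: list.exhaust; cases "tl A" rule: list.exhaust; cases "tl (tl A)") auto
  then show False
  proof cases
    case 1
    let ?Z = "x1 # R @ x2 # s # B"
    have "H x2 s" using 1 ends_ad(2) ad_sym ad_H by auto
    then have "successively H ?Z" using 1 H_parts(4) H_around' B_ne
      by (intro H_through_R) (simp add: successively_Cons)
    moreover have "H (last ?Z) (hd ?Z)" using ad_H[OF clC] B_ne by simp
    moreover have "distinct ?Z" "M < length ?Z" using 1 dC lenC R_ne dR RC by auto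
    ultimately show False using no_cyc_list[of ?Z] by blast
  next
    case 2
    let ?Z = "x1 # R @ x2 # t # B @ [s]"
    have "H x2 t" using 2 ends_ad(2) ad_sym ad_H by auto
    then have "successively H ?Z" using 2 H_parts(4) H_around H_around' H_commute[of s] B_ne
      by (intro H_through_R) (simp add: successively_Cons successively_append_iff)
    moreover have "H (last ?Z) (hd ?Z)" using 2 ends_ad(1) ad_sym ad_H by auto
    moreover have "distinct ?Z" "M < length ?Z" using 2 dC lenC R_ne dR RC by auto
    ultimately show False using no_cyc_list[of ?Z] by blast
  qed
qed

lemma initial_cfg:
  obtains p1 q1 p2 q2 S1 S2 where "cfg V ad M {p1, x1, q1} p1 x1 q1 {p2, x2, q2} p2 x2 q2 S1 S2 R"
    "ad x1 p1" "ad x1 q1" "H p1 q1" "ad x2 p2" "ad x2 q2" "H p2 q2"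
    "{p1, x1, q1} \<union> {p2, x2, q2} \<union> set S1 \<union> set S2 = set (x1 # A @ x2 # B)"
proof -
  have split: "\<exists>p S q. X = p # S @ [q] \<and> S \<noteq> []" if X: "3 \<le> length X" for X :: "'a list"
  proof -
    obtain p Y where Y: "X = p # Y" "2 \<le> length Y" using X by (cases X) auto
    then obtain S q where "Y = S @ [q]" by (metis Zero_not_Suc le_zero_eq list.size(3) numeral_2_eq_2 rev_exhaust)
    then show ?thesis using Y by auto
  qed
  obtain p1 S1 p2 where A: "A = p1 # S1 @ [p2]" "S1 \<noteq> []" using split[OF A_length] by blast
  obtain q2 S2 q1 where B: "B = q2 # S2 @ [q1]" "S2 \<noteq> []" using split[OF chord.A_length[OF chord_ends]] by blast
  have e: "ad x1 p1" "ad x1 q1" "H p1 q1" "ad x2 p2" "ad x2 q2" "H p2 q2"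
    using ends_ad H_around H_around' A B ad_sym by auto
  note Hs = e(3,6) e(1,2,4,5)[THEN ad_H]
  have "cfg V ad M {p1, x1, q1} p1 x1 q1 {p2, x2, q2} p2 x2 q2 S1 (rev S2) R"
  proof unfold_locales
    show "node {p1, x1, q1} p1 x1 q1" using dC A B Hs H_sym by (intro clique_node(1)) auto
    show "node {p2, x2, q2} p2 x2 q2" using dC A B Hs H_sym by (intro clique_node(1)) auto
    show "successively ad (p1 # S1 @ [p2])" "successively ad (q1 # rev S2 @ [q2])"
      using chC succ_ad_rev[of B] by (auto simp: A B successively_append_iff successively_Cons)
    show "card {p1, x1, q1} + card {p2, x2, q2} + length S1 + length (rev S2) = M"
      using dC lenC distinct_card[of "[p1, x1, q1]"] distinct_card[of "[p2, x2, q2]"] by (auto simp: A B)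
  qed (use A B dC dR RC R_ne chR in auto)
  then show ?thesis using that[OF _ e] by (simp add: A B Un_ac insert_commute)
qed

end

context sgraph
begin

definition clq :: "'a set \<Rightarrow> 'a \<Rightarrow> bool" where
  "clq I x \<longleftrightarrow> (\<forall>v \<in> I. v \<noteq> x \<longrightarrow> ad x v) \<and> (\<forall>v \<in> I. \<forall>w \<in> I. v \<noteq> w \<longrightarrow> H v w)"

end

text \<open>Neither \<open>c\<close> nor a vertex of the clique other than \<open>x1\<close> is
  H-adjacent to \<open>hd R\<close>, so the claws at \<open>x1\<close> make \<open>c\<close>
  H-adjacent to the whole clique.\<close>

lemma (in cfg) extend_clique:
  assumes "clq I1 x1" "ad x1 (hd S1)"
  obtains c S' where "S1 = c # S'" "cfg V ad M (insert c I1) c x1 q1 I2 p2 x2 q2 S' S2 R"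
    "clq (insert c I1) x1" "card (insert c I1) = Suc (card I1)"
proof -
  obtain c S' where S: "S1 = c # S'" using S1_ne by (cases S1) auto
  have c: "c \<notin> I1" "ad x1 c" "H c x1" using S dSI assms(2) ad_H ad_sym by auto
  have ext: "cfg V ad M (insert c I1) c x1 q1 I2 p2 x2 q2 S' S2 R" using extend(2)[OF S] c by blast
  have new: "H c v" if v: "v \<in> I1" for v
  proof (cases "v = x1")
    case True
    then show ?thesis using c by simp
  next
    case False
    have "\<not> H v (hd R)"
    proof (cases "v = q1")
      case True
      then show ?thesis using nonadj_R(3) R_ne by simp
    next
      case vq: False
      have "spl I1 p1 x1 q1 v"
        using clique_node(2)[of I1 p1 x1 q1 v] n1 assms(1) v False vq unfolding clq_def by blast
      then show ?thesis using spl_far(4) R_ne by simp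
    qed
    moreover have "\<not> H c (hd R)" using nonadj_R(2)[of "hd R"] R_ne S by simp
    moreover have "ad x1 v" using assms(1) v False unfolding clq_def by blast
    moreover have "v \<noteq> c" "c \<noteq> hd R" "v \<noteq> hd R" using c v S dists R_ne cfgD(1)[of c] cfgD(4)[OF v] hd_in_set[OF R_ne] by auto
    ultimately show ?thesis using claw[of x1 c v "hd R"] c(2) edges(5) H_sym by blast
  qed
  have "clq (insert c I1) x1" using assms(1) new c H_sym unfolding clq_def by auto
  then show ?thesis using that S ext c n1(7) by simp
qed

text \<open>\<open>connected\<close> puts 2-connectivity in terms of closed vertex sets, to be
  applied to the set of vertices reached by paths avoiding \<open>x\<close>.\<close>

locale claw_p6_graph = sgraph +
  assumes claw: "\<lbrakk>ad x a; ad x b; ad x c; a \<noteq> b; b \<noteq> c; a \<noteq> c\<rbrakk> \<Longrightarrow> H a b \<or> H b c \<or> H a c"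
    and p6: "\<lbrakk>ad a b; ad b c; ad c d; ad d e; ad e f; \<not> ad a c; \<not> ad a d; \<not> ad a e; \<not> ad a f;
      \<not> ad b d; \<not> ad b e; \<not> ad b f; \<not> ad c e; \<not> ad c f; \<not> ad d f\<rbrakk> \<Longrightarrow> heavy a \<or> heavy f"
    and card_V: "2 < card V"
    and connected: "\<lbrakk>x \<in> V; A \<noteq> {}; A \<subseteq> V - {x}; \<And>u v. u \<in> A \<Longrightarrow> ad u v \<Longrightarrow> v \<noteq> x \<Longrightarrow> v \<in> A\<rbrakk> \<Longrightarrow> A = V - {x}"
begin

lemma path_avoiding:
  assumes "x \<in> V" "u \<in> V - {x}" "v \<in> V - {x}"
  obtains P where "P \<noteq> []" "hd P = u" "last P = v" "distinct P" "successively ad P" "x \<notin> set P"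
proof -
  let ?A = "{v \<in> V - {x}. \<exists>P. P \<noteq> [] \<and> hd P = u \<and> last P = v \<and> successively ad P \<and> x \<notin> set P}"
  have "?A = V - {x}"
  proof (rule connected[OF assms(1)])
    have "u \<in> ?A" using assms(2) by (auto intro!: exI[of _ "[u]"])
    then show "?A \<noteq> {}" by blast
    fix w z assume w: "w \<in> ?A" and wz: "ad w z" "z \<noteq> x"
    obtain P where P: "P \<noteq> []" "hd P = u" "last P = w" "successively ad P" "x \<notin> set P" using w by blast
    have "z \<in> V" using wz ad_V ad_sym by blast
    then show "z \<in> ?A" using P wz
      by (intro CollectI conjI exI[of _ "P @ [z]"]) (auto simp: successively_append_iff)
  qed blast
  then obtain P where P: "P \<noteq> []" "hd P = u" "last P = v" "successively ad P" "x \<notin> set P" using assms(3) by blast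
  then show ?thesis using successively_shorten[OF P(4,1)] that by blast
qed

lemma two_neighbours:
  assumes "v \<in> V"
  obtains a b where "ad v a" "ad v b" "a \<noteq> b"
proof (rule ccontr)
  assume "\<not> thesis"
  then have one: "\<And>a b. ad v a \<Longrightarrow> ad v b \<Longrightarrow> a = b" using that by blast
  have "\<not> V \<subseteq> {v}" using card_mono[of "{v}" V] card_V by auto
  then obtain w where w: "w \<in> V" "w \<noteq> v" "\<forall>u. ad v u \<longrightarrow> u = w"
    using one ad_V ad_sym ad_irr by (metis insertI1 subsetI singletonD)
  have "{v} = V - {w}" using w assms by (intro connected) auto
  then have "V = {v, w}" using w assms by blast
  then have "card V \<le> 2" by (simp add: card_insert_if)
  then show False using card_V by simp
qed

lemma cycle_exists: "\<exists>A. cyc ad A"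
proof -
  obtain v where v: "v \<in> V" using card_V by (metis card.empty equals0I not_less_zero)
  obtain a b where ab: "ad v a" "ad v b" "a \<noteq> b" using two_neighbours[OF v] .
  then have abV: "a \<in> V - {v}" "b \<in> V - {v}" using ad_V ad_sym by auto
  obtain P where P: "P \<noteq> []" "hd P = a" "last P = b" "distinct P" "successively ad P" "v \<notin> set P"
    using path_avoiding[OF v abV] .
  have hpath: "hpath ad (set P) a b" using hpI[OF P(1,4,5)] P(2,3) by simp
  then have "hpath ad (insert v (set P)) v b" using hpath_Cons[of ad "set P" a b v] ab(1) P(6) by blast
  moreover have "card {a, b} \<le> card (set P)" using hpath_hd_in[OF hpath] hpath_last_in[OF hpath] by (intro card_mono) auto
  ultimately show ?thesis unfolding cyc_def using ab ad_sym P(6)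
    by (intro exI[of _ "insert v (set P)"] exI[of _ v] exI[of _ b]) auto
qed

definition bridge :: "'a set \<Rightarrow> 'a \<Rightarrow> 'a list \<Rightarrow> 'a \<Rightarrow> bool" where
  "bridge C a R b \<longleftrightarrow> successively ad (a # R @ [b]) \<and> a \<noteq> b \<and> R \<noteq> [] \<and> {a, b} \<subseteq> C \<and> set R \<inter> C = {}"

lemma bridge_exists:
  assumes "C \<subseteq> V" "C \<noteq> V" "2 \<le> card C"
  shows "\<exists>a R b. bridge C a R b"
proof -
  have "\<exists>x r. x \<in> C \<and> r \<notin> C \<and> ad x r"
  proof (rule ccontr)
    assume c: "\<not> ?thesis"
    obtain x where x: "x \<in> C" using assms(3) by fastforce
    have "\<not> C \<subseteq> {x}" using card_mono[of "{x}" C] assms(3) by auto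
    then have "C - {x} = V - {x}" using x assms(1) c by (intro connected) auto
    then show False using x assms by blast
  qed
  then obtain x r where x: "x \<in> C" "r \<notin> C" "ad x r" by blast
  have "\<not> C \<subseteq> {x}" using card_mono[of "{x}" C] assms(3) by auto
  then obtain z where z: "z \<in> C" "z \<noteq> x" by blast
  have V: "x \<in> V" "r \<in> V - {x}" "z \<in> V - {x}" using x z assms(1) ad_V[OF ad_sym[OF x(3)]] by auto
  obtain P where P: "P \<noteq> []" "hd P = r" "last P = z" "distinct P" "successively ad P" "x \<notin> set P"
    using path_avoiding[OF V] .
  let ?R = "takeWhile (\<lambda>y. y \<notin> C) P" and ?D = "dropWhile (\<lambda>y. y \<notin> C) P"
  have PRD: "P = ?R @ ?D" by simp
  have "z \<in> set P" using P last_in_set by blast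
  then have D: "?D \<noteq> []" using z by (auto simp: dropWhile_eq_Nil_conv)
  have R: "?R \<noteq> []" "hd ?R = r" using P x by (cases P; simp)+
  have b: "hd ?D \<in> C" using hd_dropWhile[OF D] by simp
  have "hd ?D \<in> set P" using D by (metis hd_in_set set_dropWhileD)
  then have "hd ?D \<noteq> x" using P(6) by blast
  moreover have "successively ad (?R @ [hd ?D])"
    using P(5) PRD D by (metis successively_append_iff successively.simps(2) list.sel(1) list.discI)
  then have "successively ad (x # ?R @ [hd ?D])" using R x(3) by (simp add: successively_Cons)
  ultimately have "bridge C x ?R (hd ?D)" unfolding bridge_def
    using R x(1) b by (auto dest: set_takeWhileD)
  then show ?thesis by blast
qed

text \<open>Repeated inner vertices could be cut out, giving a shorter bridge.\<close>

lemma shortest_bridge: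
  assumes "C \<subseteq> V" "C \<noteq> V" "2 \<le> card C"
  obtains a R b where "bridge C a R b" "distinct R" "\<forall>a' R' b'. bridge C a' R' b' \<longrightarrow> length R \<le> length R'"
proof -
  obtain a R b where R: "bridge C a R b" "\<forall>a' R' b'. bridge C a' R' b' \<longrightarrow> length R \<le> length R'"
    using bridge_exists[OF assms]
      ex_has_least_nat[of "\<lambda>(a, R, b). bridge C a R b" _ "\<lambda>(a, R, b). length R"] by fastforce
  have s: "successively ad R" "R \<noteq> []" "ad a (hd R)" "ad (last R) b"
    using R(1) unfolding bridge_def by (auto simp: successively_Cons successively_append_iff)
  obtain Q where Q: "Q \<noteq> []" "distinct Q" "successively ad Q" "hd Q = hd R" "last Q = last R" "set Q \<subseteq> set R"
    using successively_shorten[OF s(1,2)] .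
  have "bridge C a Q b"
    using R(1) Q s unfolding bridge_def by (auto simp: successively_Cons successively_append_iff)
  then have "length R \<le> length Q" using R(2) by blast
  also have "\<dots> \<le> card (set R)" using Q by (metis card_mono distinct_card List.finite_set)
  finally have "distinct R" using card_length[of R] card_distinct by (metis le_antisym)
  then show ?thesis using that R by blast
qed

lemma cycle_split:
  assumes "cyc ad C" "x1 \<in> C" "x2 \<in> C" "x1 \<noteq> x2"
  obtains A B where "successively ad (x1 # A @ x2 # B)" "ad (last (x2 # B)) x1"
    "distinct (x1 # A @ x2 # B)" "set (x1 # A @ x2 # B) = C"
proof -
  obtain P where P: "P \<noteq> []" "distinct P" "successively ad P" "set P = C" "ad (last P) (hd P)"
    using assms(1) unfolding cyc_def hpath_def by blast
  obtain U D where U: "P = U @ x1 # D" using P(4) assms(2) by (metis split_list)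
  have "x2 \<in> set (D @ U)" using U P(4) assms(3,4) by auto
  then obtain A B where AB: "D @ U = A @ x2 # B" by (metis split_list)
  let ?Q = "x1 # D @ U"
  have "successively ad ?Q" "ad (last ?Q) x1" "distinct ?Q" "set ?Q = C"
    using P U by (auto simp: successively_append_iff successively_Cons hd_append split: if_splits)
  then show ?thesis using that AB by (metis last_ConsR last_appendR list.discI append_is_Nil_conv)
qed

theorem cyc_V: "cyc ad V"
proof (rule ccontr)
  assume nV: "\<not> cyc ad V"
  have cV: "cyc ad A \<Longrightarrow> A \<subseteq> V" for A using cyc_subset_verts ad_V by metis
  then have bound: "cyc ad A \<longrightarrow> card A \<le> card V" for A using card_mono[OF finV] by blast
  obtain C where C: "cyc ad C" "\<forall>A. cyc ad A \<longrightarrow> card A \<le> card C"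
    using cycle_exists ex_has_greatest_nat[of "cyc ad" _ card "Suc (card V)"] bound less_Suc_eq_le by metis
  define M where "M = card C"
  interpret claw_graph V ad M
  proof unfold_locales
    show "card A \<le> M" if A: "cyc H A" for A
    proof -
      obtain B where B: "A \<subseteq> B" "cyc ad B" using cyc_H_ad[OF A] by blast
      then have "card A \<le> card B" using cV finV finite_subset by (metis card_mono)
      then show ?thesis using C(2) B unfolding M_def by fastforce
    qed
    show "3 \<le> M" using C(1) unfolding M_def cyc_def by blast
  qed (rule claw)
  have C': "C \<noteq> V" "2 \<le> card C" using C nV M3 unfolding M_def by auto
  obtain x1 R x2 where R: "bridge C x1 R x2" "distinct R" "\<forall>a' R' b'. bridge C a' R' b' \<longrightarrow> length R \<le> length R'"
    using shortest_bridge[OF cV[OF C(1)] C'] .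
  have x: "x1 \<in> C" "x2 \<in> C" "x1 \<noteq> x2" and R': "successively ad (x1 # R @ [x2])" "R \<noteq> []" "set R \<inter> C = {}"
    using R(1) unfolding bridge_def by auto
  obtain A B where AB: "successively ad (x1 # A @ x2 # B)" "ad (last (x2 # B)) x1"
    "distinct (x1 # A @ x2 # B)" "set (x1 # A @ x2 # B) = C" using cycle_split[OF C(1) x] .
  interpret chord V ad M x1 A x2 B R
    by unfold_locales (use AB R R' distinct_card[OF AB(3)] in \<open>simp_all add: M_def\<close>)
  \<comment> \<open>With \<open>C\<close>, \<open>x1\<close>, \<open>x2\<close> and \<open>R\<close>
    fixed, a configuration whose clique nodes have the largest total size is chosen; an edge from
    \<open>x1\<close> or \<open>x2\<close> to the next vertex of a segment would enlarge a
    node.\<close>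
  define P where "P = (\<lambda>(I1, p1, q1, I2, p2, q2, S1, S2). cfg V ad M I1 p1 x1 q1 I2 p2 x2 q2 S1 S2 R \<and>
    clq I1 x1 \<and> clq I2 x2 \<and> I1 \<union> I2 \<union> set S1 \<union> set S2 = C)"
  define m where "m = (\<lambda>(I1 :: 'a set, p1 :: 'a, q1 :: 'a, I2 :: 'a set, p2 :: 'a, q2 :: 'a, S1 :: 'a list, S2 :: 'a list).
    card I1 + card I2)"
  have "\<exists>t. P t"
  proof -
    obtain p1 q1 p2 q2 S1 S2 where i: "cfg V ad M {p1, x1, q1} p1 x1 q1 {p2, x2, q2} p2 x2 q2 S1 S2 R"
      "ad x1 p1" "ad x1 q1" "H p1 q1" "ad x2 p2" "ad x2 q2" "H p2 q2"
      "{p1, x1, q1} \<union> {p2, x2, q2} \<union> set S1 \<union> set S2 = set (x1 # A @ x2 # B)" using initial_cfg .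
    have "clq {p1, x1, q1} x1" "clq {p2, x2, q2} x2"
      unfolding clq_def using i(2-7) i(2,3,5,6)[THEN ad_H] H_sym by auto
    then have "P ({p1, x1, q1}, p1, q1, {p2, x2, q2}, p2, q2, S1, S2)" using i(1,8) AB(4) unfolding P_def by blast
    then show ?thesis by blast
  qed
  moreover have "P t \<longrightarrow> m t < Suc M" for t
    unfolding P_def m_def by (auto split: prod.splits dest!: cfg.cardM)
  ultimately obtain t where t: "P t" "\<forall>s. P s \<longrightarrow> m s \<le> m t"
    using ex_has_greatest_nat[of P _ m "Suc M"] by blast
  obtain I1 p1 q1 I2 p2 q2 S1 S2 where teq: "t = (I1, p1, q1, I2, p2, q2, S1, S2)" by (metis surj_pair)
  have c: "cfg V ad M I1 p1 x1 q1 I2 p2 x2 q2 S1 S2 R" "clq I1 x1" "clq I2 x2" "I1 \<union> I2 \<union> set S1 \<union> set S2 = C"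
    using t(1) unfolding teq P_def by auto
  have mx: False if "P (J1, a1, b1, J2, a2, b2, T1, T2)" "card I1 + card I2 < card J1 + card J2"
    for J1 a1 b1 J2 a2 b2 T1 T2
    using t(2) that unfolding teq m_def by fastforce
  interpret K: cfg V ad M I1 p1 x1 q1 I2 p2 x2 q2 S1 S2 R by (rule c(1))
  interpret E: cfg V ad M I2 p2 x2 q2 I1 p1 x1 q1 "rev S1" "rev S2" "rev R" by (rule K.cfg_ends)
  interpret D: cfg V ad M I1 q1 x1 p1 I2 q2 x2 p2 S2 S1 R by (rule K.cfg_sides)
  interpret ED: cfg V ad M I2 q2 x2 p2 I1 q1 x1 p1 "rev S2" "rev S1" "rev R" by (rule E.cfg_sides)
  have "\<not> ad x1 (hd S1)"
  proof
    assume "ad x1 (hd S1)"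
    then obtain c' S' where e: "S1 = c' # S'" "cfg V ad M (insert c' I1) c' x1 q1 I2 p2 x2 q2 S' S2 R"
      "clq (insert c' I1) x1" "card (insert c' I1) = Suc (card I1)"
      using K.extend_clique[OF c(2)] by blast
    have "P (insert c' I1, c', q1, I2, p2, q2, S', S2)" unfolding P_def using e c by auto
    then show False using mx e(4) by fastforce
  qed
  moreover have "\<not> ad x1 (hd S2)"
  proof
    assume "ad x1 (hd S2)"
    then obtain c' S' where e: "S2 = c' # S'" "cfg V ad M (insert c' I1) c' x1 p1 I2 q2 x2 p2 S' S1 R"
      "clq (insert c' I1) x1" "card (insert c' I1) = Suc (card I1)"
      using D.extend_clique[OF c(2)] by blast
    have "P (insert c' I1, p1, c', I2, p2, q2, S1, S')" unfolding P_def using e(1,3) cfg.cfg_sides[OF e(2)] c by auto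
    then show False using mx e(4) by fastforce
  qed
  moreover have "\<not> ad x2 (last S1)"
  proof
    assume "ad x2 (last S1)"
    then have "ad x2 (hd (rev S1))" using K.S1_ne by (simp add: hd_rev)
    then obtain c' S' where e: "rev S1 = c' # S'" "cfg V ad M (insert c' I2) c' x2 q2 I1 p1 x1 q1 S' (rev S2) (rev R)"
      "clq (insert c' I2) x2" "card (insert c' I2) = Suc (card I2)"
      using E.extend_clique[OF c(3)] by blast
    have "set S1 = insert c' (set S')" using arg_cong[OF e(1), of set] by simp
    then have "P (I1, p1, q1, insert c' I2, c', q2, rev S', S2)" unfolding P_def using e(3) cfg.cfg_ends[OF e(2)] c by auto
    then show False using mx e(4) by fastforce
  qed
  moreover have "\<not> ad x2 (last S2)"
  proof
    assume "ad x2 (last S2)"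
    then have "ad x2 (hd (rev S2))" using K.S2_ne by (simp add: hd_rev)
    then obtain c' S' where e: "rev S2 = c' # S'" "cfg V ad M (insert c' I2) c' x2 p2 I1 q1 x1 p1 S' (rev S1) (rev R)"
      "clq (insert c' I2) x2" "card (insert c' I2) = Suc (card I2)"
      using ED.extend_clique[OF c(3)] by blast
    have "set S2 = insert c' (set S')" using arg_cong[OF e(1), of set] by simp
    moreover have "cfg V ad M I1 p1 x1 q1 (insert c' I2) p2 x2 c' S1 (rev S') R"
      using cfg.cfg_sides[OF cfg.cfg_ends[OF e(2)]] by simp
    ultimately have "P (I1, p1, q1, insert c' I2, p2, c', S1, rev S')" unfolding P_def using e(3) c by auto
    then show False using mx e(4) by fastforce
  qed
  ultimately have maximal: "\<not> ad x1 (hd S1)" "\<not> ad x1 (hd S2)" "\<not> ad x2 (last S1)" "\<not> ad x2 (last S2)" by blast+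
  have "clique_cfg V ad M I1 p1 x1 q1 I2 p2 x2 q2 S1 S2 R"
  proof (intro clique_cfg.intro clique_cfg_axioms.intro)
    show "length R \<le> length R'"
      if "successively ad (a # R' @ [b])" "a \<noteq> b" "R' \<noteq> []" "{a, b} \<subseteq> I1 \<union> I2 \<union> set S1 \<union> set S2"
        "set R' \<inter> (I1 \<union> I2 \<union> set S1 \<union> set S2) = {}" for a R' b
      using R(3) that c(4) unfolding bridge_def by blast
  qed (use c(1-3) p6 maximal in \<open>unfold clq_def, blast+\<close>)
  then show False by (rule clique_cfg.clique_cfg_False)
qed

end

section \<open>Pair graphs\<close>

text \<open>Walks are lists of arcs here; pairing a vertex list with its shift translates between
  the two forms.\<close>

lemma walk_zip:
  shows "pcas u (zip (u # T) (T @ [w])) w" "pawalk_verts u (zip (u # T) (T @ [w])) = u # T @ [w]"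
    "set (zip (u # T) (T @ [w])) \<subseteq> E \<longleftrightarrow> successively (\<lambda>x y. (x, y) \<in> E) (u # T @ [w])"
  by (induction T arbitrary: u) auto

lemma path_pairs:
  "{(vs ! i, vs ! j) | i j. i < length vs \<and> j < length vs \<and> (j = Suc i \<or> i = Suc j)} =
    set (zip vs (tl vs)) \<union> (set (zip vs (tl vs)))\<inverse>"
proof -
  have "set (zip vs (tl vs)) = {(vs ! i, vs ! Suc i) | i. Suc i < length vs}"
    unfolding set_zip by (intro Collect_cong ex_cong1) (auto simp: nth_tl)
  then show ?thesis by auto (metis Suc_lessD)+
qed

lemma zip_tl_subset: "set (zip vs (tl vs)) \<union> (set (zip vs (tl vs)))\<inverse> \<subseteq> set vs \<times> set vs"
  by (cases vs) (auto dest: set_zip_leftD set_zip_rightD)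

lemma complete_bipartite_digraphI:
  assumes "pverts P = U \<union> W" "finite (pverts P)" "U \<inter> W = {}" "card U = m" "card W = n" "parcs P = U \<times> W \<union> W \<times> U"
  shows "K\<^bsub>m,n\<^esub> (with_proj P)"
  unfolding complete_bipartite_digraph_pair_def using assms by blast

lemma arcs_on_eqI:
  assumes "\<And>y z. y \<in> X \<Longrightarrow> z \<in> X \<Longrightarrow> (y, z) \<in> E \<longleftrightarrow> (y, z) \<in> F" "F \<subseteq> X \<times> X"
  shows "{e \<in> E. fst e \<in> X \<and> snd e \<in> X} = F"
  using assms by auto

context pair_graph
begin

abbreviation ad where "ad u v \<equiv> (u, v) \<in> parcs G"

interpretation S: sgraph "pverts G" ad
  by unfold_locales (use pair_finite_verts arcs_symmetric no_loops' wellformed' in auto)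

lemma vertex_degree_dg: "vertex_degree G v = S.dg v"
proof -
  have "out_arcs (with_proj G) v = Pair v ` {u. ad v u}" unfolding out_arcs_def by auto
  then show ?thesis unfolding vertex_degree_def out_degree_def S.dg_def by (simp add: card_image inj_on_def)
qed

lemma induce_subgraph_pair:
  "with_proj G \<restriction> X = with_proj \<lparr>pverts = X, parcs = {e \<in> parcs G. fst e \<in> X \<and> snd e \<in> X}\<rparr>"
  by (simp add: induce_subgraph_def with_proj_def)

text \<open>In an induced claw the nonadjacent heavy pair cannot contain the centre, so it consists
  of two leaves.\<close>

lemma claw_H:
  assumes co: "claw_o_heavy G" and ad: "ad x a" "ad x b" "ad x c" and ne: "a \<noteq> b" "b \<noteq> c" "a \<noteq> c"
  shows "S.H a b \<or> S.H b c \<or> S.H a c"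
proof (cases "ad a b \<or> ad b c \<or> ad a c")
  case True
  then show ?thesis using S.ad_H by blast
next
  case False
  let ?X = "{x, a, b, c}"
  let ?K = "\<lparr>pverts = ?X, parcs = {e \<in> parcs G. fst e \<in> ?X \<and> snd e \<in> ?X}\<rparr>"
  have V: "?X \<subseteq> pverts G" using ad wellformed' by blast
  have sym: "ad a x" "ad b x" "ad c x" and nad: "\<not> ad b a" "\<not> ad c b" "\<not> ad c a" "x \<noteq> a" "x \<noteq> b" "x \<noteq> c"
    using ad False arcs_symmetric no_loops' by blast+
  have "induced_subgraph (with_proj ?K) (with_proj G)"
    using induced_induce[OF V] unfolding induce_subgraph_pair .
  moreover have "K\<^bsub>1,3\<^esub> (with_proj ?K)"
  proof -
    let ?F = "{x} \<times> {a, b, c} \<union> {a, b, c} \<times> {x}"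
    have "ad y z \<longleftrightarrow> (y, z) \<in> ?F" if "y \<in> ?X" "z \<in> ?X" for y z
      using that ad sym nad False by (elim insertE emptyE) simp_all
    then have "{e \<in> parcs G. fst e \<in> ?X \<and> snd e \<in> ?X} = ?F" by (rule arcs_on_eqI) auto
    then show ?thesis using ne nad by (intro complete_bipartite_digraphI[of _ "{x}" "{a, b, c}"]) auto
  qed
  ultimately have "\<exists>u \<in> verts (with_proj ?K). \<exists>v \<in> verts (with_proj ?K). u \<noteq> v \<and> (u, v) \<notin> parcs G \<and>
      card (pverts G) \<le> vertex_degree G u + vertex_degree G v"
    using co unfolding claw_o_heavy_def by blast
  then obtain u v where uv: "u \<in> ?X" "v \<in> ?X" "u \<noteq> v" "\<not> ad u v"
      "card (pverts G) \<le> vertex_degree G u + vertex_degree G v"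
    unfolding with_proj_simps pair_pre_digraph.select_convs by blast
  have H: "S.H u v" using uv V unfolding S.H_def vertex_degree_dg by blast
  have "u \<in> {a, b, c}" "v \<in> {a, b, c}" using uv(1-4) ad sym by auto
  then show ?thesis using H S.H_sym S.H_irr by blast
qed

lemma path_heavy:
  assumes p: "\<And>v1 v2 v3 v4 v5 v6. induced_path G [v1, v2, v3, v4, v5, v6] \<Longrightarrow>
      real (max (vertex_degree G v1) (vertex_degree G v6)) \<ge> real (card (pverts G)) / 2"
    and e: "ad a b" "ad b c" "ad c d" "ad d e" "ad e f"
    and n: "\<not> ad a c" "\<not> ad a d" "\<not> ad a e" "\<not> ad a f" "\<not> ad b d" "\<not> ad b e" "\<not> ad b f"
      "\<not> ad c e" "\<not> ad c f" "\<not> ad d f"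
  shows "S.heavy a \<or> S.heavy f"
proof -
  have e': "ad b a" "ad c b" "ad d c" "ad e d" "ad f e" using e arcs_symmetric by blast+
  have n': "\<not> ad c a" "\<not> ad d a" "\<not> ad e a" "\<not> ad f a" "\<not> ad d b" "\<not> ad e b" "\<not> ad f b"
      "\<not> ad e c" "\<not> ad f c" "\<not> ad f d" using n arcs_symmetric by blast+
  let ?L = "[a, b, c, d, e, f]"
  \<comment> \<open>Any two of the six vertices are adjacent or told apart by a third one, so
    distinctness follows from the adjacency pattern.\<close>
  have dn: "a \<noteq> b" "a \<noteq> c" "a \<noteq> d" "a \<noteq> e" "a \<noteq> f" "b \<noteq> c" "b \<noteq> d" "b \<noteq> e" "b \<noteq> f" "c \<noteq> d"
    "c \<noteq> e" "c \<noteq> f" "d \<noteq> e" "d \<noteq> f" "e \<noteq> f"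
    using e e' n n' by auto
  then have dL: "distinct ?L" by simp
  have "\<forall>y \<in> set ?L. \<forall>z \<in> set ?L. ad y z \<longleftrightarrow> (y, z) \<in> set (zip ?L (tl ?L)) \<union> (set (zip ?L (tl ?L)))\<inverse>"
    by (simp add: e e' n n' dn dn[symmetric])
  moreover have "set (zip ?L (tl ?L)) \<union> (set (zip ?L (tl ?L)))\<inverse> \<subseteq> set ?L \<times> set ?L"
    by (rule zip_tl_subset)
  ultimately have "arcs (with_proj G \<restriction> set ?L) = set (zip ?L (tl ?L)) \<union> (set (zip ?L (tl ?L)))\<inverse>"
    unfolding induce_subgraph_arcs with_proj_simps by (intro arcs_on_eqI) blast
  moreover have "set ?L \<subseteq> pverts G" using e wellformed' by auto
  ultimately have "induced_path G ?L" using dL unfolding induced_path_def path_pairs by blast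
  then have "real (card (pverts G)) / 2 \<le> real (max (vertex_degree G a) (vertex_degree G f))" by (rule p)
  then show ?thesis unfolding S.heavy_def vertex_degree_dg by (auto simp: max_def split: if_splits)
qed

lemma connected_closed:
  assumes "k_connected 2 G" "x \<in> pverts G" "A \<noteq> {}" "A \<subseteq> pverts G - {x}"
    and cl: "\<And>u v. u \<in> A \<Longrightarrow> ad u v \<Longrightarrow> v \<noteq> x \<Longrightarrow> v \<in> A"
  shows "A = pverts G - {x}"
proof -
  let ?X = "pverts G - {x}"
  let ?K = "mk_symmetric (with_proj G \<restriction> ?X)"
  have "Digraph_Component.connected (with_proj G \<restriction> ?X)"
    using assms(1,2) unfolding k_connected_def by auto
  then have reach: "u \<rightarrow>\<^sup>*\<^bsub>?K\<^esub> v" if "u \<in> ?X" "v \<in> ?X" for u v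
    using that unfolding Digraph_Component.connected_def strongly_connected_def by auto
  obtain u where u: "u \<in> A" using assms(3) by blast
  have "v \<in> A" if "v \<in> ?X" for v
  proof -
    have "(u, v) \<in> rtrancl_on ?X (parcs ?K)" using reach[of u v] u that assms(4) unfolding reachable_def by auto
    then show ?thesis
    proof (induction rule: rtrancl_on_induct)
      case (step y z)
      then have "ad y z" "z \<noteq> x"
        using arcs_symmetric by (auto simp: parcs_mk_symmetric arcs_ends_conv)
      then show ?case using cl step by blast
    qed (use u in simp)
  qed
  then show ?thesis using assms(4) by blast
qed

lemma hamiltonianI:
  assumes "cyc ad (pverts G)"
  shows "hamiltonian G"
proof -
  obtain P where P: "P \<noteq> []" "distinct P" "successively ad P" "set P = pverts G" "ad (last P) (hd P)"
    "3 \<le> card (pverts G)"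
    using assms unfolding cyc_def hpath_def by blast
  obtain u T where uT: "P = u # T" using P(1) by (cases P) auto
  let ?p = "zip (u # T) (T @ [u])"
  have "successively ad (P @ [hd P])" using P by (simp add: successively_append_iff)
  then have "set ?p \<subseteq> parcs G" unfolding walk_zip(3) uT by simp
  then have "cycle ?p"
    unfolding cycle_def awalk_def using P uT
    by (intro exI[of _ u]) (auto simp: walk_zip(1,2)[of u T u] simp del: zip_Cons_Cons pcas.simps pawalk_verts.simps)
  moreover have "length ?p = length P" using uT by simp
  then have "3 \<le> length ?p" using P distinct_card[of P] by simp
  moreover have "fst ` set ?p = pverts G"
    using map_fst_zip[of "u # T" "T @ [u]"] P(4) uT by (metis length_Cons length_append_singleton list.set_map)
  ultimately show ?thesis unfolding hamiltonian_def by blast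
qed

lemma hamiltonian_of_induced_paths:
  assumes "k_connected 2 G" "claw_o_heavy G"
    and "\<And>v1 v2 v3 v4 v5 v6. induced_path G [v1, v2, v3, v4, v5, v6] \<Longrightarrow>
      real (max (vertex_degree G v1) (vertex_degree G v6)) \<ge> real (card (pverts G)) / 2"
  shows "hamiltonian G"
proof -
  interpret h: claw_p6_graph "pverts G" ad
  proof unfold_locales
    show "2 < card (pverts G)" using assms(1) unfolding k_connected_def by blast
  qed (rule claw_H[OF assms(2)] path_heavy[OF assms(3)] connected_closed[OF assms(1)]; assumption)+
  show ?thesis using hamiltonianI h.cyc_V by blast
qed

end

theorem theorem8:
  fixes G :: "'a pair_pre_digraph" and n :: nat
  assumes "pair_graph G"
    and "card (pverts G) = n"
    and "k_connected 2 G"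
    and "claw_o_heavy G"
    and "\<And>v1 v2 v3 v4 v5 v6. induced_path G [v1, v2, v3, v4, v5, v6] \<Longrightarrow>
           real (max (vertex_degree G v1) (vertex_degree G v6)) \<ge> real n / 2"
  shows "hamiltonian G"
  using pair_graph.hamiltonian_of_induced_paths[OF assms(1,3,4)] assms(5)[folded assms(2)] by blast

end
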